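(* Let $E,F$ be Banach spaces. (i) If $1\le p\le q<2$, then $W_p^{\mathrm{mid}}(E;F)\subset W_q^{\mathrm{mid}}(E;F)$. (ii) If $1\le p,q<2$ and $E$ and $F^*$ have cotype $2$, then $W_p^{\mathrm{mid}}(E;F)=W_q^{\mathrm{mid}}(E;F)$. (iii) If $1\le p\le q<\infty$ and $E$ and $F^*$ are $\mathcal L_\infty$-spaces, then $W_p^{\mathrm{mid}}(E;F)\subset W_q^{\mathrm{mid}}(E;F)$. (iv) If $1\le p\le 2$, then $W_p^{\mathrm{mid}}(\ell_1;c_0)=\mathcal L(\ell_1;c_0)$.
   Context: Banach spaces are over $\mathbb K=\mathbb R$ or $\mathbb C$; $\mathcal L(E;F)$ is the space of continuous linear operators; $\subset$ means (not necessarily strict) inclusion. For $1\le p<\infty$, $\ell_p^w(E)$ is the space of sequences $(x_j)_{j=1}^\infty$ in $E$ with $\|(x_j)_j\|_{w,p}:=\sup_{\varphi\in B_{E^*}}(\sum_{j}|\varphi(x_j)|^p)^{1/p}<\infty$. The space $\ell_p^{\mathrm{mid}}(F)$ consists of the sequences $(y_j)_{j=1}^\infty$ in $F$ with $\sum_{j=1}^\infty\sum_{n=1}^\infty|y_n^*(y_j)|^p<\infty$ for every $(y_n^* )_n\in\ell_p^w(F^* )$. $W_p^{\mathrm{mid}}(E;F)$ is the set of $T\in\mathcal L(E;F)$ such that $(T(x_j))_j\in\ell_p^{\mathrm{mid}}(F)$ whenever $(x_j)_j\in\ell_p^w(E)$. A space $E$ has cotype $2$ if there is $K\ge0$ with $(\sum_{i=1}^n\|x_i\|^2)^{1/2}\le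 K(\int_0^1\|\sum_{i=1}^n r_i(t)x_i\|^2dt)^{1/2}$ for all $n$ and $x_1,\dots,x_n\in E$, where $r_i$ are the Rademacher functions. $\mathcal L_\infty$-spaces are in the sense of Lindenstrauss–Pełczyński: there is $\lambda\ge 1$ such that every finite-dimensional subspace of the space is contained in a finite-dimensional subspace $G$ whose Banach–Mazur distance to $\ell_\infty^{\dim G}$ is at most $\lambda$. *)

theory Defs
  imports "HOL-Analysis.Analysis"
begin

section \<open>The scalar field\<close>

text \<open>
  The scalar field is a type of the following class, which says that it is (an isometric copy of)
  \<open>\<real>\<close> or \<open>\<complex>\<close>: the multiplicativity of the norm in \<^class>\<open>real_normed_field\<close> forces the usual
  absolute value in both cases.
\<close>

class real_or_complex = real_normed_field + banach +
  assumes real_or_complex: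
    "(\<forall>z. \<exists>a. z = a *\<^sub>R 1) \<or> (\<exists>i. i * i = - 1 \<and> (\<forall>z. \<exists>a b. z = a *\<^sub>R 1 + b *\<^sub>R i))"

instance real :: real_or_complex
  by standard auto

instance complex :: real_or_complex
proof
  have "z = Re z *\<^sub>R 1 + Im z *\<^sub>R \<i>" for z
    by (simp add: complex_eq_iff)
  then show "(\<forall>z::complex. \<exists>a. z = a *\<^sub>R 1) \<or>
    (\<exists>i::complex. i * i = - 1 \<and> (\<forall>z. \<exists>a b. z = a *\<^sub>R 1 + b *\<^sub>R i))"
    by (metis i_squared)
qed


section \<open>Normed spaces over the scalar field\<close>

text \<open>
  A Banach space over \<open>\<K>\<close> is a type of class \<^class>\<open>banach\<close> with a scalar multiplication by \<open>\<K>\<close> that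
  extends the real one. Since the dual of such a space is only a subspace of the type of real-linear
  maps into \<open>\<K>\<close>, the notions below are defined for a linear subspace \<open>S\<close> of a type, with
  scalar multiplication \<open>s\<close>.
\<close>

locale normed_space_over = vector_space s
  for s :: "'k::real_or_complex \<Rightarrow> 'a::real_normed_vector \<Rightarrow> 'a" +
  assumes scale_of_real: "s (of_real r) x = r *\<^sub>R x"
    and norm_scale: "norm (s c x) = norm c * norm x"

definition linear_map_on ::
    "'a set \<Rightarrow> ('k::real_or_complex \<Rightarrow> 'a::real_normed_vector \<Rightarrow> 'a)
      \<Rightarrow> ('k \<Rightarrow> 'b::real_normed_vector \<Rightarrow> 'b) \<Rightarrow> ('a \<Rightarrow> 'b) \<Rightarrow> bool" where
  "linear_map_on S s t u \<longleftrightarrow>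
     (\<forall>x\<in>S. \<forall>y\<in>S. u (x + y) = u x + u y) \<and> (\<forall>c. \<forall>x\<in>S. u (s c x) = t c (u x))"

definition bounded_on :: "'a::real_normed_vector set \<Rightarrow> ('a \<Rightarrow> 'b::real_normed_vector) \<Rightarrow> bool" where
  "bounded_on S u \<longleftrightarrow> (\<exists>C. \<forall>x\<in>S. norm (u x) \<le> C * norm x)"

definition op_norm_on :: "'a::real_normed_vector set \<Rightarrow> ('a \<Rightarrow> 'b::real_normed_vector) \<Rightarrow> real" where
  "op_norm_on S u = (SUP x\<in>{x \<in> S. norm x \<le> 1}. norm (u x))"

definition operators ::
    "('k::real_or_complex \<Rightarrow> 'e::real_normed_vector \<Rightarrow> 'e)
      \<Rightarrow> ('k \<Rightarrow> 'f::real_normed_vector \<Rightarrow> 'f) \<Rightarrow> ('e \<Rightarrow>\<^sub>L 'f) set" where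
  "operators sE sF = {T. Vector_Spaces.linear sE sF (blinfun_apply T)}"

definition dual :: "('k::real_or_complex \<Rightarrow> 'f::real_normed_vector \<Rightarrow> 'f) \<Rightarrow> ('f \<Rightarrow>\<^sub>L 'k) set" where
  "dual sF = operators sF (*)"

definition dual_scale :: "'k::real_or_complex \<Rightarrow> ('f::real_normed_vector \<Rightarrow>\<^sub>L 'k) \<Rightarrow> ('f \<Rightarrow>\<^sub>L 'k)" where
  "dual_scale c f = blinfun_mult_right c o\<^sub>L f"

text \<open>
  The values of a functional outside \<open>S\<close> are irrelevant.
\<close>

definition dual_ball ::
    "'a set \<Rightarrow> ('k::real_or_complex \<Rightarrow> 'a::real_normed_vector \<Rightarrow> 'a) \<Rightarrow> ('a \<Rightarrow> 'k) set" where
  "dual_ball S s = {\<phi>. linear_map_on S s (*) \<phi> \<and> (\<forall>x\<in>S. norm (\<phi> x) \<le> norm x)}"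

lemma normed_space_over_scaleR: "normed_space_over ((*\<^sub>R) :: real \<Rightarrow> 'a \<Rightarrow> 'a::real_normed_vector)"
  by standard (auto simp: algebra_simps)

lemma normed_space_over_scalars: "normed_space_over ((*) :: 'k \<Rightarrow> 'k \<Rightarrow> 'k::real_or_complex)"
  by standard (auto simp: algebra_simps norm_mult scaleR_conv_of_real)

lemma blinfun_apply_dual_scale [simp]: "blinfun_apply (dual_scale c f) x = c * blinfun_apply f x"
  by (simp add: dual_scale_def)

lemma norm_dual_scale: "norm (dual_scale c f) = norm c * norm f"
proof -
  have le: "norm (dual_scale c f) \<le> norm c * norm f" for c and f :: "'a \<Rightarrow>\<^sub>L 'b"
    by (rule norm_blinfun_bound)
       (auto simp: norm_mult mult.assoc intro!: mult_left_mono norm_blinfun)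
  show ?thesis
  proof (cases "c = 0")
    case True
    then show ?thesis using le[of 0 f] by simp
  next
    case False
    have "dual_scale (inverse c) (dual_scale c f) = f"
      by (rule blinfun_eqI) (use False in simp)
    then have "norm f \<le> norm (inverse c) * norm (dual_scale c f)"
      using le[of "inverse c" "dual_scale c f"] by simp
    then have "norm c * norm f \<le> norm (dual_scale c f)"
      using False by (simp add: norm_inverse norm_divide divide_simps mult.commute)
    then show ?thesis using le[of c f] by simp
  qed
qed

lemma normed_space_over_dual: "normed_space_over dual_scale"
  by standard
     (auto intro!: blinfun_eqI simp: norm_dual_scale blinfun.bilinear_simps algebra_simps
        scaleR_conv_of_real)


section \<open>The spaces \<open>\<ell>\<^sub>1\<close> and \<open>c\<^sub>0\<close>\<close>

typedef (overloaded) ('k::real_or_complex) l1 = "{x :: nat \<Rightarrow> 'k. summable (\<lambda>n. norm (x n))}"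
  morphisms l1_nth Abs_l1
  by (rule exI[of _ "\<lambda>_. 0"]) simp

setup_lifting type_definition_l1

lemma summable_l1: "summable (\<lambda>n. norm (l1_nth x n))"
  using l1_nth[of x] by simp

lemma summable_norm_add:
  fixes x y :: "nat \<Rightarrow> 'a::real_normed_vector"
  assumes "summable (\<lambda>n. norm (x n))" "summable (\<lambda>n. norm (y n))"
  shows "summable (\<lambda>n. norm (x n + y n))"
  by (rule summable_comparison_test'[OF summable_add[OF assms], of 0])
     (simp add: norm_triangle_ineq)

lemma summable_norm_diff:
  fixes x y :: "nat \<Rightarrow> 'a::real_normed_vector"
  assumes "summable (\<lambda>n. norm (x n))" "summable (\<lambda>n. norm (y n))"
  shows "summable (\<lambda>n. norm (x n - y n))"
  using summable_norm_add[of x "\<lambda>n. - y n"] assms by simp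

instantiation l1 :: (real_or_complex) real_normed_vector
begin

lift_definition norm_l1 :: "'a l1 \<Rightarrow> real" is "\<lambda>x. \<Sum>n. norm (x n)" .
lift_definition zero_l1 :: "'a l1" is "\<lambda>n. 0" by simp
lift_definition uminus_l1 :: "'a l1 \<Rightarrow> 'a l1" is "\<lambda>x n. - x n" by simp
lift_definition plus_l1 :: "'a l1 \<Rightarrow> 'a l1 \<Rightarrow> 'a l1" is "\<lambda>x y n. x n + y n"
  by (rule summable_norm_add)
lift_definition minus_l1 :: "'a l1 \<Rightarrow> 'a l1 \<Rightarrow> 'a l1" is "\<lambda>x y n. x n - y n"
  by (rule summable_norm_diff)
lift_definition scaleR_l1 :: "real \<Rightarrow> 'a l1 \<Rightarrow> 'a l1" is "\<lambda>r x n. r *\<^sub>R x n"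
  by (simp add: summable_mult)

definition dist_l1 :: "'a l1 \<Rightarrow> 'a l1 \<Rightarrow> real" where "dist_l1 x y = norm (x - y)"
definition sgn_l1 :: "'a l1 \<Rightarrow> 'a l1" where "sgn_l1 x = inverse (norm x) *\<^sub>R x"
definition uniformity_l1 :: "('a l1 \<times> 'a l1) filter" where
  "uniformity_l1 = (INF e\<in>{0<..}. principal {(x, y). dist x y < e})"
definition open_l1 :: "'a l1 set \<Rightarrow> bool" where
  "open_l1 U \<longleftrightarrow> (\<forall>x\<in>U. \<forall>\<^sub>F (x', y) in uniformity. x' = x \<longrightarrow> y \<in> U)"

instance
proof
  fix x y z :: "'a l1" and a b :: real
  show "norm (x + y) \<le> norm x + norm y"
  proof transfer
    fix x y :: "nat \<Rightarrow> 'a"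
    assume xy: "summable (\<lambda>n. norm (x n))" "summable (\<lambda>n. norm (y n))"
    have "(\<Sum>n. norm (x n + y n)) \<le> (\<Sum>n. norm (x n) + norm (y n))"
      by (intro suminf_le norm_triangle_ineq summable_norm_add summable_add xy)
    then show "(\<Sum>n. norm (x n + y n)) \<le> (\<Sum>n. norm (x n)) + (\<Sum>n. norm (y n))"
      using suminf_add[OF xy] by simp
  qed
  show "norm x = 0 \<longleftrightarrow> x = 0"
    by transfer (auto simp: suminf_eq_zero_iff fun_eq_iff)
  show "norm (a *\<^sub>R x) = \<bar>a\<bar> * norm x"
    by transfer (simp add: suminf_mult)
qed (transfer; simp add: algebra_simps dist_l1_def sgn_l1_def uniformity_l1_def open_l1_def; fail
   | simp add: dist_l1_def sgn_l1_def uniformity_l1_def open_l1_def)+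

end

lemma l1_nth_minus: "l1_nth (x - y) n = l1_nth x n - l1_nth y n"
  by transfer simp

lemma norm_l1_nth_le: "norm (l1_nth x n) \<le> norm x"
proof transfer
  fix x :: "nat \<Rightarrow> 'a" and n assume "summable (\<lambda>n. norm (x n))"
  from sum_le_suminf[OF this, of "{n}"] show "norm (x n) \<le> (\<Sum>n. norm (x n))" by simp
qed

lemma sum_norm_l1_le: "(\<Sum>k<K. norm (l1_nth x k)) \<le> norm x"
  by transfer (rule sum_le_suminf; simp)

instance l1 :: (real_or_complex) banach
proof
  fix X :: "nat \<Rightarrow> 'a l1" assume X: "Cauchy X"
  have "Cauchy (\<lambda>m. l1_nth (X m) k)" for k
  proof (rule CauchyI)
    fix e :: real assume "0 < e"
    then obtain N where "\<forall>m\<ge>N. \<forall>n\<ge>N. norm (X m - X n) < e" using CauchyD[OF X] by blast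
    then show "\<exists>M. \<forall>m\<ge>M. \<forall>n\<ge>M. norm (l1_nth (X m) k - l1_nth (X n) k) < e"
      by (metis l1_nth_minus norm_l1_nth_le le_less_trans)
  qed
  then have "\<forall>k. \<exists>l. (\<lambda>m. l1_nth (X m) k) \<longlonglongrightarrow> l"
    using Cauchy_convergent_iff convergent_def by blast
  then obtain L where L: "\<And>k. (\<lambda>m. l1_nth (X m) k) \<longlonglongrightarrow> L k" by metis
  have part: "(\<Sum>k<K. norm (l1_nth (X m) k - L k)) \<le> e"
    if N: "\<forall>m\<ge>N. \<forall>n\<ge>N. norm (X m - X n) < e" and m: "m \<ge> N" for e N m K
  proof (rule tendsto_upperbound)
    show "(\<lambda>n. \<Sum>k<K. norm (l1_nth (X m) k - l1_nth (X n) k))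
        \<longlonglongrightarrow> (\<Sum>k<K. norm (l1_nth (X m) k - L k))"
      by (intro tendsto_intros L)
    show "\<forall>\<^sub>F n in sequentially. (\<Sum>k<K. norm (l1_nth (X m) k - l1_nth (X n) k)) \<le> e"
      unfolding eventually_sequentially
    proof (intro exI allI impI)
      fix n assume "N \<le> n"
      have "(\<Sum>k<K. norm (l1_nth (X m) k - l1_nth (X n) k)) \<le> norm (X m - X n)"
        using sum_norm_l1_le[of "X m - X n" K] by (simp add: l1_nth_minus)
      also have "\<dots> \<le> e" using N m \<open>N \<le> n\<close> by (simp add: less_imp_le)
      finally show "(\<Sum>k<K. norm (l1_nth (X m) k - l1_nth (X n) k)) \<le> e" .
    qed
  qed simp
  have summ: "summable (\<lambda>k. norm (l1_nth (X m) k - L k))"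
    if "\<forall>m\<ge>N. \<forall>n\<ge>N. norm (X m - X n) < e" and "m \<ge> N" for e N m
    by (rule summableI_nonneg_bounded[where x = e]) (use part[OF that] in auto)
  obtain N where N: "\<forall>m\<ge>N. \<forall>n\<ge>N. norm (X m - X n) < 1"
    using CauchyD[OF X, of 1] by auto
  have "summable (\<lambda>k. norm (l1_nth (X N) k - (l1_nth (X N) k - L k)))"
    by (rule summable_norm_diff[OF summable_l1 summ[OF N order_refl]])
  then have sL: "summable (\<lambda>k. norm (L k))" by simp
  define Y where "Y = Abs_l1 L"
  have Y: "l1_nth Y = L" unfolding Y_def using sL by (simp add: Abs_l1_inverse)
  have "X \<longlonglongrightarrow> Y"
  proof (rule LIMSEQ_I)
    fix r :: real assume "0 < r"
    then obtain N where N: "\<forall>m\<ge>N. \<forall>n\<ge>N. norm (X m - X n) < r / 2"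
      using CauchyD[OF X, of "r / 2"] by auto
    have "norm (X m - Y) < r" if m: "m \<ge> N" for m
    proof -
      have "norm (X m - Y) = (\<Sum>k. norm (l1_nth (X m) k - L k))"
        by (simp add: norm_l1.rep_eq l1_nth_minus Y)
      also have "\<dots> \<le> r / 2"
        by (rule suminf_le_const[OF summ[OF N m]]) (use part[OF N m] in auto)
      finally show ?thesis using \<open>0 < r\<close> by simp
    qed
    then show "\<exists>N. \<forall>m\<ge>N. norm (X m - Y) < r" by blast
  qed
  then show "convergent X" by (rule convergentI)
qed

lift_definition l1_scale :: "'k::real_or_complex \<Rightarrow> 'k l1 \<Rightarrow> 'k l1" is "\<lambda>c x n. c * x n"
  by (simp add: norm_mult summable_mult)

lemma normed_space_over_l1: "normed_space_over l1_scale"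
  by standard (transfer; simp add: algebra_simps norm_mult scaleR_conv_of_real suminf_mult)+

typedef (overloaded) ('k::real_or_complex) c0 = "{x :: nat \<Rightarrow> 'k. x \<longlonglongrightarrow> 0}"
  morphisms c0_nth Abs_c0
  by (rule exI[of _ "\<lambda>_. 0"]) simp

setup_lifting type_definition_c0

lemma bdd_above_norm_null_seq:
  fixes x :: "nat \<Rightarrow> 'a::real_normed_vector"
  assumes "x \<longlonglongrightarrow> 0"
  shows "bdd_above (range (\<lambda>n. norm (x n)))"
proof -
  have "Bseq x" using assms by (simp add: convergentI convergent_imp_Bseq)
  then show ?thesis unfolding Bseq_def by (meson bdd_above.I2)
qed

lemma norm_le_SUP_null_seq:
  fixes x :: "nat \<Rightarrow> 'a::real_normed_vector"
  assumes "x \<longlonglongrightarrow> 0"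
  shows "norm (x n) \<le> (SUP n. norm (x n))"
  by (rule cSUP_upper[OF _ bdd_above_norm_null_seq[OF assms]]) simp

instantiation c0 :: (real_or_complex) real_normed_vector
begin

lift_definition norm_c0 :: "'a c0 \<Rightarrow> real" is "\<lambda>x. SUP n. norm (x n)" .
lift_definition zero_c0 :: "'a c0" is "\<lambda>n. 0" by simp
lift_definition uminus_c0 :: "'a c0 \<Rightarrow> 'a c0" is "\<lambda>x n. - x n"
  using tendsto_minus by fastforce
lift_definition plus_c0 :: "'a c0 \<Rightarrow> 'a c0 \<Rightarrow> 'a c0" is "\<lambda>x y n. x n + y n"
  using tendsto_add by fastforce
lift_definition minus_c0 :: "'a c0 \<Rightarrow> 'a c0 \<Rightarrow> 'a c0" is "\<lambda>x y n. x n - y n"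
  using tendsto_diff by fastforce
lift_definition scaleR_c0 :: "real \<Rightarrow> 'a c0 \<Rightarrow> 'a c0" is "\<lambda>r x n. r *\<^sub>R x n"
  using tendsto_scaleR[OF tendsto_const] by fastforce

definition dist_c0 :: "'a c0 \<Rightarrow> 'a c0 \<Rightarrow> real" where "dist_c0 x y = norm (x - y)"
definition sgn_c0 :: "'a c0 \<Rightarrow> 'a c0" where "sgn_c0 x = inverse (norm x) *\<^sub>R x"
definition uniformity_c0 :: "('a c0 \<times> 'a c0) filter" where
  "uniformity_c0 = (INF e\<in>{0<..}. principal {(x, y). dist x y < e})"
definition open_c0 :: "'a c0 set \<Rightarrow> bool" where
  "open_c0 U \<longleftrightarrow> (\<forall>x\<in>U. \<forall>\<^sub>F (x', y) in uniformity. x' = x \<longrightarrow> y \<in> U)"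

instance
proof
  fix x y z :: "'a c0" and a b :: real
  show "norm (x + y) \<le> norm x + norm y"
  proof transfer
    fix x y :: "nat \<Rightarrow> 'a" assume xy: "x \<longlonglongrightarrow> 0" "y \<longlonglongrightarrow> 0"
    show "(SUP n. norm (x n + y n)) \<le> (SUP n. norm (x n)) + (SUP n. norm (y n))"
      by (rule cSUP_least)
         (auto intro!: norm_triangle_le add_mono norm_le_SUP_null_seq xy)
  qed
  show "norm x = 0 \<longleftrightarrow> x = 0"
  proof transfer
    fix x :: "nat \<Rightarrow> 'a" assume x: "x \<longlonglongrightarrow> 0"
    show "(SUP n. norm (x n)) = 0 \<longleftrightarrow> x = (\<lambda>n. 0)"
      using norm_le_SUP_null_seq[OF x] by (fastforce simp: fun_eq_iff)
  qed
  show "norm (a *\<^sub>R x) = \<bar>a\<bar> * norm x"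
  proof transfer
    fix a and x :: "nat \<Rightarrow> 'a" assume x: "x \<longlonglongrightarrow> 0"
    have "\<bar>a\<bar> * (SUP n. norm (x n)) = (SUP n. \<bar>a\<bar> * norm (x n))"
      using continuous_at_Sup_mono[of "\<lambda>t. \<bar>a\<bar> * t" "range (\<lambda>n. norm (x n))"]
        bdd_above_norm_null_seq[OF x]
      by (simp add: image_comp comp_def mono_def mult_left_mono continuous_intros)
    then show "(SUP n. norm (a *\<^sub>R x n)) = \<bar>a\<bar> * (SUP n. norm (x n))" by simp
  qed
qed (transfer; simp add: algebra_simps dist_c0_def sgn_c0_def uniformity_c0_def open_c0_def; fail
   | simp add: dist_c0_def sgn_c0_def uniformity_c0_def open_c0_def)+

end

lemma c0_nth_minus: "c0_nth (x - y) n = c0_nth x n - c0_nth y n"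
  by transfer simp

lemma norm_c0_nth_le: "norm (c0_nth x n) \<le> norm x"
  by transfer (rule norm_le_SUP_null_seq)

instance c0 :: (real_or_complex) banach
proof
  fix X :: "nat \<Rightarrow> 'a c0" assume X: "Cauchy X"
  have "Cauchy (\<lambda>m. c0_nth (X m) k)" for k
  proof (rule CauchyI)
    fix e :: real assume "0 < e"
    then obtain N where "\<forall>m\<ge>N. \<forall>n\<ge>N. norm (X m - X n) < e" using CauchyD[OF X] by blast
    then show "\<exists>M. \<forall>m\<ge>M. \<forall>n\<ge>M. norm (c0_nth (X m) k - c0_nth (X n) k) < e"
      by (metis c0_nth_minus norm_c0_nth_le le_less_trans)
  qed
  then have "\<forall>k. \<exists>l. (\<lambda>m. c0_nth (X m) k) \<longlonglongrightarrow> l"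
    using Cauchy_convergent_iff convergent_def by blast
  then obtain L where L: "\<And>k. (\<lambda>m. c0_nth (X m) k) \<longlonglongrightarrow> L k" by metis
  have bound: "norm (c0_nth (X m) k - L k) \<le> e"
    if N: "\<forall>m\<ge>N. \<forall>n\<ge>N. norm (X m - X n) < e" and m: "m \<ge> N" for e N m k
  proof (rule tendsto_upperbound)
    show "(\<lambda>n. norm (c0_nth (X m) k - c0_nth (X n) k)) \<longlonglongrightarrow> norm (c0_nth (X m) k - L k)"
      by (intro tendsto_intros L)
    show "\<forall>\<^sub>F n in sequentially. norm (c0_nth (X m) k - c0_nth (X n) k) \<le> e"
      unfolding eventually_sequentially
      using N m by (metis c0_nth_minus norm_c0_nth_le le_less_trans less_imp_le)
  qed simp
  have L0: "L \<longlonglongrightarrow> 0"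
  proof (rule LIMSEQ_I)
    fix r :: real assume "0 < r"
    then obtain N where N: "\<forall>m\<ge>N. \<forall>n\<ge>N. norm (X m - X n) < r / 2"
      using CauchyD[OF X, of "r / 2"] by auto
    have "c0_nth (X N) \<longlonglongrightarrow> 0" using c0_nth[of "X N"] by simp
    then obtain M where M: "\<forall>k\<ge>M. norm (c0_nth (X N) k) < r / 2"
      using LIMSEQ_D[of "c0_nth (X N)" 0 "r / 2"] \<open>0 < r\<close> by auto
    have "norm (L k) < r" if "k \<ge> M" for k
    proof -
      have "norm (L k) \<le> norm (c0_nth (X N) k) + norm (c0_nth (X N) k - L k)"
        by (metis norm_minus_commute norm_triangle_sub)
      also have "\<dots> < r / 2 + r / 2"
        by (rule add_less_le_mono) (use M that bound[OF N order_refl] in auto)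
      finally show ?thesis by simp
    qed
    then show "\<exists>M. \<forall>k\<ge>M. norm (L k - 0) < r" by auto
  qed
  define Y where "Y = Abs_c0 L"
  have Y: "c0_nth Y = L" unfolding Y_def using L0 by (simp add: Abs_c0_inverse)
  have "X \<longlonglongrightarrow> Y"
  proof (rule LIMSEQ_I)
    fix r :: real assume "0 < r"
    then obtain N where N: "\<forall>m\<ge>N. \<forall>n\<ge>N. norm (X m - X n) < r / 2"
      using CauchyD[OF X, of "r / 2"] by auto
    have "norm (X m - Y) < r" if m: "m \<ge> N" for m
    proof -
      have "norm (X m - Y) = (SUP k. norm (c0_nth (X m) k - L k))"
        by (simp add: norm_c0.rep_eq c0_nth_minus Y)
      also have "\<dots> \<le> r / 2"
        by (rule cSUP_least) (use bound[OF N m] in auto)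
      finally show ?thesis using \<open>0 < r\<close> by simp
    qed
    then show "\<exists>N. \<forall>m\<ge>N. norm (X m - Y) < r" by blast
  qed
  then show "convergent X" by (rule convergentI)
qed

lift_definition c0_scale :: "'k::real_or_complex \<Rightarrow> 'k c0 \<Rightarrow> 'k c0" is "\<lambda>c x n. c * x n"
  using tendsto_mult[OF tendsto_const] by fastforce

lemma norm_c0_scale: "norm (c0_scale c x) = norm c * norm x"
proof -
  have "norm (c0_scale c x) = norm (norm c *\<^sub>R x)"
    by transfer (simp add: norm_mult)
  then show ?thesis by simp
qed

lemma normed_space_over_c0: "normed_space_over c0_scale"
  by standard
     (simp add: norm_c0_scale; fail | transfer; simp add: algebra_simps scaleR_conv_of_real)+


section \<open>Sequence spaces and the operator classes\<close>

text \<open>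
  The membership of \<open>x\<close> in \<open>\<ell>\<^sub>p\<^sup>w\<close>: the supremum that defines the weak norm is finite.
\<close>

definition weakly_summable ::
    "real \<Rightarrow> 'a set \<Rightarrow> ('k::real_or_complex \<Rightarrow> 'a::real_normed_vector \<Rightarrow> 'a) \<Rightarrow> (nat \<Rightarrow> 'a) set" where
  "weakly_summable p S s = {x. (\<forall>j. x j \<in> S) \<and>
     (\<exists>C. \<forall>\<phi>\<in>dual_ball S s. summable (\<lambda>j. norm (\<phi> (x j)) powr p) \<and>
        (\<Sum>j. norm (\<phi> (x j)) powr p) powr (1 / p) \<le> C)}"

definition mid_summable ::
    "real \<Rightarrow> ('k::real_or_complex \<Rightarrow> 'f::real_normed_vector \<Rightarrow> 'f) \<Rightarrow> (nat \<Rightarrow> 'f) set" where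
  "mid_summable p sF = {y. \<forall>ys \<in> weakly_summable p (dual sF) dual_scale.
     (\<Sum>j. \<Sum>n. ennreal (norm (blinfun_apply (ys n) (y j)) powr p)) < \<infinity>}"

definition W_mid ::
    "real \<Rightarrow> ('k::real_or_complex \<Rightarrow> 'e::real_normed_vector \<Rightarrow> 'e)
      \<Rightarrow> ('k \<Rightarrow> 'f::real_normed_vector \<Rightarrow> 'f) \<Rightarrow> ('e \<Rightarrow>\<^sub>L 'f) set" where
  "W_mid p sE sF = {T \<in> operators sE sF.
     \<forall>x \<in> weakly_summable p UNIV sE. (\<lambda>j. blinfun_apply T (x j)) \<in> mid_summable p sF}"


section \<open>Cotype 2 and \<open>\<L>\<^sub>\<infinity>\<close>-spaces\<close>

definition rademacher :: "nat \<Rightarrow> real \<Rightarrow> real" where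
  "rademacher i t = sgn (sin (2 ^ i * pi * t))"

definition cotype_2 :: "'a::real_normed_vector set \<Rightarrow> bool" where
  "cotype_2 S \<longleftrightarrow> (\<exists>K\<ge>0. \<forall>n. \<forall>x. (\<forall>i\<in>{1..n}. x i \<in> S) \<longrightarrow>
     sqrt (\<Sum>i=1..n. (norm (x i))\<^sup>2)
       \<le> K * sqrt (LINT t:{0..1}|lborel. (norm (\<Sum>i=1..n. rademacher i t *\<^sub>R x i))\<^sup>2))"

definition finite_dim_subspace ::
    "('k::real_or_complex \<Rightarrow> 'a::real_normed_vector \<Rightarrow> 'a) \<Rightarrow> 'a set \<Rightarrow> bool" where
  "finite_dim_subspace s V \<longleftrightarrow> (\<exists>B. finite B \<and> module.span s B = V)"

text \<open>
  The value is \<open>\<infinity>\<close> (the infimum of the empty set) if \<open>G\<close> and \<open>H\<close> are not isomorphic.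
\<close>

definition banach_mazur ::
    "('k::real_or_complex \<Rightarrow> 'a::real_normed_vector \<Rightarrow> 'a) \<Rightarrow> 'a set
      \<Rightarrow> ('k \<Rightarrow> 'b::real_normed_vector \<Rightarrow> 'b) \<Rightarrow> 'b set \<Rightarrow> ennreal" where
  "banach_mazur s G t H =
     (INF u \<in> {u. linear_map_on G s t u \<and> bij_betw u G H \<and>
                  bounded_on G u \<and> bounded_on H (inv_into G u)}.
        ennreal (op_norm_on G u * op_norm_on H (inv_into G u)))"

text \<open>
  The space \<open>\<ell>\<^sub>\<infinity>\<^sup>n\<close> as the subspace of \<open>c\<^sub>0\<close> of the sequences supported in the first \<open>n\<close> coordinates,
  on which the norm of \<open>c\<^sub>0\<close> is the maximum norm.
\<close>

definition linf :: "nat \<Rightarrow> ('k::real_or_complex) c0 set" where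
  "linf n = {x. \<forall>k\<ge>n. c0_nth x k = 0}"

definition L_infinity_space ::
    "'a set \<Rightarrow> ('k::real_or_complex \<Rightarrow> 'a::real_normed_vector \<Rightarrow> 'a) \<Rightarrow> bool" where
  "L_infinity_space S s \<longleftrightarrow> (\<exists>l::real. l \<ge> 1 \<and>
     (\<forall>V. finite_dim_subspace s V \<and> V \<subseteq> S \<longrightarrow>
        (\<exists>G. finite_dim_subspace s G \<and> V \<subseteq> G \<and> G \<subseteq> S \<and>
           banach_mazur s G c0_scale (linf (vector_space.dim s G)) \<le> ennreal l)))"

end

theory Submission
  imports Defs
begin

text \<open>
  All four parts are statements about finite families with uniform constants: \<open>T\<close> belongs to
  \<open>W_mid p\<close> iff there is a \<open>C\<close> with \<open>\<Sum>i j. |y j (T (x i))|^p \<le> C\<close> for all finite families \<open>x\<close> in \<open>E\<close>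
  and \<open>y\<close> in \<open>F*\<close> whose weak \<open>p\<close>-norms are at most 1 (\<open>W_mid_iff_mid_bounded\<close>). Without such a
  constant, ever worse families could be scaled down and glued to one pair of sequences for which
  the double series diverges.

  The inclusion \<open>W_mid p \<subseteq> W_mid q\<close> for \<open>p < q \<le> 2\<close> holds because finite-dimensional \<open>\<ell>\<^sub>q\<close>-spaces
  embed into finite-dimensional \<open>\<ell>\<^sub>p\<close>-spaces, with constants that do not depend on the dimension
  (\<open>lq_embeds_into_lp\<close>). The embedding maps the unit vectors to random variables of the form random
  sign times \<open>2^k\<close>, where \<open>2^k\<close> occurs with probability about \<open>2^(- q k)\<close>; for \<open>q = 2\<close> random signs
  alone suffice, by Khintchine's inequality. Applied to a weakly \<open>q\<close>-summable family \<open>y\<close> this yields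
  a weakly \<open>p\<close>-summable family whose values at a vector have a \<open>p\<close>-norm comparable to the \<open>q\<close>-norm
  of the values of \<open>y\<close>. The passage from weakly \<open>q\<close>-summable to weakly \<open>p\<close>-summable families \<open>x\<close> is
  the usual one by multipliers, as in the proof that \<open>p\<close>-summing operators are \<open>q\<close>-summing.

  If \<open>E\<close> and \<open>F*\<close> have cotype 2, it remains to see that \<open>W_mid q \<subseteq> W_mid 1\<close> for \<open>q < 2\<close>. An operator
  from \<open>\<ell>\<^sub>\<infinity>\<close> to a space of cotype 2 is (2,1)-summing, and an argument of Pisier bounds it by the
  norm of \<open>L\<^sub>r\<close> of a probability measure, for each \<open>r > 2\<close> (\<open>orlicz_imp_lr_dominated\<close>). This says
  that each weakly 1-summable family is the product of a scalar family in \<open>\<ell>\<^sub>r\<close> and a weakly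
  \<open>q\<close>-summable family, where \<open>1/q + 1/r = 1\<close> (\<open>weak1_factorization\<close>). With this for \<open>E\<close> and for
  \<open>F*\<close>, the inclusion is Hoelder's inequality.

  If \<open>E\<close> and \<open>F*\<close> are \<open>\<L>\<^sub>\<infinity>\<close>-spaces, the first inclusion settles the case \<open>q \<le> 2\<close>, and for \<open>q > 2\<close>
  all operators belong to \<open>W_mid q\<close>: finitely many vectors of \<open>F\<close> have coordinates in which their
  norms are \<open>\<ell>\<^sub>1\<close>-norms, so \<open>F\<close> shares with \<open>\<ell>\<^sub>1\<close> the property that is used above in place of cotype
  2; since \<open>E\<close> is locally \<open>\<ell>\<^sub>\<infinity>\<close>, the same domination theorem shows that \<open>T\<close> is \<open>q\<close>-summing.

  For operators from \<open>\<ell>\<^sub>1\<close> to \<open>c\<^sub>0\<close> it suffices to treat \<open>p = 1\<close>. In coordinates, the claim is a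
  form of Grothendieck's inequality (\<open>finite_grothendieck\<close>): the tensor product of two bounded
  bilinear forms on \<open>\<ell>\<^sub>\<infinity> \<times> \<ell>\<^sub>\<infinity>\<close> is bounded. Domination by an \<open>L\<^sub>4\<close>-norm and Khintchine's inequality,
  used in \<open>L\<^sub>4\<close> and in \<open>\<ell>\<^sub>1\<close>, show that an operator from \<open>\<ell>\<^sub>\<infinity>\<close> to \<open>\<ell>\<^sub>1\<close> respects square functions
  (\<open>l1_krivine\<close>). For one of the forms this is used directly, for the other one it gives domination
  by an \<open>L\<^sub>2\<close>-norm.
\<close>

section \<open>The scalar field\<close>

text \<open>
  The norm is multiplicative, so it is bounded by 1 on the unit circle, because the powers of an
  element of the circle stay on the circle and thus have norm at most 2. On the circle the conjugate
  is the inverse, which makes the norm equal to 1 there.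
\<close>

lemma norm_sq_complex_coords:
  fixes i :: "'k::real_or_complex"
  assumes i: "i * i = - 1"
  shows "(norm (a *\<^sub>R 1 + b *\<^sub>R i))\<^sup>2 = a\<^sup>2 + b\<^sup>2"
proof -
  have "norm i * norm i = 1"
    using i by (metis norm_minus_cancel norm_mult norm_one)
  then have ni: "norm i = 1"
    by (metis abs_norm_cancel abs_mult_self_eq power2_eq_square real_sqrt_abs real_sqrt_one)
  have mult: "(a *\<^sub>R 1 + b *\<^sub>R i) * (c *\<^sub>R 1 + d *\<^sub>R i) = (a*c - b*d) *\<^sub>R 1 + (a*d + b*c) *\<^sub>R i" for a b c d
  proof -
    have "(a *\<^sub>R 1 + b *\<^sub>R i) * (c *\<^sub>R 1 + d *\<^sub>R i)
      = (a*c) *\<^sub>R 1 + (a*d) *\<^sub>R i + (b*c) *\<^sub>R i + (b*d) *\<^sub>R (i*i)"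
      by (simp add: algebra_simps)
    then show ?thesis by (simp add: i algebra_simps)
  qed
  have le1: "norm (a *\<^sub>R 1 + b *\<^sub>R i) \<le> 1" if ab: "a\<^sup>2 + b\<^sup>2 = 1" for a b
  proof (rule ccontr)
    let ?z = "a *\<^sub>R 1 + b *\<^sub>R i"
    assume "\<not> norm ?z \<le> 1"
    then obtain n where n: "2 < norm ?z ^ n"
      using real_arch_pow[of "norm ?z" 2] by auto
    have "\<exists>c d. ?z ^ n = c *\<^sub>R 1 + d *\<^sub>R i \<and> c\<^sup>2 + d\<^sup>2 = 1"
    proof (induction n)
      case 0
      show ?case by (rule exI[of _ 1], rule exI[of _ 0]) simp
    next
      case (Suc n)
      then obtain c d where cd: "?z ^ n = c *\<^sub>R 1 + d *\<^sub>R i" "c\<^sup>2 + d\<^sup>2 = 1" by blast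
      have "(a*c - b*d)\<^sup>2 + (a*d + b*c)\<^sup>2 = (a\<^sup>2 + b\<^sup>2) * (c\<^sup>2 + d\<^sup>2)"
        by (simp add: power2_eq_square algebra_simps)
      then show ?case using cd ab mult[of a b c d] by auto
    qed
    then obtain c d where cd: "?z ^ n = c *\<^sub>R 1 + d *\<^sub>R i" "c\<^sup>2 + d\<^sup>2 = 1" by blast
    have "c\<^sup>2 \<le> 1" "d\<^sup>2 \<le> 1" using cd(2)
      by (metis le_add_same_cancel1 zero_le_power2, metis le_add_same_cancel2 zero_le_power2)
    then have "\<bar>c\<bar> \<le> 1" "\<bar>d\<bar> \<le> 1" by (auto simp: abs_square_le_1)
    moreover have "norm ?z ^ n \<le> \<bar>c\<bar> + \<bar>d\<bar>"
      unfolding norm_power[symmetric] cd(1) by (rule order_trans[OF norm_triangle_ineq]) (simp add: ni)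
    ultimately show False using n by linarith
  qed
  have eq1: "norm (a *\<^sub>R 1 + b *\<^sub>R i) = 1" if ab: "a\<^sup>2 + b\<^sup>2 = 1" for a b
  proof -
    have "(a *\<^sub>R 1 + b *\<^sub>R i) * (a *\<^sub>R 1 + (-b) *\<^sub>R i) = 1"
      unfolding mult using ab by (simp add: power2_eq_square)
    then have "norm (a *\<^sub>R 1 + b *\<^sub>R i) * norm (a *\<^sub>R 1 + (-b) *\<^sub>R i) = 1"
      by (metis norm_mult norm_one)
    moreover have "norm (a *\<^sub>R 1 + (-b) *\<^sub>R i) \<le> 1" by (rule le1) (use ab in simp)
    ultimately have "norm (a *\<^sub>R 1 + b *\<^sub>R i) \<ge> 1"
      by (metis mult_left_le norm_ge_zero)
    then show ?thesis using le1[OF ab] by simp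
  qed
  show ?thesis
  proof (cases "a\<^sup>2 + b\<^sup>2 = 0")
    case True
    then show ?thesis by (simp add: sum_power2_eq_zero_iff)
  next
    case False
    define r where "r = sqrt (a\<^sup>2 + b\<^sup>2)"
    have r: "r > 0" "r\<^sup>2 = a\<^sup>2 + b\<^sup>2" using False unfolding r_def
      by (auto simp: sum_power2_gt_zero_iff)
    have "norm ((a/r) *\<^sub>R 1 + (b/r) *\<^sub>R i) = 1"
      by (rule eq1) (use r False in \<open>simp add: power_divide add_divide_distrib[symmetric]\<close>)
    moreover have "a *\<^sub>R 1 + b *\<^sub>R i = r *\<^sub>R ((a/r) *\<^sub>R 1 + (b/r) *\<^sub>R i)"
      using r by (simp add: algebra_simps)
    ultimately have "norm (a *\<^sub>R 1 + b *\<^sub>R i) = r" using r by simp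
    then show ?thesis using r by simp
  qed
qed

definition phase :: "'k::real_or_complex \<Rightarrow> 'k" where
  "phase z = (if z = 0 then 0 else of_real (norm z) / z)"

lemma norm_phase_le: "norm (phase z) \<le> 1"
  by (simp add: phase_def norm_divide)

lemma phase_mult: "phase z * z = of_real (norm z)"
  by (simp add: phase_def)

text \<open>
  Either the scalars are the real numbers, or the real part function \<open>\<rho>\<close> recovers a scalar from
  its values at \<open>z\<close> and \<open>i * z\<close>.
\<close>

lemma real_part_exists:
  obtains \<rho> :: "'k::real_or_complex \<Rightarrow> real" where
    "linear \<rho>" "\<And>z. \<bar>\<rho> z\<bar> \<le> norm z" "\<And>r. \<rho> (of_real r) = r"
    "(\<forall>z. z = of_real (\<rho> z)) \<or> (\<exists>i. i * i = - 1 \<and> (\<forall>z. z = of_real (\<rho> z) - i * of_real (\<rho> (i * z))))"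
proof -
  consider (R) "\<forall>z::'k. \<exists>a. z = a *\<^sub>R 1"
    | (C) i :: 'k where "i * i = - 1" "\<forall>z. \<exists>a b. z = a *\<^sub>R 1 + b *\<^sub>R i"
    using real_or_complex by blast
  then show thesis
  proof cases
    case R
    then obtain \<rho> :: "'k \<Rightarrow> real" where \<rho>: "\<And>z. z = \<rho> z *\<^sub>R 1" by metis
    have eqI: "\<rho> z = a" if "z = a *\<^sub>R 1" for z a
      using \<rho>[of z] that by (metis scaleR_cancel_right zero_neq_one)
    have "linear \<rho>"
    proof
      fix x y :: 'k and r :: real
      show "\<rho> (x + y) = \<rho> x + \<rho> y" by (rule eqI) (metis \<rho> scaleR_add_left)
      show "\<rho> (r *\<^sub>R x) = r *\<^sub>R \<rho> x"
        by (rule eqI) (metis \<rho> real_scaleR_def scaleR_scaleR)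
    qed
    moreover have "\<bar>\<rho> z\<bar> \<le> norm z" for z
      by (subst (2) \<rho>) simp
    moreover have "\<rho> (of_real r) = r" for r by (rule eqI) (simp add: of_real_def)
    moreover have "\<forall>z. z = of_real (\<rho> z)" using \<rho> by (simp add: of_real_def)
    ultimately show ?thesis using that by blast
  next
    case C
    then obtain \<rho> \<sigma> :: "'k \<Rightarrow> real" where \<rho>: "\<And>z. z = \<rho> z *\<^sub>R 1 + \<sigma> z *\<^sub>R i" by metis
    note nrm = norm_sq_complex_coords[OF C(1)]
    have eqI: "\<rho> z = a \<and> \<sigma> z = b" if "z = a *\<^sub>R 1 + b *\<^sub>R i" for z a b
    proof -
      have "(\<rho> z - a) *\<^sub>R 1 + (\<sigma> z - b) *\<^sub>R i = (\<rho> z *\<^sub>R 1 + \<sigma> z *\<^sub>R i) - (a *\<^sub>R 1 + b *\<^sub>R i)" 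
        by (simp add: algebra_simps)
      also have "\<dots> = 0" using \<rho>[of z] that by simp
      finally have "(\<rho> z - a)\<^sup>2 + (\<sigma> z - b)\<^sup>2 = 0"
        using nrm[of "\<rho> z - a" "\<sigma> z - b"] by simp
      then show ?thesis by (simp add: sum_power2_eq_zero_iff)
    qed
    have "linear \<rho>"
    proof
      fix x y :: 'k and r :: real
      have "x + y = (\<rho> x + \<rho> y) *\<^sub>R 1 + (\<sigma> x + \<sigma> y) *\<^sub>R i"
        using \<rho>[of x] \<rho>[of y] by (simp add: algebra_simps)
      then show "\<rho> (x + y) = \<rho> x + \<rho> y" using eqI by blast
      have "r *\<^sub>R x = (r * \<rho> x) *\<^sub>R 1 + (r * \<sigma> x) *\<^sub>R i"
        using arg_cong[OF \<rho>[of x], of "scaleR r"] by (simp add: algebra_simps)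
      then show "\<rho> (r *\<^sub>R x) = r *\<^sub>R \<rho> x" using eqI by auto
    qed
    moreover have "\<bar>\<rho> z\<bar> \<le> norm z" for z
    proof -
      have "(\<rho> z)\<^sup>2 \<le> (norm z)\<^sup>2" using nrm[of "\<rho> z" "\<sigma> z"] \<rho>[of z] by simp
      then show ?thesis using abs_le_square_iff[of "\<rho> z" "norm z"] by simp
    qed
    moreover have "\<rho> (of_real r) = r" for r using eqI[of "of_real r" r 0] by (simp add: of_real_def)
    moreover have "z = of_real (\<rho> z) - i * of_real (\<rho> (i * z))" for z
    proof -
      have "i * z = (- \<sigma> z) *\<^sub>R 1 + \<rho> z *\<^sub>R i"
        using arg_cong[OF \<rho>[of z], of "\<lambda>w. i * w"] C(1) by (simp add: algebra_simps)
      then have "\<rho> (i * z) = - \<sigma> z" using eqI by blast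
      then show ?thesis using \<rho>[of z] by (simp add: of_real_def)
    qed
    ultimately show ?thesis using that C(1) by blast
  qed
qed

lemma scalar_parallelogram:
  fixes z w :: "'k::real_or_complex"
  shows "(norm (z + w))\<^sup>2 + (norm (z - w))\<^sup>2 = 2 * (norm z)\<^sup>2 + 2 * (norm w)\<^sup>2"
proof -
  consider (R) "\<forall>z::'k. \<exists>a. z = a *\<^sub>R 1"
    | (C) i :: 'k where "i * i = - 1" "\<forall>z. \<exists>a b. z = a *\<^sub>R 1 + b *\<^sub>R i"
    using real_or_complex by blast
  then show ?thesis
  proof cases
    case R
    then obtain a b where "z = of_real a" "w = of_real b" unfolding of_real_def by blast
    then show ?thesis
      by (simp flip: of_real_add of_real_diff add: power2_eq_square algebra_simps)
  next
    case C
    then obtain a b c d where ab: "z = a *\<^sub>R 1 + b *\<^sub>R i" "w = c *\<^sub>R 1 + d *\<^sub>R i" by blast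
    have "z + w = (a + c) *\<^sub>R 1 + (b + d) *\<^sub>R i" "z - w = (a - c) *\<^sub>R 1 + (b - d) *\<^sub>R i"
      unfolding ab by (simp_all add: algebra_simps)
    then show ?thesis using ab
      by (simp only: norm_sq_complex_coords[OF C(1)]) (simp add: power2_eq_square algebra_simps)
  qed
qed

section \<open>The Hahn-Banach theorem\<close>

text \<open>
  Functionals are encoded by their graphs, which are subspaces of the product with the real line.
  The bound on the graph alone forces it to be single-valued, so that the union of a chain is
  again of this kind.
\<close>

definition bounded_graph :: "real \<Rightarrow> ('a::real_normed_vector \<times> real) set \<Rightarrow> bool" where
  "bounded_graph C H \<longleftrightarrow> subspace H \<and> (\<forall>(x, a) \<in> H. a \<le> C * norm x)"

lemma bounded_graph_unique:
  assumes H: "bounded_graph C H" and "(x, a) \<in> H" "(x, b) \<in> H"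
  shows "a = b"
proof -
  have sub: "subspace H" using H by (simp add: bounded_graph_def)
  have "(0, a - b) \<in> H" "(0, b - a) \<in> H"
    using subspace_diff[OF sub assms(2,3)] subspace_diff[OF sub assms(3,2)] by simp_all
  then have "a - b \<le> C * norm (0::'a)" "b - a \<le> C * norm (0::'a)"
    using H by (fastforce simp: bounded_graph_def)+
  then show ?thesis by simp
qed

text \<open>
  The admissible values at the new vector are those between the lower and the upper bounds that the
  existing values impose; the supremum of the lower bounds is one of them.
\<close>

lemma bounded_graph_extend:
  fixes H :: "('a::real_normed_vector \<times> real) set"
  assumes H: "bounded_graph C H" and C: "C \<ge> 0"
  shows "\<exists>H' c. bounded_graph C H' \<and> H \<subseteq> H' \<and> (x0, c) \<in> H'"
proof -
  have sub: "subspace H" and bd: "\<And>x a. (x, a) \<in> H \<Longrightarrow> a \<le> C * norm x"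
    using H by (auto simp: bounded_graph_def)
  have z: "(0, 0) \<in> H" using subspace_0[OF sub] by (simp add: zero_prod_def)
  have key: "a - C * norm (x - x0) \<le> C * norm (y + x0) - b" if "(x, a) \<in> H" "(y, b) \<in> H" for x a y b
  proof -
    have "a + b \<le> C * norm (x + y)"
      using bd subspace_add[OF sub that] by simp
    also have "\<dots> = C * norm ((x - x0) + (y + x0))" by (simp add: algebra_simps)
    also have "\<dots> \<le> C * (norm (x - x0) + norm (y + x0))"
      by (intro mult_left_mono norm_triangle_ineq C)
    finally show ?thesis by (simp add: algebra_simps)
  qed
  define c where "c = (SUP (x, a) \<in> H. a - C * norm (x - x0))"
  have bdd: "bdd_above ((\<lambda>(x, a). a - C * norm (x - x0)) ` H)"
    using key[OF _ z] by (auto intro!: bdd_aboveI2[where M = "C * norm x0"])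
  have lo: "a - C * norm (x - x0) \<le> c" if "(x, a) \<in> H" for x a
    unfolding c_def using cSUP_upper[OF that bdd] by simp
  have hi: "c \<le> C * norm (y + x0) - b" if "(y, b) \<in> H" for y b
    unfolding c_def by (rule cSUP_least) (use z key that in auto)
  define H' where "H' = {u + v | u v. u \<in> H \<and> v \<in> span {(x0, c)}}"
  have "subspace H'" unfolding H'_def by (rule subspace_sums) (auto simp: sub)
  moreover have "a \<le> C * norm x" if xa: "(x, a) \<in> H'" for x a
  proof -
    obtain y b t where yb: "(y, b) \<in> H" and x: "x = y + t *\<^sub>R x0" and a: "a = b + t * c"
      using xa unfolding H'_def span_singleton by (auto simp: plus_prod_def)
    consider "t = 0" | "t > 0" | "t < 0" by linarith
    then show ?thesis
    proof cases
      case 1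
      then show ?thesis using bd[OF yb] x a by simp
    next
      case 2
      have "((1/t) *\<^sub>R y, (1/t) * b) \<in> H" using subspace_scale[OF sub yb, of "1/t"] by simp
      from hi[OF this] have "t * c \<le> t * (C * norm ((1/t) *\<^sub>R y + x0) - (1/t) * b)"
        using 2 by (intro mult_left_mono) auto
      also have "\<dots> = C * norm (t *\<^sub>R ((1/t) *\<^sub>R y + x0)) - b"
        using 2 by (simp only: norm_scaleR) (simp add: algebra_simps)
      also have "t *\<^sub>R ((1/t) *\<^sub>R y + x0) = x" using 2 x by (simp add: algebra_simps)
      finally show ?thesis using a by simp
    next
      case 3
      define s where "s = - t"
      have s: "s > 0" using 3 s_def by simp
      have "((1/s) *\<^sub>R y, (1/s) * b) \<in> H" using subspace_scale[OF sub yb, of "1/s"] by simp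
      from lo[OF this] have "s * ((1/s) * b - C * norm ((1/s) *\<^sub>R y - x0)) \<le> s * c"
        using s by (intro mult_left_mono) auto
      moreover have "s * ((1/s) * b - C * norm ((1/s) *\<^sub>R y - x0)) = b - C * norm (s *\<^sub>R ((1/s) *\<^sub>R y - x0))"
        using s by (simp only: norm_scaleR) (simp add: algebra_simps)
      moreover have "s *\<^sub>R ((1/s) *\<^sub>R y - x0) = x" using s x s_def by (simp add: algebra_simps)
      moreover have "a = b - s * c" using a s_def by simp
      ultimately show ?thesis by simp
    qed
  qed
  moreover have "H \<subseteq> H'" unfolding H'_def
  proof
    fix u assume "u \<in> H"
    then show "u \<in> {u + v | u v. u \<in> H \<and> v \<in> span {(x0, c)}}"
      by (intro CollectI exI[of _ u] exI[of _ 0]) (auto simp: span_zero)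
  qed
  moreover have "(x0, c) \<in> H'" unfolding H'_def
    by (intro CollectI exI[of _ "0"] exI[of _ "(x0, c)"]) (use sub in \<open>auto simp: span_base subspace_0\<close>)
  ultimately show ?thesis unfolding bounded_graph_def by blast
qed

theorem hahn_banach_real:
  fixes f :: "'a::real_normed_vector \<Rightarrow> real"
  assumes M: "subspace M" and C: "C \<ge> 0"
    and add: "\<And>x y. x \<in> M \<Longrightarrow> y \<in> M \<Longrightarrow> f (x + y) = f x + f y"
    and scale: "\<And>r x. x \<in> M \<Longrightarrow> f (r *\<^sub>R x) = r * f x"
    and bound: "\<And>x. x \<in> M \<Longrightarrow> f x \<le> C * norm x"
  obtains g where "linear g" "\<And>x. x \<in> M \<Longrightarrow> g x = f x" "\<And>x. \<bar>g x\<bar> \<le> C * norm x"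
proof -
  define H0 where "H0 = (\<lambda>x. (x, f x)) ` M"
  have "subspace H0" unfolding subspace_def
  proof (intro conjI ballI allI)
    have "f 0 = 0" using scale[of 0 0] subspace_0[OF M] by simp
    then show "0 \<in> H0" using subspace_0[OF M] by (auto simp: H0_def zero_prod_def image_iff)
    fix u assume u: "u \<in> H0"
    show "u + v \<in> H0" if "v \<in> H0" for v
      using u that subspace_add[OF M] by (auto simp: H0_def simp flip: add)
    show "r *\<^sub>R u \<in> H0" for r
      using u subspace_scale[OF M] by (auto simp: H0_def simp flip: scale)
  qed
  then have H0: "bounded_graph C H0" using bound by (auto simp: bounded_graph_def H0_def)
  let ?A = "{H. bounded_graph C H \<and> H0 \<subseteq> H}"
  have "\<exists>G\<in>?A. \<forall>X\<in>?A. G \<subseteq> X \<longrightarrow> X = G"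
  proof (rule subset_Zorn_nonempty)
    show "?A \<noteq> {}" using H0 by blast
    fix \<C> assume ne: "\<C> \<noteq> {}" and ch: "subset.chain ?A \<C>"
    have A: "\<And>H. H \<in> \<C> \<Longrightarrow> bounded_graph C H \<and> H0 \<subseteq> H"
      and dir: "\<And>H K. H \<in> \<C> \<Longrightarrow> K \<in> \<C> \<Longrightarrow> H \<subseteq> K \<or> K \<subseteq> H"
      using ch unfolding subset.chain_def by blast+
    have "subspace (\<Union>\<C>)" unfolding subspace_def
    proof (intro conjI ballI allI)
      show "0 \<in> \<Union>\<C>" using ne A by (auto simp: bounded_graph_def subspace_0)
      fix u assume u: "u \<in> \<Union>\<C>"
      show "u + v \<in> \<Union>\<C>" if v: "v \<in> \<Union>\<C>" for v
      proof -
        obtain H K where "H \<in> \<C>" "u \<in> H" "K \<in> \<C>" "v \<in> K" using u v by blast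
        then obtain L where "L \<in> \<C>" "u \<in> L" "v \<in> L" using dir by blast
        then show ?thesis using A subspace_add unfolding bounded_graph_def by blast
      qed
      show "r *\<^sub>R u \<in> \<Union>\<C>" for r
        using u A subspace_scale unfolding bounded_graph_def by blast
    qed
    then show "\<Union>\<C> \<in> ?A" using A ne unfolding bounded_graph_def by blast
  qed
  then obtain G where G: "bounded_graph C G" "H0 \<subseteq> G"
    and max: "\<And>X. bounded_graph C X \<Longrightarrow> G \<subseteq> X \<Longrightarrow> X = G" by (metis (no_types, lifting) mem_Collect_eq order_trans)
  have "\<exists>c. (x, c) \<in> G" for x
    using bounded_graph_extend[OF G(1) C, of x] max by metis
  then obtain g where g: "\<And>x. (x, g x) \<in> G" by metis
  have uniq: "g x = a" if "(x, a) \<in> G" for x a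
    using bounded_graph_unique[OF G(1) g that] .
  have sub: "subspace G" and bd: "\<And>x. g x \<le> C * norm x" using G(1) g by (auto simp: bounded_graph_def)
  have lin: "linear g"
  proof
    fix x y :: 'a and r :: real
    show "g (x + y) = g x + g y" using uniq subspace_add[OF sub g g] by simp
    show "g (r *\<^sub>R x) = r *\<^sub>R g x" using uniq subspace_scale[OF sub g] by simp
  qed
  have "\<bar>g x\<bar> \<le> C * norm x" for x
    using bd[of x] bd[of "- x"] linear_neg[OF lin, of x] by simp
  moreover have "g x = f x" if "x \<in> M" for x using uniq G(2) that H0_def by auto
  ultimately show thesis using that lin by blast
qed

text \<open>
  The scalar-valued extension is assembled from a real extension of the real part, in the way in
  which a scalar is recovered from real parts.
\<close>

theorem hahn_banach:
  fixes s :: "'k::real_or_complex \<Rightarrow> 'a::real_normed_vector \<Rightarrow> 'a"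
  assumes s: "normed_space_over s" and M: "module.subspace s M" and C: "C \<ge> 0"
    and add: "\<And>x y. x \<in> M \<Longrightarrow> y \<in> M \<Longrightarrow> f (x + y) = f x + f y"
    and scale: "\<And>c x. x \<in> M \<Longrightarrow> f (s c x) = c * f x"
    and bound: "\<And>x. x \<in> M \<Longrightarrow> norm (f x) \<le> C * norm x"
  obtains \<phi> where "linear_map_on UNIV s (*) \<phi>" "\<And>x. x \<in> M \<Longrightarrow> \<phi> x = f x"
    "\<And>x. norm (\<phi> x) \<le> C * norm x"
proof -
  interpret s: normed_space_over s by (rule s)
  obtain \<rho> :: "'k \<Rightarrow> real" where \<rho>: "linear \<rho>" "\<And>z. \<bar>\<rho> z\<bar> \<le> norm z" "\<And>r. \<rho> (of_real r) = r"
    and cases: "(\<forall>z. z = of_real (\<rho> z)) \<or>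
       (\<exists>i. i * i = - 1 \<and> (\<forall>z. z = of_real (\<rho> z) - i * of_real (\<rho> (i * z))))"
    by (rule real_part_exists) blast
  have MR: "subspace M" unfolding subspace_def
    using s.subspace_0[OF M] s.subspace_add[OF M] s.subspace_scale[OF M]
    by (metis s.scale_of_real)
  obtain g where g: "linear g" "\<And>x. x \<in> M \<Longrightarrow> g x = \<rho> (f x)" "\<And>x. \<bar>g x\<bar> \<le> C * norm x"
  proof (rule hahn_banach_real[OF MR C, of "\<lambda>x. \<rho> (f x)"])
    show "\<rho> (f (x + y)) = \<rho> (f x) + \<rho> (f y)" if "x \<in> M" "y \<in> M" for x y
      using that by (simp add: add linear_add[OF \<rho>(1)])
    show "\<rho> (f (r *\<^sub>R x)) = r * \<rho> (f x)" if "x \<in> M" for r x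
      using scale[OF that, of "of_real r"] linear_scale[OF \<rho>(1), of r "f x"]
      by (simp add: s.scale_of_real scaleR_conv_of_real)
    show "\<rho> (f x) \<le> C * norm x" if "x \<in> M" for x
      using bound[OF that] \<rho>(2)[of "f x"] by linarith
  qed blast
  have gR: "g (s (of_real r) x) = r * g x" for r x
    by (simp add: s.scale_of_real linear_scale[OF g(1)])
  note extension = that
  have fin: thesis if lin: "linear_map_on UNIV s (*) \<phi>" and ext: "\<And>x. x \<in> M \<Longrightarrow> \<phi> x = f x"
    and re: "\<And>x r. \<phi> x = of_real r \<Longrightarrow> g x = r" for \<phi>
  proof (rule extension[OF lin ext])
    fix x
    define e where "e = (if \<phi> x = 0 then 1 else inverse (\<phi> x) * of_real (norm (\<phi> x)))"
    have e: "norm e = 1" "e * \<phi> x = of_real (norm (\<phi> x))"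
      unfolding e_def by (auto simp: norm_mult norm_inverse norm_divide field_simps)
    have "\<phi> (s e x) = of_real (norm (\<phi> x))" using lin e(2) by (simp add: linear_map_on_def)
    then have "g (s e x) = norm (\<phi> x)" by (rule re)
    then show "norm (\<phi> x) \<le> C * norm x" using g(3)[of "s e x"] e(1) by (simp add: s.norm_scale)
  qed
  from cases show thesis
  proof (elim disjE exE conjE)
    assume R: "\<forall>z. z = of_real (\<rho> z)"
    show thesis
    proof (rule fin[of "\<lambda>x. of_real (g x)"])
      show "linear_map_on UNIV s (*) (\<lambda>x. of_real (g x))"
        unfolding linear_map_on_def by (auto simp: linear_add[OF g(1)]) (metis R gR of_real_mult)
    qed (use g R in auto)
  next
    fix i assume i: "i * i = - 1" and re: "\<forall>z. z = of_real (\<rho> z) - i * of_real (\<rho> (i * z))"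
    define \<phi> where "\<phi> x = of_real (g x) - i * of_real (g (s i x))" for x
    have add: "\<phi> (x + y) = \<phi> x + \<phi> y" for x y
      by (simp add: \<phi>_def s.scale_right_distrib linear_add[OF g(1)] algebra_simps)
    have real: "\<phi> (s (of_real r) x) = of_real r * \<phi> x" for r x
      unfolding \<phi>_def s.scale_left_commute[of i "of_real r" x] gR by (simp add: algebra_simps)
    have imag: "\<phi> (s i x) = i * \<phi> x" for x
    proof -
      have "s i (s i x) = s (of_real (-1)) x" using i by simp
      then have "g (s i (s i x)) = - g x" using gR[of "-1" x] by simp
      moreover have "i * (i * z) = - z" for z by (metis i mult.assoc mult_minus1)
      ultimately show ?thesis unfolding \<phi>_def by (simp only: right_diff_distrib) simp
    qed
    show thesis
    proof (rule fin[of \<phi>])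
      have "\<phi> (s c x) = c * \<phi> x" for c x
      proof -
        define a b where "a = \<rho> c" and "b = - \<rho> (i * c)"
        have c: "c = of_real a + of_real b * i" 
          using re[rule_format, of c] unfolding a_def b_def
          by (simp only: of_real_minus mult_minus_left mult.commute[of "of_real _" i] add_uminus_conv_diff)
        have "s c x = s (of_real a) x + s (of_real b) (s i x)"
          unfolding c by (simp add: s.scale_left_distrib)
        then show ?thesis unfolding c by (simp only: add real imag) (simp add: algebra_simps)
      qed
      then show "linear_map_on UNIV s (*) \<phi>" by (simp add: linear_map_on_def add)
      show "\<phi> x = f x" if "x \<in> M" for x
        unfolding \<phi>_def using g(2)[OF that] g(2)[OF s.subspace_scale[OF M that, of i]] scale[OF that, of i]
          re[rule_format, of "f x"] by simp
      show "g x = r" if "\<phi> x = of_real r" for x r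
      proof -
        have "\<rho> (i * of_real t) = 0" for t
        proof -
          have "of_real t = of_real t - i * of_real (\<rho> (i * of_real t))"
            using re[rule_format, of "of_real t"] \<rho>(3) by simp
          then have "i * of_real (\<rho> (i * of_real t)) = 0" by (simp add: algebra_simps)
          moreover have "i \<noteq> 0" using i by auto
          ultimately show ?thesis by simp
        qed
        then have "\<rho> (\<phi> x) = g x" by (simp add: \<phi>_def linear_diff[OF \<rho>(1)] \<rho>(3))
        then show ?thesis using that \<rho>(3) by simp
      qed
    qed
  qed
qed

lemma norming_functional:
  fixes s :: "'k::real_or_complex \<Rightarrow> 'a::real_normed_vector \<Rightarrow> 'a"
  assumes s: "normed_space_over s"
  obtains \<phi> where "\<phi> \<in> dual_ball UNIV s" "\<phi> x = of_real (norm x)"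
proof (cases "x = 0")
  case True
  then show thesis using that[of "\<lambda>_. 0"] by (simp add: dual_ball_def linear_map_on_def)
next
  case False
  interpret s: normed_space_over s by (rule s)
  define f where "f z = (THE c. z = s c x) * of_real (norm x)" for z
  have f: "f (s c x) = c * of_real (norm x)" for c unfolding f_def using False by simp
  let ?M = "range (\<lambda>c. s c x)"
  have "s.subspace ?M" using s.subspace_span[of "{x}"] by (simp add: s.span_singleton)
  then obtain \<phi> where "linear_map_on UNIV s (*) \<phi>" "\<And>z. z \<in> ?M \<Longrightarrow> \<phi> z = f z" "\<And>z. norm (\<phi> z) \<le> 1 * norm z"
  proof (rule hahn_banach[OF s, of ?M 1 f])
    show "f (u + v) = f u + f v" if "u \<in> ?M" "v \<in> ?M" for u v
      using that f by (auto simp: algebra_simps simp flip: s.scale_left_distrib)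
    show "f (s c u) = c * f u" if "u \<in> ?M" for u c
      using that by (auto simp: f)
    show "norm (f u) \<le> 1 * norm u" if "u \<in> ?M" for u
      using that by (auto simp: f norm_mult s.norm_scale)
  qed auto
  moreover have "x \<in> ?M" by (metis rangeI s.scale_one)
  moreover have "f x = of_real (norm x)" using f[of 1] by simp
  ultimately show thesis using that[of \<phi>] by (simp add: dual_ball_def)
qed

lemma norming_real_functional:
  fixes x :: "'a::real_normed_vector"
  obtains g where "linear g" "g x = norm x" "\<And>z. \<bar>g z\<bar> \<le> norm z"
proof -
  obtain g :: "'a \<Rightarrow> real" where g: "g \<in> dual_ball UNIV (*\<^sub>R)" "g x = of_real (norm x)"
    by (rule norming_functional[OF normed_space_over_scaleR])
  then have "linear g" by (intro linearI) (simp_all add: dual_ball_def linear_map_on_def)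
  then show thesis using g that[of g] by (simp add: dual_ball_def)
qed

section \<open>Khintchine's inequality\<close>

definition signed_sum :: "'i set \<Rightarrow> ('i \<Rightarrow> 'a::real_normed_vector) \<Rightarrow> 'i set \<Rightarrow> 'a" where
  "signed_sum J a A = (\<Sum>j\<in>J. if j \<in> A then a j else - a j)"

text \<open>
  A vector of signs is coded by the set of the indices with a positive sign, so that the mean over
  all signs is a sum over a power set, which is accessible to induction over the index set.
\<close>

definition sign_mean :: "'i set \<Rightarrow> ('i set \<Rightarrow> real) \<Rightarrow> real" where
  "sign_mean J g = (\<Sum>A\<in>Pow J. g A) / 2 ^ card J"

lemma sign_mean_mono:
  assumes "\<And>A. A \<subseteq> J \<Longrightarrow> g A \<le> h A"
  shows "sign_mean J g \<le> sign_mean J h"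
  unfolding sign_mean_def by (intro divide_right_mono sum_mono) (use assms in auto)

lemma sign_mean_const: "finite J \<Longrightarrow> sign_mean J (\<lambda>_. c) = c"
  by (simp add: sign_mean_def card_Pow)

lemma sign_mean_add: "sign_mean J (\<lambda>A. g A + h A) = sign_mean J g + sign_mean J h"
  by (simp add: sign_mean_def sum.distrib add_divide_distrib)

lemma sign_mean_cmult: "sign_mean J (\<lambda>A. c * g A) = c * sign_mean J g"
  by (simp add: sign_mean_def sum_distrib_left)

lemma sign_mean_sum: "sign_mean J (\<lambda>A. \<Sum>k\<in>K. g k A) = (\<Sum>k\<in>K. sign_mean J (g k))"
  unfolding sign_mean_def by (subst sum.swap) (simp add: sum_divide_distrib)

lemma sign_mean_insert:
  assumes "finite J" "x \<notin> J"
  shows "sign_mean (insert x J) g = sign_mean J (\<lambda>A. (g A + g (insert x A)) / 2)"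
proof -
  have "(\<Sum>A\<in>Pow (insert x J). g A) = (\<Sum>A\<in>Pow J. g A) + (\<Sum>A\<in>insert x ` Pow J. g A)"
    unfolding Pow_insert by (rule sum.union_disjoint) (use assms in auto)
  also have "(\<Sum>A\<in>insert x ` Pow J. g A) = (\<Sum>A\<in>Pow J. g (insert x A))"
    by (rule sum.reindex_cong[of "insert x"]) (use assms in \<open>auto simp: inj_on_def insert_ident\<close>)
  finally show ?thesis using assms
    by (simp add: sign_mean_def sum.distrib add_divide_distrib sum_divide_distrib[symmetric])
qed

lemma signed_sum_insert:
  assumes "finite J" "x \<notin> J" "A \<subseteq> J"
  shows "signed_sum (insert x J) a A = signed_sum J a A - a x"
    and "signed_sum (insert x J) a (insert x A) = signed_sum J a A + a x"
proof -
  show "signed_sum (insert x J) a A = signed_sum J a A - a x"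
    using assms by (auto simp: signed_sum_def)
  have "(\<Sum>j\<in>J. if j \<in> insert x A then a j else - a j) = (\<Sum>j\<in>J. if j \<in> A then a j else - a j)"
    by (rule sum.cong) (use assms in auto)
  then show "signed_sum (insert x J) a (insert x A) = signed_sum J a A + a x"
    using assms by (simp add: signed_sum_def)
qed

lemma sign_mean_insert_signed_sum:
  assumes "finite J" "x \<notin> J"
  shows "sign_mean (insert x J) (\<lambda>A. g (signed_sum (insert x J) a A)) =
    sign_mean J (\<lambda>A. (g (signed_sum J a A - a x) + g (signed_sum J a A + a x)) / 2)"
  unfolding sign_mean_insert[OF assms]
  unfolding sign_mean_def
  by (intro arg_cong2[of _ _ _ _ "(/)"] sum.cong refl) (use assms in \<open>simp add: signed_sum_insert\<close>)

lemma second_moment: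
  fixes a :: "'i \<Rightarrow> 'k::real_or_complex"
  assumes "finite J"
  shows "sign_mean J (\<lambda>A. (norm (signed_sum J a A))\<^sup>2) = (\<Sum>j\<in>J. (norm (a j))\<^sup>2)"
  using assms
proof induction
  case empty
  then show ?case by (simp add: sign_mean_def signed_sum_def)
next
  case (insert x J)
  have "((norm (z - a x))\<^sup>2 + (norm (z + a x))\<^sup>2) / 2 = (norm z)\<^sup>2 + (norm (a x))\<^sup>2" for z
    using scalar_parallelogram[of z "a x"] by argo
  then show ?case
    unfolding sign_mean_insert_signed_sum[OF insert(1,2), where g = "\<lambda>z. (norm z)\<^sup>2"]
    using insert by (simp only: sign_mean_add sign_mean_const) simp
qed

text \<open>
  By the parallelogram law, the squares of \<open>|z + w|\<close> and \<open>|z - w|\<close> have the sum \<open>2 (|z|^2 + |w|^2)\<close>,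
  and they differ by at most \<open>4 |z| |w|\<close>; this bounds the mean of the fourth powers in each step.
\<close>

lemma fourth_moment:
  fixes a :: "'i \<Rightarrow> 'k::real_or_complex"
  assumes "finite J"
  shows "sign_mean J (\<lambda>A. norm (signed_sum J a A) ^ 4) \<le> 3 * (\<Sum>j\<in>J. (norm (a j))\<^sup>2)\<^sup>2"
  using assms
proof induction
  case empty
  then show ?case by (simp add: sign_mean_def signed_sum_def)
next
  case (insert x J)
  let ?w = "norm (a x)"
  have step: "(norm (z - a x) ^ 4 + norm (z + a x) ^ 4) / 2
    \<le> norm z ^ 4 + 6 * ?w\<^sup>2 * (norm z)\<^sup>2 + ?w ^ 4" for z
  proof -
    define P M where "P = (norm (z + a x))\<^sup>2" and "M = (norm (z - a x))\<^sup>2"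
    have sum: "P + M = 2 * ((norm z)\<^sup>2 + ?w\<^sup>2)"
      using scalar_parallelogram[of z "a x"] by (simp add: P_def M_def)
    have "P \<le> (norm z + ?w)\<^sup>2" "M \<le> (norm z + ?w)\<^sup>2"
      unfolding P_def M_def by (intro power_mono norm_triangle_ineq norm_triangle_ineq4 norm_ge_zero)+
    then have "\<bar>P - M\<bar> \<le> 4 * (norm z * ?w)" using sum by (simp add: power2_eq_square algebra_simps)
    then have "(P - M)\<^sup>2 \<le> (4 * (norm z * ?w))\<^sup>2"
      using abs_le_square_iff[of "P - M" "4 * (norm z * ?w)"] by simp
    moreover have "P\<^sup>2 + M\<^sup>2 = ((P + M)\<^sup>2 + (P - M)\<^sup>2) / 2" by (simp add: power2_eq_square algebra_simps)
    ultimately have "P\<^sup>2 + M\<^sup>2 \<le> ((2 * ((norm z)\<^sup>2 + ?w\<^sup>2))\<^sup>2 + (4 * (norm z * ?w))\<^sup>2) / 2" using sum by simp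
    also have "\<dots> = 2 * (norm z ^ 4 + 6 * ?w\<^sup>2 * (norm z)\<^sup>2 + ?w ^ 4)" by algebra
    moreover have "P\<^sup>2 = norm (z + a x) ^ 4" "M\<^sup>2 = norm (z - a x) ^ 4"
      unfolding P_def M_def by (simp_all flip: power_mult)
    ultimately show ?thesis by simp
  qed
  define \<sigma> where "\<sigma> = (\<Sum>j\<in>J. (norm (a j))\<^sup>2)"
  have "sign_mean (insert x J) (\<lambda>A. norm (signed_sum (insert x J) a A) ^ 4)
      = sign_mean J (\<lambda>A. (norm (signed_sum J a A - a x) ^ 4 + norm (signed_sum J a A + a x) ^ 4) / 2)"
    by (rule sign_mean_insert_signed_sum[where g = "\<lambda>z. norm z ^ 4"]) (use insert in auto)
  also have "\<dots> \<le> sign_mean J (\<lambda>A. norm (signed_sum J a A) ^ 4 + 6 * ?w\<^sup>2 * (norm (signed_sum J a A))\<^sup>2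
    + ?w ^ 4)"
    by (rule sign_mean_mono) (rule step)
  also have "\<dots> = sign_mean J (\<lambda>A. norm (signed_sum J a A) ^ 4) + 6 * ?w\<^sup>2 * \<sigma> + ?w ^ 4"
    using insert by (simp add: sign_mean_add sign_mean_cmult sign_mean_const second_moment \<sigma>_def)
  also have "\<dots> \<le> 3 * \<sigma>\<^sup>2 + 6 * ?w\<^sup>2 * \<sigma> + 3 * ?w ^ 4"
    using insert.IH unfolding \<sigma>_def[symmetric] by (simp add: add_increasing)
  also have "\<dots> = 3 * (?w\<^sup>2 + \<sigma>)\<^sup>2" by algebra
  finally show ?case using insert by (simp add: \<sigma>_def)
qed

text \<open>
  The lower bound interpolates the second moment between the \<open>p\<close>-th and the fourth one, by
  \<open>t\<^sup>2 \<le> 6 * t powr p + t\<^sup>4 / 6\<close>.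
\<close>

lemma khintchine_normalized:
  fixes a :: "'i \<Rightarrow> 'k::real_or_complex"
  assumes J: "finite J" and p: "1 \<le> p" "p \<le> 2" and a: "(\<Sum>j\<in>J. (norm (a j))\<^sup>2) = 1"
  shows "1 / 12 \<le> sign_mean J (\<lambda>A. norm (signed_sum J a A) powr p)"
    and "sign_mean J (\<lambda>A. norm (signed_sum J a A) powr p) \<le> 2"
proof -
  have lo: "t\<^sup>2 \<le> 6 * t powr p + 1/6 * t ^ 4" if t: "t \<ge> 0" for t :: real
  proof (cases "t\<^sup>2 \<le> 6")
    case True
    show ?thesis
    proof (cases "t = 0")
      case False
      then have t: "t > 0" using t by simp
      have "t\<^sup>2 = t powr (2 - p) * t powr p" using t by (simp add: powr_add[symmetric] powr_numeral)
      also have "t powr (2 - p) \<le> 6"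
      proof (cases "t \<ge> 1")
        case True
        then have "t powr (2 - p) \<le> t powr 2" using p by (intro powr_mono) auto
        then show ?thesis using \<open>t\<^sup>2 \<le> 6\<close> t by (simp add: powr_numeral)
      next
        case False
        then have "t powr (2 - p) \<le> 1" using p t by (intro powr_le1) auto
        then show ?thesis by simp
      qed
      finally have "t\<^sup>2 \<le> 6 * t powr p" using t by (simp add: mult_right_mono)
      then show ?thesis using t by (simp add: add_increasing2)
    qed simp
  next
    case False
    then have "6 * t\<^sup>2 \<le> t\<^sup>2 * t\<^sup>2" by (intro mult_right_mono) auto
    then have "t\<^sup>2 \<le> 1/6 * t ^ 4" by (simp add: power4_eq_xxxx power2_eq_square mult.assoc)
    then show ?thesis by (simp add: add_increasing)
  qed
  have "1 = sign_mean J (\<lambda>A. (norm (signed_sum J a A))\<^sup>2)" using second_moment[OF J, of a] a by simp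
  also have "\<dots> \<le> sign_mean J (\<lambda>A. 6 * norm (signed_sum J a A) powr p + 1/6 * norm (signed_sum J a A) ^ 4)"
    by (rule sign_mean_mono) (rule lo, simp)
  also have "\<dots> = 6 * sign_mean J (\<lambda>A. norm (signed_sum J a A) powr p)
    + 1/6 * sign_mean J (\<lambda>A. norm (signed_sum J a A) ^ 4)"
    unfolding sign_mean_add sign_mean_cmult ..
  also have "\<dots> \<le> 6 * sign_mean J (\<lambda>A. norm (signed_sum J a A) powr p) + 1/2"
    using fourth_moment[OF J, of a] a by simp
  finally show "1 / 12 \<le> sign_mean J (\<lambda>A. norm (signed_sum J a A) powr p)" by simp
  have hi: "t powr p \<le> 1 + t\<^sup>2" if "t \<ge> 0" for t :: real
  proof (cases "t \<ge> 1")
    case True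
    then have "t powr p \<le> t powr 2" using p by (intro powr_mono) auto
    then show ?thesis using True by (simp add: powr_numeral)
  next
    case False
    then have "t powr p \<le> 1" using p that by (intro powr_le1) auto
    then show ?thesis by (simp add: add_increasing2)
  qed
  have "sign_mean J (\<lambda>A. norm (signed_sum J a A) powr p) \<le> sign_mean J (\<lambda>A. 1 + (norm (signed_sum J a A))\<^sup>2)"
    by (rule sign_mean_mono) (rule hi, simp)
  also have "\<dots> = 2" using J a by (simp add: sign_mean_add sign_mean_const second_moment)
  finally show "sign_mean J (\<lambda>A. norm (signed_sum J a A) powr p) \<le> 2" .
qed

lemma signed_sum_scaleR: "signed_sum J (\<lambda>j. r *\<^sub>R a j) A = r *\<^sub>R signed_sum J a A"
  unfolding signed_sum_def scaleR_sum_right by (intro sum.cong) auto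

theorem khintchine:
  fixes a :: "'i \<Rightarrow> 'k::real_or_complex"
  assumes J: "finite J" and p: "1 \<le> p" "p \<le> 2"
  shows "(1 / 12) * L2_set (\<lambda>j. norm (a j)) J powr p \<le> sign_mean J (\<lambda>A. norm (signed_sum J a A) powr p)"
    and "sign_mean J (\<lambda>A. norm (signed_sum J a A) powr p) \<le> 2 * L2_set (\<lambda>j. norm (a j)) J powr p"
proof -
  define L where "L = L2_set (\<lambda>j. norm (a j)) J"
  have "(1 / 12) * L powr p \<le> sign_mean J (\<lambda>A. norm (signed_sum J a A) powr p) \<and>
     sign_mean J (\<lambda>A. norm (signed_sum J a A) powr p) \<le> 2 * L powr p"
  proof (cases "L = 0")
    case True
    then have "signed_sum J a A = 0" for A
      using J unfolding signed_sum_def by (intro sum.neutral) (auto simp: L_def L2_set_eq_0_iff)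
    then show ?thesis using True p by (simp add: sign_mean_const J)
  next
    case False
    then have L: "L > 0" by (simp add: L_def order_less_le)
    define b where "b j = (1 / L) *\<^sub>R a j" for j
    have "(\<Sum>j\<in>J. (norm (b j))\<^sup>2) = (\<Sum>j\<in>J. (norm (a j))\<^sup>2) / L\<^sup>2"
      by (simp add: b_def power_mult_distrib power_divide sum_divide_distrib)
    also have "\<dots> = 1" using L by (simp add: L_def L2_set_def sum_nonneg)
    finally have b: "(\<Sum>j\<in>J. (norm (b j))\<^sup>2) = 1" .
    have "norm (signed_sum J a A) powr p = L powr p * norm (signed_sum J b A) powr p" for A
      unfolding b_def signed_sum_scaleR using L by (simp add: powr_mult[symmetric])
    then have "sign_mean J (\<lambda>A. norm (signed_sum J a A) powr p)
      = L powr p * sign_mean J (\<lambda>A. norm (signed_sum J b A) powr p)"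
      by (simp add: sign_mean_cmult)
    then show ?thesis using khintchine_normalized[OF J p b]
      mult_left_mono[OF khintchine_normalized(1)[OF J p b], of "L powr p"]
      mult_left_mono[OF khintchine_normalized(2)[OF J p b], of "L powr p"] by (simp add: mult.commute)
  qed
  then show "(1 / 12) * L2_set (\<lambda>j. norm (a j)) J powr p \<le> sign_mean J (\<lambda>A. norm (signed_sum J a A) powr p)"
    and "sign_mean J (\<lambda>A. norm (signed_sum J a A) powr p) \<le> 2 * L2_set (\<lambda>j. norm (a j)) J powr p"
    by (simp_all add: L_def)
qed

section \<open>Embedding \<open>\<ell>\<^sub>q\<close> into \<open>\<ell>\<^sub>p\<close> for \<open>1 \<le> p < q \<le> 2\<close>\<close>

lemma sum_power_abs_le:
  fixes x :: real and Z :: "int set"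
  assumes "finite Z" "0 \<le> x" "x < 1"
  shows "(\<Sum>k\<in>Z. x ^ nat \<bar>k\<bar>) \<le> 2 / (1 - x)"
proof -
  have half: "(\<Sum>k\<in>Y. x ^ nat \<bar>k\<bar>) \<le> 1 / (1 - x)" if "finite Y" "inj_on (\<lambda>k. nat \<bar>k\<bar>) Y" for Y :: "int set"
  proof -
    have "(\<Sum>k\<in>Y. x ^ nat \<bar>k\<bar>) = (\<Sum>n\<in>(\<lambda>k. nat \<bar>k\<bar>) ` Y. x ^ n)"
      using that by (simp add: sum.reindex)
    also have "\<dots> \<le> (\<Sum>n. x ^ n)"
      by (rule sum_le_suminf) (use assms that in auto)
    finally show ?thesis using assms by (simp add: suminf_geometric)
  qed
  have "(\<Sum>k\<in>Z. x ^ nat \<bar>k\<bar>) = (\<Sum>k\<in>Z \<inter> {0..}. x ^ nat \<bar>k\<bar>) + (\<Sum>k\<in>Z - {0..}. x ^ nat \<bar>k\<bar>)"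
    using sum.Int_Diff[OF assms(1)] by blast
  also have "\<dots> \<le> 1 / (1 - x) + 1 / (1 - x)"
    by (intro add_mono half) (use assms in \<open>auto simp: inj_on_def\<close>)
  finally show ?thesis by simp
qed

text \<open>
  A bound for sums of \<open>min t (1/t)\<close> to the power \<open>d\<close> over a dyadic sequence of numbers \<open>t\<close>: two
  geometric series with ratio \<open>2^(-d)\<close>, and a factor \<open>2^d\<close> for rounding to powers of 2.
\<close>

definition two_sided_bound :: "real \<Rightarrow> real" where
  "two_sided_bound d = 2 powr d * (2 / (1 - 2 powr (- d)))"

lemma two_sided_bound_nonneg: "d > 0 \<Longrightarrow> two_sided_bound d \<ge> 0"
  by (simp add: two_sided_bound_def powr_le1 powr_minus_divide field_simps ge_one_powr_ge_zero)

lemma dyadic_two_sided_sum: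
  fixes d \<alpha> :: real and Z :: "int set"
  assumes d: "d > 0" and \<alpha>: "\<alpha> > 0" and Z: "finite Z"
  shows "(\<Sum>k\<in>Z. min (2 powr k * \<alpha>) (1 / (2 powr k * \<alpha>)) powr d) \<le> two_sided_bound d"
proof -
  define m where "m = \<lfloor>log 2 \<alpha>\<rfloor>"
  have m: "2 powr m \<le> \<alpha>" "\<alpha> < 2 powr (m + 1)"
    using \<alpha> unfolding m_def by (simp_all add: powr_le_iff less_powr_iff)
  define x :: real where "x = 2 powr (- d)"
  have x: "0 < x" "x < 1" using d by (auto simp: x_def powr_less_one)
  have bound: "min (2 powr k * \<alpha>) (1 / (2 powr k * \<alpha>)) powr d \<le> 2 powr d * x ^ nat \<bar>k + m\<bar>" for k :: int
  proof -
    have "min (2 powr k * \<alpha>) (1 / (2 powr k * \<alpha>)) \<le> 2 * 2 powr (- \<bar>k + m\<bar>)"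
    proof (cases "k + m \<ge> 0")
      case True
      have "2 powr (k + m) \<le> 2 powr k * \<alpha>" using m by (simp add: powr_add)
      then have "1 / (2 powr k * \<alpha>) \<le> 1 / 2 powr (k + m)"
        by (intro divide_left_mono) (use \<alpha> in auto)
      also have "\<dots> = 2 powr (- \<bar>k + m\<bar>)"
        using True powr_minus_divide[of 2 "real_of_int (k + m)"] by simp
      finally have "1 / (2 powr k * \<alpha>) \<le> 2 * 2 powr (- \<bar>k + m\<bar>)" by (rule order_trans) simp
      then show ?thesis by (rule min.coboundedI2)
    next
      case False
      have "2 powr k * \<alpha> \<le> 2 powr k * 2 powr (m + 1)" using m by (intro mult_left_mono) auto
      also have "\<dots> = 2 * 2 powr (- \<bar>k + m\<bar>)" 
      proof -
        have "real_of_int (- \<bar>k + m\<bar>) = real_of_int k + real_of_int m" using False by simp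
        then show ?thesis by (simp only: powr_add of_int_add) simp
      qed
      finally show ?thesis by (rule min.coboundedI1)
    qed
    then have "min (2 powr k * \<alpha>) (1 / (2 powr k * \<alpha>)) powr d \<le> (2 * 2 powr (- \<bar>k + m\<bar>)) powr d"
      by (intro powr_mono2) (use d \<alpha> in auto)
    also have "\<dots> = 2 powr d * x ^ nat \<bar>k + m\<bar>"
    proof -
      have "x ^ nat \<bar>k + m\<bar> = x powr real_of_int \<bar>k + m\<bar>"
        using x powr_realpow[of x "nat \<bar>k + m\<bar>"] by simp
      then show ?thesis by (simp add: powr_mult x_def powr_powr mult.commute)
    qed
    finally show ?thesis .
  qed
  have "(\<Sum>k\<in>Z. min (2 powr k * \<alpha>) (1 / (2 powr k * \<alpha>)) powr d) \<le> (\<Sum>k\<in>Z. 2 powr d * x ^ nat \<bar>k + m\<bar>)"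
    by (rule sum_mono) (rule bound)
  also have "\<dots> = 2 powr d * (\<Sum>k\<in>(\<lambda>k. k + m) ` Z. x ^ nat \<bar>k\<bar>)"
    by (simp add: sum_distrib_left sum.reindex inj_on_def)
  also have "\<dots> \<le> 2 powr d * (2 / (1 - x))"
    by (intro mult_left_mono sum_power_abs_le) (use Z x in auto)
  finally show ?thesis by (simp add: two_sided_bound_def x_def)
qed

text \<open>
  After division by the sum, all terms are at most 1, so that a smaller exponent increases them.
\<close>

lemma sum_powr_le:
  fixes f :: "'i \<Rightarrow> real"
  assumes "finite J" "\<And>j. j \<in> J \<Longrightarrow> 0 \<le> f j" "0 < r" "r \<le> 1"
  shows "(\<Sum>j\<in>J. f j) powr r \<le> (\<Sum>j\<in>J. f j powr r)"
proof (cases "(\<Sum>j\<in>J. f j) = 0")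
  case True
  then show ?thesis by (simp add: sum_nonneg)
next
  case False
  define S where "S = (\<Sum>j\<in>J. f j)"
  have S: "S > 0" using False assms by (simp add: S_def order_less_le sum_nonneg)
  have "1 = (\<Sum>j\<in>J. f j / S)" using S by (simp add: S_def flip: sum_divide_distrib)
  also have "\<dots> \<le> (\<Sum>j\<in>J. (f j / S) powr r)"
  proof (rule sum_mono)
    fix j assume j: "j \<in> J"
    have "f j \<le> S" unfolding S_def by (rule member_le_sum) (use j assms in auto)
    then have "(f j / S) powr 1 \<le> (f j / S) powr r"
      using assms S j by (intro powr_mono') auto
    then show "f j / S \<le> (f j / S) powr r" using assms j S by simp
  qed
  also have "\<dots> = (\<Sum>j\<in>J. f j powr r) / S powr r"
    using assms S by (simp add: powr_divide sum_divide_distrib)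
  finally show ?thesis using S by (simp add: S_def field_simps)
qed

text \<open>
  Below 1 the square is used, which has a small expectation there, above 1 the \<open>p\<close>-th power, which
  still has a finite one. The bound of the square function by a sum over the coordinates makes its
  expectation computable from the laws of the single coordinates.
\<close>

definition small_square :: "real \<Rightarrow> real \<Rightarrow> real" where
  "small_square p t = (if t \<le> 1 then t\<^sup>2 else t powr p)"

lemma L2_set_powr_le_small_square:
  fixes t :: "'i \<Rightarrow> real"
  assumes J: "finite J" and t: "\<And>j. j \<in> J \<Longrightarrow> 0 \<le> t j" and p: "0 < p" "p \<le> 2"
  shows "L2_set t J powr p \<le> 1 + (\<Sum>j\<in>J. small_square p (t j))"
proof -
  let ?S = "{j \<in> J. t j \<le> 1}" and ?L = "{j \<in> J. \<not> t j \<le> 1}"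
  define S L where "S = (\<Sum>j\<in>?S. (t j)\<^sup>2)" and "L = (\<Sum>j\<in>?L. (t j)\<^sup>2)"
  have nn: "S \<ge> 0" "L \<ge> 0" by (auto simp: S_def L_def sum_nonneg)
  have split: "(\<Sum>j\<in>J. g j) = (\<Sum>j\<in>?S. g j) + (\<Sum>j\<in>?L. g j)" for g :: "'i \<Rightarrow> real"
    by (subst sum.union_disjoint[symmetric]) (use J in \<open>auto intro!: sum.cong\<close>)
  have "L2_set t J powr p = (\<Sum>j\<in>J. (t j)\<^sup>2) powr (p/2)"
    by (simp add: L2_set_def powr_half_sqrt[symmetric] sum_nonneg powr_powr)
  also have "\<dots> = (S + L) powr (p/2)" by (simp add: split S_def L_def)
  also have "\<dots> \<le> S powr (p/2) + L powr (p/2)"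
    using sum_powr_le[of "{True, False}" "\<lambda>b. if b then S else L" "p/2"] nn p by simp
  also have "S powr (p/2) \<le> 1 + S"
  proof (cases "S \<le> 1")
    case True
    then show ?thesis using powr_le1[of "p/2" S] nn p by simp
  next
    case False
    then have "S powr (p/2) \<le> S powr 1" using p by (intro powr_mono) auto
    then show ?thesis using nn by simp
  qed
  also have "L powr (p/2) \<le> (\<Sum>j\<in>?L. ((t j)\<^sup>2) powr (p/2))"
    unfolding L_def by (rule sum_powr_le) (use J p in auto)
  also have "\<dots> = (\<Sum>j\<in>?L. small_square p (t j))"
  proof (rule sum.cong)
    fix j assume "j \<in> ?L"
    then have "((t j)\<^sup>2) powr (p/2) = (t j powr 2) powr (p/2)" by simp
    also have "\<dots> = t j powr p" by (simp only: powr_powr) simp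
    finally show "((t j)\<^sup>2) powr (p/2) = small_square p (t j)"
      using \<open>j \<in> ?L\<close> by (simp add: small_square_def)
  qed simp
  also have "1 + S + \<dots> = 1 + (\<Sum>j\<in>J. small_square p (t j))"
    unfolding split[of "\<lambda>j. small_square p (t j)"] by (simp add: S_def small_square_def)
  finally show ?thesis by simp
qed

text \<open>
  The functions in \<open>PiE J (\<lambda>_. K)\<close> with the product weights are a sample space of independent
  variables, one for each \<open>j \<in> J\<close>, with law \<open>w\<close>. The sum is the expectation of a function of one of
  them.
\<close>

lemma sum_PiE_marginal:
  fixes w f :: "'b \<Rightarrow> real"
  assumes J: "finite J" "i \<in> J" and K: "finite K" "(\<Sum>k\<in>K. w k) = 1"
  shows "(\<Sum>\<omega>\<in>PiE J (\<lambda>_. K). (\<Prod>j\<in>J. w (\<omega> j)) * f (\<omega> i)) = (\<Sum>k\<in>K. w k * f k)"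
proof -
  define g where "g j k = w k * (if j = i then f k else 1)" for j k
  have "(\<Sum>\<omega>\<in>PiE J (\<lambda>_. K). (\<Prod>j\<in>J. w (\<omega> j)) * f (\<omega> i)) = (\<Sum>\<omega>\<in>PiE J (\<lambda>_. K). \<Prod>j\<in>J. g j (\<omega> j))"
  proof (rule sum.cong)
    fix \<omega>
    have "(\<Prod>j\<in>J. g j (\<omega> j)) = (\<Prod>j\<in>J. w (\<omega> j)) * (\<Prod>j\<in>J. if j = i then f (\<omega> j) else 1)"
      by (simp only: g_def prod.distrib)
    then show "(\<Prod>j\<in>J. w (\<omega> j)) * f (\<omega> i) = (\<Prod>j\<in>J. g j (\<omega> j))" using J by simp
  qed simp
  also have "\<dots> = (\<Prod>j\<in>J. \<Sum>k\<in>K. g j k)"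
    by (rule prod_sum_PiE[symmetric]) (use J K in auto)
  also have "\<dots> = (\<Prod>j\<in>J. if j = i then \<Sum>k\<in>K. w k * f k else 1)"
    by (rule prod.cong) (use K in \<open>auto simp: g_def\<close>)
  finally show ?thesis using J by simp
qed

lemma sum_PiE_prod_1:
  fixes w :: "'b \<Rightarrow> real"
  assumes J: "finite J" and K: "finite K" "(\<Sum>k\<in>K. w k) = 1"
  shows "(\<Sum>\<omega>\<in>PiE J (\<lambda>_. K). \<Prod>j\<in>J. w (\<omega> j)) = 1"
  using prod_sum_PiE[of J "\<lambda>_. K" "\<lambda>_. w"] assms by simp

text \<open>
  The probability that no variable in \<open>J'\<close> hits its target: a product by independence, and
  \<open>1 - w \<le> exp (- w)\<close>.
\<close>

lemma sum_PiE_avoid_le: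
  fixes w :: "'b \<Rightarrow> real"
  assumes J: "finite J" "J' \<subseteq> J" and K: "finite K" "(\<Sum>k\<in>K. w k) = 1" "\<And>k. k \<in> K \<Longrightarrow> w k \<ge> 0"
    and \<kappa>: "\<And>j. j \<in> J' \<Longrightarrow> \<kappa> j \<in> K"
  shows "(\<Sum>\<omega>\<in>{\<omega> \<in> PiE J (\<lambda>_. K). \<forall>j\<in>J'. \<omega> j \<noteq> \<kappa> j}. \<Prod>j\<in>J. w (\<omega> j)) \<le> exp (- (\<Sum>j\<in>J'. w (\<kappa> j)))"
proof -
  define B where "B j = (if j \<in> J' then K - {\<kappa> j} else K)" for j
  have "{\<omega> \<in> PiE J (\<lambda>_. K). \<forall>j\<in>J'. \<omega> j \<noteq> \<kappa> j} = PiE J B"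
  proof (intro set_eqI iffI)
    fix \<omega> assume "\<omega> \<in> {\<omega> \<in> PiE J (\<lambda>_. K). \<forall>j\<in>J'. \<omega> j \<noteq> \<kappa> j}"
    then show "\<omega> \<in> PiE J B" by (auto simp: PiE_iff B_def)
  next
    fix \<omega> assume \<omega>: "\<omega> \<in> PiE J B"
    have "\<omega> j \<in> K" if "j \<in> J" for j using PiE_mem[OF \<omega> that] by (auto simp: B_def split: if_splits)
    moreover have "\<omega> j \<noteq> \<kappa> j" if "j \<in> J'" for j
      using PiE_mem[OF \<omega>, of j] that J(2) by (auto simp: B_def)
    ultimately show "\<omega> \<in> {\<omega> \<in> PiE J (\<lambda>_. K). \<forall>j\<in>J'. \<omega> j \<noteq> \<kappa> j}"
      using \<omega> by (simp add: PiE_iff)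
  qed
  then have "(\<Sum>\<omega>\<in>{\<omega> \<in> PiE J (\<lambda>_. K). \<forall>j\<in>J'. \<omega> j \<noteq> \<kappa> j}. \<Prod>j\<in>J. w (\<omega> j)) = (\<Prod>j\<in>J. \<Sum>k\<in>B j. w k)"
    using prod_sum_PiE[of J B "\<lambda>_. w"] J K by (simp add: B_def)
  also have "\<dots> \<le> (\<Prod>j\<in>J. exp (if j \<in> J' then - w (\<kappa> j) else 0))"
  proof (rule prod_mono, intro conjI)
    fix j assume j: "j \<in> J"
    show "0 \<le> (\<Sum>k\<in>B j. w k)" using K by (intro sum_nonneg) (auto simp: B_def split: if_splits)
    show "(\<Sum>k\<in>B j. w k) \<le> exp (if j \<in> J' then - w (\<kappa> j) else 0)"
      using K \<kappa> exp_ge_add_one_self[of "- w (\<kappa> j)"] by (auto simp: B_def sum_diff1)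
  qed
  also have "\<dots> = exp (- (\<Sum>j\<in>J'. w (\<kappa> j)))"
    using J by (simp flip: exp_sum add: sum.If_cases Int_absorb1 sum_negf)
  finally show ?thesis .
qed

text \<open>
  The law of an exponent \<open>k\<close> for which \<open>2^k\<close> has the tail of a Pareto variable of index \<open>q\<close>,
  truncated to keep the sample space finite.
\<close>

definition pareto_weight :: "real \<Rightarrow> nat \<Rightarrow> nat \<Rightarrow> real" where
  "pareto_weight q K k = 2 powr (- q * k) / (\<Sum>l\<le>K. 2 powr (- q * real l))"

lemma pareto_total:
  assumes "1 \<le> q"
  shows "1 \<le> (\<Sum>l\<le>K. 2 powr (- q * real l))" "(\<Sum>l\<le>K. 2 powr (- q * real l)) \<le> 2"
proof -
  have "(\<Sum>l\<in>{0}. 2 powr (- q * real l)) \<le> (\<Sum>l\<le>K. 2 powr (- q * real l))"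
    by (rule sum_mono2) auto
  then show "1 \<le> (\<Sum>l\<le>K. 2 powr (- q * real l))" by simp
  have "(\<Sum>l\<le>K. 2 powr (- q * real l)) \<le> (\<Sum>l\<le>K. (1/2) ^ l)"
  proof (rule sum_mono)
    fix l
    have "2 powr (- q * real l) \<le> 2 powr (- real l)"
      using assms by (intro powr_mono) (auto simp: mult_le_cancel_right1)
    also have "\<dots> = (1/2) ^ l" by (simp add: powr_minus_divide powr_realpow power_one_over)
    finally show "2 powr (- q * real l) \<le> (1/2) ^ l" .
  qed
  also have "\<dots> \<le> (\<Sum>l. (1/2::real) ^ l)" by (rule sum_le_suminf) auto
  also have "\<dots> = 2" by (simp add: suminf_geometric)
  finally show "(\<Sum>l\<le>K. 2 powr (- q * real l)) \<le> 2" .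
qed

lemma pareto_weight:
  assumes "1 \<le> q"
  shows "pareto_weight q K k \<ge> 0" "(\<Sum>k\<le>K. pareto_weight q K k) = 1"
    "2 powr (- q * k) / 2 \<le> pareto_weight q K k" "pareto_weight q K k \<le> 2 powr (- q * k)"
proof -
  define S where "S = (\<Sum>l\<le>K. 2 powr (- q * real l))"
  have S: "1 \<le> S" "S \<le> 2" using pareto_total[OF assms, of K] by (simp_all only: S_def)
  have w: "pareto_weight q K k = 2 powr (- q * k) / S" for k by (simp only: pareto_weight_def S_def)
  show "pareto_weight q K k \<ge> 0" unfolding w using S by (intro divide_nonneg_nonneg) auto
  have "(\<Sum>k\<le>K. pareto_weight q K k) = S / S"
    unfolding w sum_divide_distrib[symmetric] S_def ..
  then show "(\<Sum>k\<le>K. pareto_weight q K k) = 1" using S by simp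
  show "2 powr (- q * k) / 2 \<le> pareto_weight q K k"
    unfolding w by (rule divide_left_mono) (use S in auto)
  show "pareto_weight q K k \<le> 2 powr (- q * k)"
    unfolding w using divide_left_mono[of 1 S "2 powr (- q * k)"] S by simp
qed

text \<open>
  With \<open>t = 2^k \<alpha>\<close>, each term is at most \<open>\<alpha>^q\<close> times a positive power of \<open>min t (1/t)\<close>: the exponent
  \<open>2 - q\<close> arises for small and \<open>q - p\<close> for large \<open>t\<close>.
\<close>

lemma pareto_small_square:
  assumes p: "1 \<le> p" "p < q" "q < 2" and \<alpha>: "\<alpha> \<ge> 0"
  shows "(\<Sum>k\<le>K. pareto_weight q K k * small_square p (2 ^ k * \<alpha>))
    \<le> two_sided_bound (min (2 - q) (q - p)) * \<alpha> powr q"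
proof (cases "\<alpha> = 0")
  case True
  then show ?thesis by (simp add: small_square_def)
next
  case False
  then have \<alpha>: "\<alpha> > 0" using \<alpha> by simp
  define d where "d = min (2 - q) (q - p)"
  have d: "d > 0" using p by (simp add: d_def)
  have "pareto_weight q K k * small_square p (2 ^ k * \<alpha>)
     \<le> \<alpha> powr q * min (2 powr int k * \<alpha>) (1 / (2 powr int k * \<alpha>)) powr d" for k
  proof -
    define t where "t = 2 ^ k * \<alpha>"
    have t: "t > 0" using \<alpha> by (simp add: t_def)
    have ss: "small_square p t \<ge> 0" by (simp add: small_square_def)
    have "2 powr (- q * k) = \<alpha> powr q * t powr (- q)"
    proof -
      have "t powr (- q) = (2 ^ k) powr (- q) * \<alpha> powr (- q)" using \<alpha> by (simp add: t_def powr_mult)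
      also have "(2 ^ k) powr (- q) = (2 powr real k) powr (- q)" by (simp add: powr_realpow)
      also have "\<dots> = 2 powr (- q * k)" by (simp only: powr_powr) (simp add: mult.commute)
      finally show ?thesis using \<alpha> by (simp add: powr_minus field_simps)
    qed
    then have "pareto_weight q K k * small_square p t \<le> \<alpha> powr q * (t powr (- q) * small_square p t)"
      using mult_right_mono[OF pareto_weight(4)[of q K k] ss] p by (simp add: mult.assoc)
    also have "t powr (- q) * small_square p t \<le> min t (1 / t) powr d"
    proof (cases "t \<le> 1")
      case True
      then have "t powr (- q) * small_square p t = t powr (2 - q)"
        using t by (simp add: small_square_def powr_diff powr_minus divide_inverse powr_numeral)
      also have "\<dots> \<le> t powr d" using t True by (intro powr_mono') (auto simp: d_def)
      finally show ?thesis using t True mult_le_one[of t t] by (simp add: min_absorb1 pos_le_divide_eq)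
    next
      case False
      then have "t powr (- q) * small_square p t = t powr (- (q - p))"
        using t by (simp add: small_square_def powr_diff powr_minus divide_inverse)
      also have "\<dots> \<le> t powr (- d)" using t False by (intro powr_mono) (auto simp: d_def)
      also have "\<dots> = (1 / t) powr d" using t by (simp add: powr_divide powr_minus_divide)
      finally have *: "t powr (- q) * small_square p t \<le> (1 / t) powr d" .
      have "1 / t \<le> t" using t False mult_mono[of 1 t 1 t] by (simp add: pos_divide_le_eq)
      then show ?thesis using * by (simp add: min_absorb2)
    qed
    finally show ?thesis using \<alpha> by (simp add: t_def powr_realpow mult_left_mono)
  qed
  then have "(\<Sum>k\<le>K. pareto_weight q K k * small_square p (2 ^ k * \<alpha>))
      \<le> (\<Sum>k\<le>K. \<alpha> powr q * min (2 powr int k * \<alpha>) (1 / (2 powr int k * \<alpha>)) powr d)"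
    by (rule sum_mono)
  also have "\<dots> = \<alpha> powr q * (\<Sum>k\<in>int ` {..K}. min (2 powr k * \<alpha>) (1 / (2 powr k * \<alpha>)) powr d)"
    by (simp add: sum_distrib_left sum.reindex)
  also have "\<dots> \<le> \<alpha> powr q * two_sided_bound d"
    by (intro mult_left_mono dyadic_two_sided_sum) (use d \<alpha> in auto)
  finally show ?thesis by (simp only: d_def mult.commute[of "\<alpha> powr q" "two_sided_bound _"])
qed

lemma dyadic_exponent_exists:
  fixes \<alpha> :: real
  assumes "0 < \<alpha>" "\<alpha> \<le> 1"
  obtains k :: nat where "1 \<le> 2 ^ k * \<alpha>" "2 ^ k * \<alpha> < 2"
proof -
  obtain n where "1 / \<alpha> < 2 ^ n" using real_arch_pow[of 2 "1/\<alpha>"] by auto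
  then have ex: "1 \<le> 2 ^ n * \<alpha>" using assms by (simp add: field_simps)
  define k where "k = (LEAST n. 1 \<le> 2 ^ n * \<alpha>)"
  have k: "1 \<le> 2 ^ k * \<alpha>" unfolding k_def by (rule LeastI[of _ n]) (rule ex)
  have "2 ^ k * \<alpha> < 2"
  proof (cases k)
    case 0
    then show ?thesis using assms by simp
  next
    case (Suc l)
    then have "l < (LEAST n. 1 \<le> 2 ^ n * \<alpha>)" by (simp only: k_def[symmetric])
    then have "\<not> 1 \<le> 2 ^ l * \<alpha>" by (rule not_less_Least)
    then show ?thesis using Suc by simp
  qed
  with k show thesis by (rule that)
qed

text \<open>
  The upper bound is additive in the coordinates. For the lower bound it suffices that some
  \<open>2^(\<omega> j) * \<alpha> j\<close> reaches 1 with a probability that is bounded from below. For the single coordinate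
  this probability is about \<open>(\<alpha> j)^q\<close>, and these numbers have the sum 1.
\<close>

lemma pareto_moments:
  fixes \<alpha> :: "'j \<Rightarrow> real"
  assumes p: "1 \<le> p" "p < q" "q < 2" and J: "finite J" and \<alpha>: "\<And>j. j \<in> J \<Longrightarrow> 0 \<le> \<alpha> j"
    and norm1: "(\<Sum>j\<in>J. \<alpha> j powr q) = 1" and K: "4 * card J \<le> 2 ^ K"
  defines "M \<equiv> (\<Sum>\<omega>\<in>PiE J (\<lambda>_. {..K}). (\<Prod>j\<in>J. pareto_weight q K (\<omega> j)) * L2_set (\<lambda>j. 2 ^ \<omega> j * \<alpha> j) J powr p)"
  shows "1 - exp (- 1 / 16) \<le> M" "M \<le> 1 + two_sided_bound (min (2 - q) (q - p))"
proof -
  let ?w = "pareto_weight q K" and ?\<Omega> = "PiE J (\<lambda>_. {..K})"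
  let ?W = "\<lambda>\<omega>. \<Prod>j\<in>J. ?w (\<omega> j)"
  have q: "1 \<le> q" using p by simp
  have W: "?W \<omega> \<ge> 0" for \<omega> by (intro prod_nonneg ballI pareto_weight(1) q)
  note tot = sum_PiE_prod_1[OF J finite_atMost pareto_weight(2)[OF q]]
  have "M \<le> (\<Sum>\<omega>\<in>?\<Omega>. ?W \<omega> * (1 + (\<Sum>j\<in>J. small_square p (2 ^ \<omega> j * \<alpha> j))))"
    unfolding M_def by (intro sum_mono mult_left_mono L2_set_powr_le_small_square W J) (use p \<alpha> in auto)
  also have "\<dots> = 1 + (\<Sum>j\<in>J. \<Sum>\<omega>\<in>?\<Omega>. ?W \<omega> * small_square p (2 ^ \<omega> j * \<alpha> j))"
    by (simp add: algebra_simps sum.distrib tot sum_distrib_left) (rule sum.swap)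
  also have "\<dots> = 1 + (\<Sum>j\<in>J. \<Sum>k\<le>K. ?w k * small_square p (2 ^ k * \<alpha> j))"
    using sum_PiE_marginal[OF J _ finite_atMost pareto_weight(2)[OF q]]
    by (intro arg_cong2[of _ _ _ _ "(+)"] sum.cong refl) (rule sum_PiE_marginal[OF J _ finite_atMost
      pareto_weight(2)[OF q]])
  also have "\<dots> \<le> 1 + (\<Sum>j\<in>J. two_sided_bound (min (2 - q) (q - p)) * \<alpha> j powr q)"
    by (intro add_left_mono sum_mono pareto_small_square p \<alpha>)
  also have "\<dots> = 1 + two_sided_bound (min (2 - q) (q - p))"
    by (simp add: norm1 flip: sum_distrib_left)
  finally show "M \<le> 1 + two_sided_bound (min (2 - q) (q - p))" .

  define n where "n = card J"
  have n: "n > 0" using norm1 J by (auto simp: n_def card_gt_0_iff)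
  \<comment> \<open>The truncation at \<open>K\<close> excludes very small coordinates, which carry at most half of the sum.\<close>
  define J' where "J' = {j \<in> J. 1 / (2 * n) \<le> \<alpha> j powr q}"
  have J': "J' \<subseteq> J" by (auto simp: J'_def)
  have le1: "\<alpha> j \<le> 1" if "j \<in> J" for j
  proof -
    have "\<alpha> j powr q \<le> (\<Sum>j\<in>J. \<alpha> j powr q)" by (rule member_le_sum) (use that J in auto)
    then show ?thesis using norm1 \<alpha>[OF that] q powr_le_one_le
      by (smt (verit) powr_less_mono2 powr_one_eq_one)
  qed
  have "\<exists>k. k \<le> K \<and> 1 \<le> 2 ^ k * \<alpha> j \<and> \<alpha> j powr q / 8 \<le> ?w k" if j: "j \<in> J'" for j
  proof -
    have jJ: "j \<in> J" and big: "1 / (2 * n) \<le> \<alpha> j powr q" using j by (auto simp: J'_def)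
    have pos: "\<alpha> j > 0" using big n \<alpha>[OF jJ] by (cases "\<alpha> j = 0") auto
    obtain k where k: "1 \<le> 2 ^ k * \<alpha> j" "2 ^ k * \<alpha> j < 2"
      using dyadic_exponent_exists[OF pos le1[OF jJ]] by blast
    have "\<alpha> j powr q \<le> \<alpha> j powr 1" using le1[OF jJ] pos q by (intro powr_mono') auto
    then have "1 / (2 * n) \<le> \<alpha> j" using big pos by simp
    then have "2 ^ k * (1 / (2 * n)) < 2"
      using k(2) by (meson le_less_trans mult_left_mono zero_le_numeral zero_le_power)
    then have "(2::real) ^ k < 4 * n" using n by (simp add: field_simps)
    also have "4 * n \<le> (2::real) ^ K" using K
      unfolding n_def by (metis of_nat_le_iff of_nat_mult of_nat_numeral of_nat_power)
    finally have "k \<le> K" by simp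
    moreover have "\<alpha> j powr q / 8 \<le> ?w k"
    proof -
      have "\<alpha> j \<le> 2 powr (1 - real k)" using k(2) by (simp add: powr_diff powr_realpow field_simps)
      then have "\<alpha> j powr q \<le> (2 powr (1 - real k)) powr q" using pos q by (intro powr_mono2) auto
      also have "\<dots> = 2 powr q * 2 powr (- q * k)" 
          by (simp only: powr_powr powr_add[symmetric]) (simp add: algebra_simps)
      also have "\<dots> \<le> 4 * 2 powr (- q * k)"
        using powr_mono[of q 2 "2::real"] p by (intro mult_right_mono) auto
      finally show ?thesis using pareto_weight(3)[OF q, of k K] by simp
    qed
    ultimately show ?thesis using k by blast
  qed
  then obtain \<kappa> where \<kappa>: "\<And>j. j \<in> J' \<Longrightarrow> \<kappa> j \<le> K" "\<And>j. j \<in> J' \<Longrightarrow> 1 \<le> 2 ^ \<kappa> j * \<alpha> j"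
    "\<And>j. j \<in> J' \<Longrightarrow> \<alpha> j powr q / 8 \<le> ?w (\<kappa> j)" by metis
  have "1 = (\<Sum>j\<in>J'. \<alpha> j powr q) + (\<Sum>j\<in>J - J'. \<alpha> j powr q)"
    using sum.subset_diff[OF J' J, of "\<lambda>j. \<alpha> j powr q"] norm1 by simp
  also have "(\<Sum>j\<in>J - J'. \<alpha> j powr q) \<le> (\<Sum>j\<in>J - J'. 1 / (2 * n))"
    by (rule sum_mono) (auto simp: J'_def)
  also have "\<dots> \<le> (\<Sum>j\<in>J. 1 / (2 * n))" by (rule sum_mono2) (use J in auto)
  also have "\<dots> = 1/2" using n by (simp add: n_def)
  finally have half: "1/2 \<le> (\<Sum>j\<in>J'. \<alpha> j powr q)" by simp
  define N where "N = {\<omega> \<in> ?\<Omega>. \<forall>j\<in>J'. \<omega> j \<noteq> \<kappa> j}"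
  have fin: "finite ?\<Omega>" using J by (intro finite_PiE) auto
  have "(\<Sum>\<omega>\<in>N. ?W \<omega>) \<le> exp (- (\<Sum>j\<in>J'. ?w (\<kappa> j)))"
    unfolding N_def by (rule sum_PiE_avoid_le) (use J J' \<kappa> pareto_weight q in auto)
  also have "\<dots> \<le> exp (- 1/16)"
  proof -
    have "(\<Sum>j\<in>J'. \<alpha> j powr q / 8) \<le> (\<Sum>j\<in>J'. ?w (\<kappa> j))" by (rule sum_mono) (rule \<kappa>(3))
    then show ?thesis using half by (simp flip: sum_divide_distrib)
  qed
  finally have "(\<Sum>\<omega>\<in>N. ?W \<omega>) \<le> exp (- 1/16)" .
  moreover have "1 = (\<Sum>\<omega>\<in>N. ?W \<omega>) + (\<Sum>\<omega>\<in>?\<Omega> - N. ?W \<omega>)"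
    using sum.subset_diff[of N ?\<Omega> ?W] fin tot by (simp add: N_def)
  moreover have "(\<Sum>\<omega>\<in>?\<Omega> - N. ?W \<omega>) \<le> M"
  proof -
    have "(\<Sum>\<omega>\<in>?\<Omega> - N. ?W \<omega>) \<le> (\<Sum>\<omega>\<in>?\<Omega> - N. ?W \<omega> * L2_set (\<lambda>j. 2 ^ \<omega> j * \<alpha> j) J powr p)"
    proof (rule sum_mono)
      fix \<omega> assume "\<omega> \<in> ?\<Omega> - N"
      then obtain j where j: "j \<in> J'" "\<omega> j = \<kappa> j" by (auto simp: N_def)
      have "1 \<le> 2 ^ \<omega> j * \<alpha> j" using \<kappa>(2) j by simp
      also have "\<dots> \<le> L2_set (\<lambda>j. 2 ^ \<omega> j * \<alpha> j) J"
        by (rule member_le_L2_set) (use J j J' in auto)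
      finally have "1 \<le> L2_set (\<lambda>j. 2 ^ \<omega> j * \<alpha> j) J powr p" using p by (intro ge_one_powr_ge_zero) auto
      from mult_left_mono[OF this W, of \<omega>]
      show "?W \<omega> \<le> ?W \<omega> * L2_set (\<lambda>j. 2 ^ \<omega> j * \<alpha> j) J powr p" by simp
    qed
    also have "\<dots> \<le> M" unfolding M_def by (rule sum_mono2) (use fin W in auto)
    finally show ?thesis .
  qed
  ultimately show "1 - exp (- 1 / 16) \<le> M" by simp
qed

text \<open>
  The vectors of an \<open>\<ell>\<^sub>p\<close>-space that represent the unit vectors have one coordinate for each pair of
  a sample point \<open>w\<close> and a choice of signs; averaging over the signs produces the square function.
  The probabilities are absorbed into the coefficients.
\<close>

lemma randomized_sign_embedding:
  fixes J :: "'j set" and \<Omega> :: "'w set" and W :: "'w \<Rightarrow> real" and r :: "'w \<Rightarrow> 'j \<Rightarrow> real"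
  assumes J: "finite J" and \<Omega>: "finite \<Omega>" and W: "\<And>w. W w \<ge> 0" and r: "\<And>w j. r w j \<ge> 0"
    and p: "1 \<le> p" "p \<le> 2"
  shows "\<exists>N (\<theta> :: nat \<Rightarrow> 'j \<Rightarrow> real). \<forall>a :: 'j \<Rightarrow> 'k::real_or_complex.
    (1 / 12) * (\<Sum>w\<in>\<Omega>. W w * L2_set (\<lambda>j. r w j * norm (a j)) J powr p)
      \<le> (\<Sum>i<N. norm (\<Sum>j\<in>J. \<theta> i j *\<^sub>R a j) powr p) \<and>
    (\<Sum>i<N. norm (\<Sum>j\<in>J. \<theta> i j *\<^sub>R a j) powr p)
      \<le> 2 * (\<Sum>w\<in>\<Omega>. W w * L2_set (\<lambda>j. r w j * norm (a j)) J powr p)"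
proof -
  have fin: "finite (\<Omega> \<times> Pow J)" using J \<Omega> by simp
  obtain h where h: "bij_betw h {0..<card (\<Omega> \<times> Pow J)} (\<Omega> \<times> Pow J)"
    using ex_bij_betw_nat_finite[OF fin] by blast
  define N where "N = card (\<Omega> \<times> Pow J)"
  define \<tau> where "\<tau> u j = (W (fst u) / 2 ^ card J) powr (1/p) * (r (fst u) j
    * (if j \<in> snd u then 1 else - 1))"
    for u :: "'w \<times> 'j set" and j
  have "(\<Sum>i<N. norm (\<Sum>j\<in>J. \<tau> (h i) j *\<^sub>R a j) powr p)
      = (\<Sum>w\<in>\<Omega>. W w * sign_mean J (\<lambda>A. norm (signed_sum J (\<lambda>j. r w j *\<^sub>R a j) A) powr p))"
    for a :: "'j \<Rightarrow> 'k"
  proof -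
    have tau: "norm (\<Sum>j\<in>J. \<tau> u j *\<^sub>R a j) powr p
       = W (fst u) / 2 ^ card J * norm (signed_sum J (\<lambda>j. r (fst u) j *\<^sub>R a j) (snd u)) powr p" for u
    proof -
      have "(\<Sum>j\<in>J. \<tau> u j *\<^sub>R a j) = (W (fst u) / 2 ^ card J) powr (1/p) *\<^sub>R signed_sum J (\<lambda>j. r (fst u) j
        *\<^sub>R a j) (snd u)"
        unfolding signed_sum_def scaleR_sum_right by (rule sum.cong) (auto simp: \<tau>_def)
      then show ?thesis using p W[of "fst u"] by (simp add: powr_mult powr_powr)
    qed
    have "(\<Sum>i<N. norm (\<Sum>j\<in>J. \<tau> (h i) j *\<^sub>R a j) powr p) = (\<Sum>u\<in>\<Omega> \<times> Pow J. norm (\<Sum>j\<in>J. \<tau> u j *\<^sub>R a j) powr p)"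
      using sum.reindex_bij_betw[OF h, of "\<lambda>u. norm (\<Sum>j\<in>J. \<tau> u j *\<^sub>R a j) powr p"]
      by (simp add: N_def atLeast0LessThan)
    also have "\<dots> = (\<Sum>w\<in>\<Omega>. \<Sum>A\<in>Pow J. W w / 2 ^ card J * norm (signed_sum J (\<lambda>j. r w j *\<^sub>R a j) A) powr p)"
      unfolding tau by (simp add: sum.cartesian_product case_prod_unfold)
    finally show ?thesis by (simp add: sign_mean_def sum_distrib_left sum_divide_distrib)
  qed
  moreover have "(1 / 12) * (\<Sum>w\<in>\<Omega>. W w * L2_set (\<lambda>j. r w j * norm (a j)) J powr p)
        \<le> (\<Sum>w\<in>\<Omega>. W w * sign_mean J (\<lambda>A. norm (signed_sum J (\<lambda>j. r w j *\<^sub>R a j) A) powr p)) \<and>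
     (\<Sum>w\<in>\<Omega>. W w * sign_mean J (\<lambda>A. norm (signed_sum J (\<lambda>j. r w j *\<^sub>R a j) A) powr p))
        \<le> 2 * (\<Sum>w\<in>\<Omega>. W w * L2_set (\<lambda>j. r w j * norm (a j)) J powr p)" for a :: "'j \<Rightarrow> 'k"
  proof -
    have n: "norm (r w j *\<^sub>R a j) = r w j * norm (a j)" for w j using r by simp
    have "(1 / 12) * (W w * L2_set (\<lambda>j. r w j * norm (a j)) J powr p)
        \<le> W w * sign_mean J (\<lambda>A. norm (signed_sum J (\<lambda>j. r w j *\<^sub>R a j) A) powr p)"
      "W w * sign_mean J (\<lambda>A. norm (signed_sum J (\<lambda>j. r w j *\<^sub>R a j) A) powr p)
        \<le> 2 * (W w * L2_set (\<lambda>j. r w j * norm (a j)) J powr p)" for w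
      using mult_left_mono[OF khintchine(1)[OF J p, of "\<lambda>j. r w j *\<^sub>R a j"] W[of w]]
        mult_left_mono[OF khintchine(2)[OF J p, of "\<lambda>j. r w j *\<^sub>R a j"] W[of w]]
      unfolding n by (simp_all add: mult.left_commute)
    then show ?thesis unfolding sum_distrib_left by (auto intro!: sum_mono)
  qed
  ultimately show ?thesis by (intro exI[of _ N] exI[of _ "\<lambda>i. \<tau> (h i)"]) simp
qed

theorem lq_embeds_into_lp:
  fixes p q :: real
  assumes p: "1 \<le> p" "p < q" "q \<le> 2"
  obtains c C :: real where "c > 0" "C > 0"
    "\<And>J :: 'j set. finite J \<Longrightarrow> \<exists>N (\<theta> :: nat \<Rightarrow> 'j \<Rightarrow> real). \<forall>a :: 'j \<Rightarrow> 'k::real_or_complex.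
       c * (\<Sum>j\<in>J. norm (a j) powr q) powr (p / q) \<le> (\<Sum>i<N. norm (\<Sum>j\<in>J. \<theta> i j *\<^sub>R a j) powr p) \<and>
       (\<Sum>i<N. norm (\<Sum>j\<in>J. \<theta> i j *\<^sub>R a j) powr p) \<le> C * (\<Sum>j\<in>J. norm (a j) powr q) powr (p / q)"
proof (cases "q = 2")
  case True
  show thesis
  proof (rule that[of "1/12" 2])
    fix J :: "'j set" assume J: "finite J"
    have "L2_set (\<lambda>j. norm (a j)) J powr p = (\<Sum>j\<in>J. norm (a j) powr q) powr (p / q)" for a :: "'j \<Rightarrow> 'k"
      using True by (simp add: L2_set_def powr_numeral powr_half_sqrt[symmetric] sum_nonneg powr_powr)
    then show "\<exists>N (\<theta> :: nat \<Rightarrow> 'j \<Rightarrow> real). \<forall>a :: 'j \<Rightarrow> 'k.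
       1/12 * (\<Sum>j\<in>J. norm (a j) powr q) powr (p / q) \<le> (\<Sum>i<N. norm (\<Sum>j\<in>J. \<theta> i j *\<^sub>R a j) powr p) \<and>
       (\<Sum>i<N. norm (\<Sum>j\<in>J. \<theta> i j *\<^sub>R a j) powr p) \<le> 2 * (\<Sum>j\<in>J. norm (a j) powr q) powr (p / q)"
      using randomized_sign_embedding[where ?'k = 'k, OF J, of "{()}" "\<lambda>_. 1" "\<lambda>_ _. 1" p] p by simp
  qed auto
next
  case False
  then have q: "q < 2" using p by simp
  define B where "B = 1 + two_sided_bound (min (2 - q) (q - p))"
  define b :: real where "b = 1 - exp (- 1 / 16)"
  have b: "b > 0" by (simp add: b_def)
  have B: "B > 0" using two_sided_bound_nonneg[of "min (2 - q) (q - p)"] p q by (simp add: B_def)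
  show thesis
  proof (rule that[of "1/12 * b" "2 * B"])
    show "1/12 * b > 0" "2 * B > 0" using b B by auto
    fix J :: "'j set" assume J: "finite J"
    obtain K where "real (4 * card J) < 2 ^ K" using real_arch_pow[of 2 "real (4 * card J)"] by auto
    then have K: "4 * card J \<le> 2 ^ K" by (metis less_imp_le of_nat_le_iff of_nat_numeral of_nat_power)
    let ?\<Omega> = "PiE J (\<lambda>_. {..K})" and ?W = "\<lambda>\<omega>. \<Prod>j\<in>J. pareto_weight q K (\<omega> j)"
    let ?M = "\<lambda>a :: 'j \<Rightarrow> 'k. \<Sum>\<omega>\<in>?\<Omega>. ?W \<omega> * L2_set (\<lambda>j. 2 ^ \<omega> j * norm (a j)) J powr p"
    have q1: "1 \<le> q" using p by simp
    have W: "?W \<omega> \<ge> 0" for \<omega> by (intro prod_nonneg ballI pareto_weight(1) q1)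
    have fin: "finite ?\<Omega>" using J by (intro finite_PiE) auto
    have M: "b * (\<Sum>j\<in>J. norm (a j) powr q) powr (p / q) \<le> ?M a \<and>
        ?M a \<le> B * (\<Sum>j\<in>J. norm (a j) powr q) powr (p / q)" for a :: "'j \<Rightarrow> 'k"
    proof -
      define S where "S = (\<Sum>j\<in>J. norm (a j) powr q)"
      show ?thesis
      proof (cases "S = 0")
        case True
        then have "a j = 0" if "j \<in> J" for j
          using that J by (auto simp: S_def sum_nonneg_eq_0_iff)
        then have "L2_set (\<lambda>j. 2 ^ \<omega> j * norm (a j)) J = 0" for \<omega> :: "'j \<Rightarrow> nat"
          by (intro L2_set_0') simp
        then show ?thesis using True by (simp flip: S_def)
      next
        case False
        then have S: "S > 0" by (simp add: S_def order_less_le sum_nonneg)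
        define L where "L = S powr (1/q)"
        have L: "L > 0" "L powr q = S" "L powr p = S powr (p/q)"
          using S p by (simp_all add: L_def powr_powr)
        define \<alpha> where "\<alpha> j = norm (a j) / L" for j
        have "(\<Sum>j\<in>J. \<alpha> j powr q) = 1"
          using L S by (simp add: \<alpha>_def powr_divide S_def flip: sum_divide_distrib)
        moreover have "\<And>j. j \<in> J \<Longrightarrow> 0 \<le> \<alpha> j" using L by (simp add: \<alpha>_def)
        moreover have "?M a = L powr p * (\<Sum>\<omega>\<in>?\<Omega>. ?W \<omega> * L2_set (\<lambda>j. 2 ^ \<omega> j * \<alpha> j) J powr p)"
        proof -
          have "L2_set (\<lambda>j. 2 ^ \<omega> j * norm (a j)) J = L * L2_set (\<lambda>j. 2 ^ \<omega> j * \<alpha> j) J" for \<omega> :: "'j \<Rightarrow> nat"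
            using L by (simp add: L2_set_right_distrib \<alpha>_def)
          then show ?thesis using L by (simp add: powr_mult sum_distrib_left mult.left_commute)
        qed
        ultimately show ?thesis
          using pareto_moments[OF p(1,2) q J _ _ K, of \<alpha>] L
          by (simp add: B_def b_def S_def[symmetric] mult.commute mult_left_mono)
      qed
    qed
    obtain N and \<theta> :: "nat \<Rightarrow> 'j \<Rightarrow> real" where \<theta>: "\<And>a :: 'j \<Rightarrow> 'k. (1 / 12) * ?M a
      \<le> (\<Sum>i<N. norm (\<Sum>j\<in>J. \<theta> i j *\<^sub>R a j) powr p) \<and>
       (\<Sum>i<N. norm (\<Sum>j\<in>J. \<theta> i j *\<^sub>R a j) powr p) \<le> 2 * ?M a"
      using randomized_sign_embedding[where ?'k = 'k, OF J fin, of ?W "\<lambda>\<omega> j. 2 ^ \<omega> j" p] W p by auto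
    show "\<exists>N (\<theta> :: nat \<Rightarrow> 'j \<Rightarrow> real). \<forall>a :: 'j \<Rightarrow> 'k.
       1/12 * b * (\<Sum>j\<in>J. norm (a j) powr q) powr (p / q) \<le> (\<Sum>i<N. norm (\<Sum>j\<in>J. \<theta> i j *\<^sub>R a j) powr p) \<and>
       (\<Sum>i<N. norm (\<Sum>j\<in>J. \<theta> i j *\<^sub>R a j) powr p) \<le> 2 * B * (\<Sum>j\<in>J. norm (a j) powr q) powr (p / q)"
    proof (intro exI[of _ N] exI[of _ \<theta>] allI)
      fix a :: "'j \<Rightarrow> 'k"
      show "1/12 * b * (\<Sum>j\<in>J. norm (a j) powr q) powr (p / q) \<le> (\<Sum>i<N. norm (\<Sum>j\<in>J. \<theta> i j *\<^sub>R a j) powr p) \<and>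
       (\<Sum>i<N. norm (\<Sum>j\<in>J. \<theta> i j *\<^sub>R a j) powr p) \<le> 2 * B * (\<Sum>j\<in>J. norm (a j) powr q) powr (p / q)"
        using \<theta>[of a] M[of a] by linarith
    qed
  qed
qed

section \<open>Domination theorems\<close>

definition lin_comb :: "('k::real_or_complex \<Rightarrow> 'y::real_normed_vector \<Rightarrow> 'y) \<Rightarrow> 'i set \<Rightarrow> ('i \<Rightarrow> 'y) \<Rightarrow> ('i
  \<Rightarrow> 'k) \<Rightarrow> 'y" where
  "lin_comb s I x f = (\<Sum>i\<in>I. s (f i) (x i))"

lemma lin_comb_scale:
  assumes "normed_space_over s"
  shows "lin_comb s I x (\<lambda>i. of_real r * f i) = r *\<^sub>R lin_comb s I x f"
proof -
  interpret s: normed_space_over s by fact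
  show ?thesis unfolding lin_comb_def scaleR_sum_right
    by (intro sum.cong) (simp_all flip: s.scale_of_real)
qed

text \<open>
  The measure comes from an almost maximal family \<open>f\<close>. If another function \<open>f0\<close> is to be added, the
  members of the family must be shrunk by the factor \<open>w = (1 - |f0|^e)^(1/e)\<close>. By maximality, the
  loss of the family is, up to \<open>\<epsilon>\<close>, at least the gain \<open>|u f0|^2\<close>; norming functionals of the vectors
  \<open>u (f m)\<close> bound the loss by a multiple of \<open>\<Lambda>\<close>, a linear functional, at \<open>1 - w \<le> |f0|^e\<close>. For
  \<open>e = 1\<close> this is Pisier's theorem on (2,1)-summing operators, for \<open>e = 2\<close> it is Pietsch's
  domination theorem.
\<close>

lemma domination:
  fixes s :: "'k::real_or_complex \<Rightarrow> 'y::real_normed_vector \<Rightarrow> 'y" and I :: "'i set"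
  assumes s: "normed_space_over s" and I: "finite I" "I \<noteq> {}" and e: "e \<ge> 1" and K: "K > 0"
    and summing: "\<And>M (f :: nat \<Rightarrow> 'i \<Rightarrow> 'k). (\<And>i. i \<in> I \<Longrightarrow> (\<Sum>m<M. norm (f m i) powr e) \<le> 1) \<Longrightarrow>
      (\<Sum>m<M. (norm (lin_comb s I x (f m)))\<^sup>2) \<le> K\<^sup>2"
  obtains \<mu> :: "'i \<Rightarrow> real" where "\<And>i. \<mu> i > 0" "(\<Sum>i\<in>I. \<mu> i) \<le> 3 * K\<^sup>2"
    "\<And>f. (\<And>i. i \<in> I \<Longrightarrow> norm (f i) \<le> 1) \<Longrightarrow> (\<exists>i\<in>I. norm (f i) = 1) \<Longrightarrow>
      (norm (lin_comb s I x f))\<^sup>2 \<le> (\<Sum>i\<in>I. \<mu> i * norm (f i) powr e)"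
proof -
  interpret s: normed_space_over s by fact
  let ?u = "lin_comb s I x"
  define admissible where "admissible M f \<longleftrightarrow> (\<forall>i\<in>I. (\<Sum>m<M. norm (f m i) powr e) \<le> 1)"
    for M :: nat and f :: "nat \<Rightarrow> 'i \<Rightarrow> 'k"
  define A where "A = {\<Sum>m<M. (norm (?u (f m)))\<^sup>2 | M f. admissible M f}"
  have le: "(\<Sum>m<M. (norm (?u (f m)))\<^sup>2) \<le> K\<^sup>2" if "admissible M f" for M f
    using summing that by (simp add: admissible_def)
  have bdd: "bdd_above A" using le by (auto simp: A_def intro!: bdd_aboveI[of _ "K\<^sup>2"])
  have inA: "(\<Sum>m<M. (norm (?u (f m)))\<^sup>2) \<in> A" if "admissible M f" for M f
    using that by (auto simp: A_def)
  have ne: "A \<noteq> {}" using inA[of 0 "\<lambda>_ _. 0"] by (auto simp: admissible_def)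
  \<comment> \<open>The uniform measure of total mass \<open>K\<^sup>2\<close> absorbs the defect \<open>\<epsilon>\<close> of an almost maximal family, since
    \<open>|f0|\<close> attains 1.\<close>
  define \<epsilon> where "\<epsilon> = K\<^sup>2 / card I"
  have \<epsilon>: "\<epsilon> > 0" using I K by (simp add: \<epsilon>_def card_gt_0_iff)
  have "Sup A - \<epsilon> < Sup A" using \<epsilon> by simp
  then obtain M f where f: "admissible M f" and near: "Sup A - \<epsilon> < (\<Sum>m<M. (norm (?u (f m)))\<^sup>2)"
    using less_cSup_iff[OF ne bdd, of "Sup A - \<epsilon>"] by (auto simp: A_def)
  have "\<exists>g. linear g \<and> g v = norm v \<and> (\<forall>z. \<bar>g z\<bar> \<le> norm z)" for v :: 'y
    by (rule norming_real_functional[of v]) blast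
  then have "\<exists>G. \<forall>v::'y. linear (G v) \<and> G v v = norm v \<and> (\<forall>z. \<bar>G v z\<bar> \<le> norm z)" by (intro choice allI)
  then obtain G where G: "\<And>v::'y. linear (G v)" "\<And>v. G v v = norm v" "\<And>v z. \<bar>G v z\<bar> \<le> norm z" by blast
  define v where "v m = ?u (f m)" for m
  define g where "g m = G (v m)" for m
  have g: "linear (g m)" "g m (v m) = norm (v m)" "\<bar>g m z\<bar> \<le> norm z" for m z
    using G by (simp_all add: g_def)
  define \<Lambda> where "\<Lambda> i = (\<Sum>m<M. norm (v m) * g m (s (f m i) (x i)))" for i
  define twist where "twist h m i = of_real (h i) * f m i" for h :: "'i \<Rightarrow> real" and m i
  have \<Lambda>: "(\<Sum>i\<in>I. h i * \<Lambda> i) = (\<Sum>m<M. norm (v m) * g m (?u (twist h m)))" for h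
  proof -
    have "g m (?u (twist h m)) = (\<Sum>i\<in>I. h i * g m (s (f m i) (x i)))" for m
    proof -
      have "?u (twist h m) = (\<Sum>i\<in>I. h i *\<^sub>R s (f m i) (x i))"
        unfolding lin_comb_def twist_def by (intro sum.cong) (simp_all flip: s.scale_of_real)
      then show ?thesis by (simp add: linear_sum[OF g(1)] linear_scale[OF g(1)])
    qed
    then have "(\<Sum>m<M. norm (v m) * g m (?u (twist h m)))
      = (\<Sum>m<M. \<Sum>i\<in>I. h i * (norm (v m) * g m (s (f m i) (x i))))"
      by (simp add: sum_distrib_left mult.left_commute)
    also have "\<dots> = (\<Sum>i\<in>I. h i * \<Lambda> i)" unfolding \<Lambda>_def sum_distrib_left by (rule sum.swap)
    finally show ?thesis by simp
  qed
  have tot: "(\<Sum>i\<in>I. \<Lambda> i) = (\<Sum>m<M. (norm (v m))\<^sup>2)"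
  proof -
    have "twist (\<lambda>_. 1) m = f m" for m by (simp add: twist_def fun_eq_iff)
    then show ?thesis using \<Lambda>[of "\<lambda>_. 1"] g(2) by (simp add: power2_eq_square flip: v_def)
  qed
  have mass: "(\<Sum>i\<in>I. \<bar>\<Lambda> i\<bar>) \<le> K\<^sup>2"
  proof -
    define h where "h i = sgn (\<Lambda> i)" for i
    have h: "\<bar>h i\<bar> \<le> 1" for i by (simp add: h_def sgn_real_def)
    have "admissible M (twist h)" unfolding admissible_def
    proof
      fix i assume i: "i \<in> I"
      have "(\<Sum>m<M. norm (twist h m i) powr e) \<le> (\<Sum>m<M. norm (f m i) powr e)"
        using h[of i] e by (intro sum_mono powr_mono2) (auto simp: twist_def norm_mult intro:
          mult_left_le_one_le)
      also have "\<dots> \<le> 1" using f i by (simp add: admissible_def)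
      finally show "(\<Sum>m<M. norm (twist h m i) powr e) \<le> 1" .
    qed
    note adm = le[OF this]
    have "(\<Sum>i\<in>I. \<bar>\<Lambda> i\<bar>) = (\<Sum>i\<in>I. h i * \<Lambda> i)" by (simp add: h_def abs_sgn mult.commute)
    also have "\<dots> = (\<Sum>m<M. norm (v m) * g m (?u (twist h m)))" by (rule \<Lambda>)
    also have "\<dots> \<le> (\<Sum>m<M. ((norm (v m))\<^sup>2 + (norm (?u (twist h m)))\<^sup>2) / 2)"
    proof (rule sum_mono)
      fix m
      have "norm (v m) * g m (?u (twist h m)) \<le> norm (v m) * norm (?u (twist h m))"
        using g(3)[of m "?u (twist h m)"] by (intro mult_left_mono) auto
      also have "\<dots> \<le> ((norm (v m))\<^sup>2 + (norm (?u (twist h m)))\<^sup>2) / 2"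
        using sum_squares_bound[of "norm (v m)" "norm (?u (twist h m))"] by simp
      finally show "norm (v m) * g m (?u (twist h m)) \<le> ((norm (v m))\<^sup>2 + (norm (?u (twist h m)))\<^sup>2) / 2" .
    qed
    also have "\<dots> = ((\<Sum>m<M. (norm (v m))\<^sup>2) + (\<Sum>m<M. (norm (?u (twist h m)))\<^sup>2)) / 2"
      by (simp add: sum.distrib add_divide_distrib sum_divide_distrib)
    also have "\<dots> \<le> K\<^sup>2" using le[OF f] adm by (simp add: v_def)
    finally show ?thesis .
  qed
  define \<mu> where "\<mu> i = \<epsilon> + 2 * \<bar>\<Lambda> i\<bar>" for i
  show thesis
  proof (rule that[of \<mu>])
    show "\<mu> i > 0" for i using \<epsilon> by (simp add: \<mu>_def add_pos_nonneg)
    have "(\<Sum>i\<in>I. \<mu> i) = K\<^sup>2 + 2 * (\<Sum>i\<in>I. \<bar>\<Lambda> i\<bar>)"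
      using I by (simp add: \<mu>_def sum.distrib sum_distrib_left \<epsilon>_def)
    then show "(\<Sum>i\<in>I. \<mu> i) \<le> 3 * K\<^sup>2" using mass by simp
    fix f0 :: "'i \<Rightarrow> 'k" assume f0: "\<And>i. i \<in> I \<Longrightarrow> norm (f0 i) \<le> 1" and one: "\<exists>i\<in>I. norm (f0 i) = 1"
    define w where "w i = (if i \<in> I then (1 - norm (f0 i) powr e) powr (1/e) else 0)" for i
    have f0e: "norm (f0 i) powr e \<le> 1" if "i \<in> I" for i using f0[OF that] e by (intro powr_le1) auto
    have we: "w i powr e = 1 - norm (f0 i) powr e" and w1: "0 \<le> w i" "w i \<le> 1"
      and w2: "1 - w i \<le> norm (f0 i) powr e" if i: "i \<in> I" for i
    proof -
      show we: "w i powr e = 1 - norm (f0 i) powr e" using i e f0e[OF i] by (simp add: w_def powr_powr)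
      show w1: "0 \<le> w i" "w i \<le> 1" using i e f0e[OF i] by (auto simp: w_def intro!: powr_le1)
      have "w i powr e \<le> w i powr 1" using w1 e by (intro powr_mono') auto
      then show "1 - w i \<le> norm (f0 i) powr e" using we w1 by simp
    qed
    define F where "F m = (if m < M then twist w m else f0)" for m
    have "admissible (Suc M) F" unfolding admissible_def
    proof
      fix i assume i: "i \<in> I"
      have "(\<Sum>m<Suc M. norm (F m i) powr e) = (\<Sum>m<M. w i powr e * norm (f m i) powr e) + norm (f0 i) powr e"
        using w1[OF i] by (simp add: F_def twist_def norm_mult powr_mult)
      also have "\<dots> \<le> w i powr e * 1 + norm (f0 i) powr e"
        unfolding sum_distrib_left[symmetric]
        by (intro add_right_mono mult_left_mono) (use f i in \<open>auto simp: admissible_def\<close>)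
      also have "\<dots> = 1" using we[OF i] by simp
      finally show "(\<Sum>m<Suc M. norm (F m i) powr e) \<le> 1" .
    qed
    then have "(\<Sum>m<Suc M. (norm (?u (F m)))\<^sup>2) \<le> Sup A" by (intro cSup_upper bdd inA)
    then have "(\<Sum>m<M. (norm (?u (twist w m)))\<^sup>2) + (norm (?u f0))\<^sup>2 \<le> Sup A" by (simp add: F_def)
    moreover have "2 * (\<Sum>i\<in>I. w i * \<Lambda> i) - (\<Sum>m<M. (norm (v m))\<^sup>2) \<le> (\<Sum>m<M. (norm (?u (twist w m)))\<^sup>2)"
      unfolding \<Lambda> sum_distrib_left sum_subtractf[symmetric]
    proof (rule sum_mono)
      fix m
      have "norm (v m) * g m (?u (twist w m)) \<le> norm (v m) * norm (?u (twist w m))"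
        using g(3)[of m "?u (twist w m)"] by (intro mult_left_mono) auto
      then show "2 * (norm (v m) * g m (?u (twist w m))) - (norm (v m))\<^sup>2 \<le> (norm (?u (twist w m)))\<^sup>2"
        using sum_squares_bound[of "norm (v m)" "norm (?u (twist w m))"] by simp
    qed
    ultimately have "(norm (?u f0))\<^sup>2 \<le> \<epsilon> + 2 * (\<Sum>m<M. (norm (v m))\<^sup>2) - 2 * (\<Sum>i\<in>I. w i * \<Lambda> i)"
      using near by (simp add: v_def)
    also have "\<dots> = \<epsilon> + 2 * (\<Sum>i\<in>I. (1 - w i) * \<Lambda> i)"
      by (simp add: tot[symmetric] left_diff_distrib sum_subtractf)
    also have "\<dots> \<le> \<epsilon> + 2 * (\<Sum>i\<in>I. norm (f0 i) powr e * \<bar>\<Lambda> i\<bar>)"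
    proof (intro add_left_mono mult_left_mono sum_mono)
      fix i assume i: "i \<in> I"
      have "(1 - w i) * \<Lambda> i \<le> (1 - w i) * \<bar>\<Lambda> i\<bar>" using w1[OF i] by (intro mult_left_mono) auto
      also have "\<dots> \<le> norm (f0 i) powr e * \<bar>\<Lambda> i\<bar>" using w2[OF i] by (intro mult_right_mono) auto
      finally show "(1 - w i) * \<Lambda> i \<le> norm (f0 i) powr e * \<bar>\<Lambda> i\<bar>" .
    qed simp
    also have "\<epsilon> \<le> (\<Sum>i\<in>I. \<epsilon> * norm (f0 i) powr e)"
    proof -
      obtain i where i: "i \<in> I" "norm (f0 i) = 1" using one by blast
      have "\<epsilon> * norm (f0 i) powr e \<le> (\<Sum>i\<in>I. \<epsilon> * norm (f0 i) powr e)"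
        by (rule member_le_sum) (use i I \<epsilon> in auto)
      then show ?thesis using i by simp
    qed
    also have "(\<Sum>i\<in>I. \<epsilon> * norm (f0 i) powr e) + 2 * (\<Sum>i\<in>I. norm (f0 i) powr e * \<bar>\<Lambda> i\<bar>)
       = (\<Sum>i\<in>I. \<mu> i * norm (f0 i) powr e)"
      by (simp add: \<mu>_def sum.distrib sum_distrib_left algebra_simps)
    finally show "(norm (?u f0))\<^sup>2 \<le> (\<Sum>i\<in>I. \<mu> i * norm (f0 i) powr e)" by simp
  qed
qed

lemma max_norm_attained:
  fixes f :: "'i \<Rightarrow> 'a::real_normed_vector"
  assumes I: "finite I" and f: "\<not> (\<forall>i\<in>I. f i = 0)"
  obtains t j where "t > 0" "\<And>i. i \<in> I \<Longrightarrow> norm (f i) \<le> t" "j \<in> I" "norm (f j) = t"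
proof -
  define t where "t = Max ((\<lambda>i. norm (f i)) ` I)"
  have le: "norm (f i) \<le> t" if "i \<in> I" for i using that I by (simp add: t_def)
  have "t \<in> (\<lambda>i. norm (f i)) ` I" unfolding t_def using f I by (intro Max_in) auto
  moreover obtain k where "k \<in> I" "f k \<noteq> 0" using f by blast
  then have "t > 0" using le[of k] by (metis less_le_trans zero_less_norm_iff)
  ultimately show thesis using that le by blast
qed

text \<open>
  The function is split into its dyadic levels \<open>A k\<close>. On a level, the hypothesis gives the bound
  \<open>2^k * sqrt (\<mu> (A k))\<close>. By the normalization in \<open>L\<^sub>r\<close>, the mass of the level is at most \<open>M\<close> and at
  most about \<open>2^(-k r)\<close> times \<open>M\<close>, so that the bounds decay geometrically in both directions because
  \<open>r > 2\<close>.
\<close>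

lemma lr_domination:
  fixes s :: "'k::real_or_complex \<Rightarrow> 'y::real_normed_vector \<Rightarrow> 'y" and I :: "'i set"
  assumes s: "normed_space_over s" and I: "finite I" and r: "r > 2" and M: "M > 0"
    and \<mu>: "\<And>i. \<mu> i > 0" "(\<Sum>i\<in>I. \<mu> i) \<le> M"
    and dom: "\<And>f. (\<And>i. i \<in> I \<Longrightarrow> norm (f i) \<le> 1) \<Longrightarrow> (\<exists>i\<in>I. norm (f i) = 1) \<Longrightarrow>
      (norm (lin_comb s I x f))\<^sup>2 \<le> (\<Sum>i\<in>I. \<mu> i * norm (f i))"
  shows "norm (lin_comb s I x f)
     \<le> 2 powr (r/2) * two_sided_bound (min 1 (r/2 - 1)) * sqrt M * (\<Sum>i\<in>I. \<mu> i / M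
       * norm (f i) powr r) powr (1/r)"
proof -
  interpret s: normed_space_over s by fact
  let ?u = "lin_comb s I x"
  have level: "(norm (?u f))\<^sup>2 \<le> t * (\<Sum>i\<in>I. \<mu> i * norm (f i))"
    if ft: "\<And>i. i \<in> I \<Longrightarrow> norm (f i) \<le> t" and t: "t > 0" for f t
  proof (cases "\<forall>i\<in>I. f i = 0")
    case True
    then have "?u f = 0" by (simp add: lin_comb_def)
    then show ?thesis using t \<mu> by (simp add: sum_nonneg less_imp_le)
  next
    case False
    obtain t' j where t': "t' > 0" and le: "\<And>i. i \<in> I \<Longrightarrow> norm (f i) \<le> t'" and j: "j \<in> I" "norm (f j) = t'"
      by (rule max_norm_attained[OF I False]) (erule that, blast, assumption, assumption)
    have "t' \<le> t" using ft j by auto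
    define h where "h i = of_real (1/t') * f i" for i
    have nh: "norm (h i) = norm (f i) / t'" for i using t' by (simp add: h_def norm_mult norm_divide)
    have "(norm (?u h))\<^sup>2 \<le> (\<Sum>i\<in>I. \<mu> i * norm (h i))"
      by (rule dom) (use le j t' in \<open>auto simp: nh\<close>)
    moreover have "?u h = (1/t') *\<^sub>R ?u f" unfolding h_def by (rule lin_comb_scale[OF s])
    ultimately have "(norm (?u f) / t')\<^sup>2 \<le> (\<Sum>i\<in>I. \<mu> i * norm (f i)) / t'"
      using t' by (simp add: nh sum_divide_distrib)
    then have "(norm (?u f))\<^sup>2 \<le> t' * (\<Sum>i\<in>I. \<mu> i * norm (f i))"
      using t' by (simp add: field_simps power2_eq_square)
    also have "\<dots> \<le> t * (\<Sum>i\<in>I. \<mu> i * norm (f i))"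
      using \<open>t' \<le> t\<close> \<mu>(1) by (intro mult_right_mono sum_nonneg mult_nonneg_nonneg) (auto simp: less_imp_le)
    finally show ?thesis .
  qed
  define d where "d = min 1 (r/2 - 1)"
  have d: "d > 0" using r by (simp add: d_def)
  define C where "C = 2 powr (r/2) * two_sided_bound d * sqrt M"
  have unit: "norm (?u f) \<le> C" if f1: "(\<Sum>i\<in>I. \<mu> i / M * norm (f i) powr r) \<le> 1" for f
  proof -
    define \<kappa> where "\<kappa> i = \<lceil>log 2 (norm (f i))\<rceil>" for i
    define I0 where "I0 = {i \<in> I. f i \<noteq> 0}"
    have I0: "finite I0" "I0 \<subseteq> I" using I by (auto simp: I0_def)
    have \<kappa>: "norm (f i) \<le> 2 powr \<kappa> i" "2 powr (\<kappa> i - 1) \<le> norm (f i)" if "i \<in> I0" for i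
    proof -
      have pos: "norm (f i) > 0" using that by (simp add: I0_def)
      show "norm (f i) \<le> 2 powr \<kappa> i" using pos by (simp add: le_powr_iff \<kappa>_def)
      show "2 powr (\<kappa> i - 1) \<le> norm (f i)" using pos by (simp add: powr_le_iff \<kappa>_def)
    qed
    define part where "part k i = (if i \<in> I0 \<and> \<kappa> i = k then f i else 0)" for k i
    have u0: "?u f = (\<Sum>i\<in>I0. s (f i) (x i))"
      unfolding lin_comb_def by (rule sum.mono_neutral_right) (use I in \<open>auto simp: I0_def\<close>)
    have "?u (part k) = (\<Sum>i\<in>{i \<in> I0. \<kappa> i = k}. s (f i) (x i))" for k
      unfolding lin_comb_def by (rule sum.mono_neutral_cong_right) (use I I0 in \<open>auto simp: part_def\<close>)
    then have "?u f = (\<Sum>k\<in>\<kappa> ` I0. ?u (part k))"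
      unfolding u0 using sum.group[of I0 "\<kappa> ` I0" \<kappa> "\<lambda>i. s (f i) (x i)"] I0 by simp
    then have "norm (?u f) \<le> (\<Sum>k\<in>\<kappa> ` I0. norm (?u (part k)))" by (simp add: norm_sum)
    also have "\<dots> \<le> (\<Sum>k\<in>\<kappa> ` I0. 2 powr (r/2) * sqrt M * min (2 powr k * 1) (1 / (2 powr k * 1)) powr d)"
    proof (rule sum_mono)
      fix k
      define A where "A = {i \<in> I0. \<kappa> i = k}"
      have A: "finite A" "A \<subseteq> I" using I0 by (auto simp: A_def)
      define m where "m = (\<Sum>i\<in>A. \<mu> i)"
      have m0: "m \<ge> 0" unfolding m_def using \<mu>(1) by (intro sum_nonneg) (auto simp: less_imp_le)
      have mM: "m \<le> M"
        using sum_mono2[OF I A(2), of \<mu>] \<mu> by (simp add: m_def less_imp_le)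
      have mr: "m \<le> M * 2 powr (- (k - 1) * r)"
      proof -
        have "m / M * 2 powr ((k - 1) * r) = (\<Sum>i\<in>A. \<mu> i / M * (2 powr (k - 1)) powr r)"
          by (simp add: m_def sum_divide_distrib sum_distrib_right powr_powr)
        also have "\<dots> \<le> (\<Sum>i\<in>A. \<mu> i / M * norm (f i) powr r)"
          by (intro sum_mono mult_left_mono powr_mono2) (use \<kappa> \<mu>(1) M r in \<open>auto simp: A_def less_imp_le\<close>)
        also have "\<dots> \<le> (\<Sum>i\<in>I. \<mu> i / M * norm (f i) powr r)"
          by (rule sum_mono2) (use A I \<mu>(1) M in \<open>auto simp: less_imp_le\<close>)
        also have "\<dots> \<le> 1" by (rule f1)
        finally show ?thesis using M by (simp add: field_simps powr_minus) (simp add: powr_diff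
          powr_minus field_simps)
      qed
      have "(norm (?u (part k)))\<^sup>2 \<le> 2 powr k * (\<Sum>i\<in>I. \<mu> i * norm (part k i))"
        by (rule level) (use \<kappa> in \<open>auto simp: part_def\<close>)
      also have "(\<Sum>i\<in>I. \<mu> i * norm (part k i)) = (\<Sum>i\<in>A. \<mu> i * norm (f i))"
        by (rule sum.mono_neutral_cong_right) (use I A in \<open>auto simp: part_def A_def\<close>)
      also have "\<dots> \<le> (\<Sum>i\<in>A. \<mu> i * 2 powr k)"
        by (intro sum_mono mult_left_mono) (use \<kappa> \<mu>(1) in \<open>auto simp: A_def less_imp_le\<close>)
      also have "\<dots> = m * 2 powr k" by (simp add: m_def sum_distrib_right)
      also have "2 powr k * (m * 2 powr k) = (2 powr k * sqrt m)\<^sup>2"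
        using m0 by (simp add: power_mult_distrib) (simp add: power2_eq_square)
      finally have "(norm (?u (part k)))\<^sup>2 \<le> (2 powr k * sqrt m)\<^sup>2"
        by (simp add: mult_left_mono)
      then have *: "norm (?u (part k)) \<le> 2 powr k * sqrt m"
        by (rule power2_le_imp_le) (use m0 in simp)
      show "norm (?u (part k)) \<le> 2 powr (r/2) * sqrt M * min (2 powr k * 1) (1 / (2 powr k * 1)) powr d"
      proof (cases "k \<le> 0")
        case True
        have k1: "(2::real) powr k \<le> 1" using True powr_mono[of "real_of_int k" 0 2] by simp
        note *
        also have "2 powr k * sqrt m \<le> (2 powr k) powr d * sqrt M"
        proof (intro mult_mono)
          have "(2 powr k) powr 1 \<le> (2 powr k) powr d" using k1 by (intro powr_mono') (auto simp: d_def)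
          then show "2 powr real_of_int k \<le> (2 powr k) powr d" by simp
        qed (use mM m0 in auto)
        also have "\<dots> \<le> 2 powr (r/2) * ((2 powr k) powr d * sqrt M)"
          using M r mult_right_mono[of 1 "2 powr (r/2)" "(2 powr k) powr d * sqrt M"]
          by (simp add: ge_one_powr_ge_zero)
        also have "2 powr k = min (2 powr k * 1) (1 / (2 powr real_of_int k * 1))"
          using k1 mult_le_one[of "2 powr real_of_int k" "2 powr real_of_int k"]
            by (simp add: min_absorb1 pos_le_divide_eq)
        finally show ?thesis by (simp add: mult.commute mult.left_commute)
      next
        case False
        then have k1: "k \<ge> 1" by simp
        note *
        also have "2 powr k * sqrt m \<le> 2 powr k * sqrt (M * 2 powr (- (k - 1) * r))"
          using mr by (intro mult_left_mono) auto
        also have "\<dots> = 2 powr (r/2) * sqrt M * 2 powr (- k * (r/2 - 1))"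
        proof -
          have "sqrt (2 powr (- (k - 1) * r)) = 2 powr (- (k - 1) * r / 2)"
            by (simp add: powr_half_sqrt[symmetric] powr_powr)
          moreover have "2 powr k * 2 powr (- (k - 1) * r / 2) = 2 powr (r/2) * 2 powr (- k * (r/2 - 1))"
            unfolding powr_add[symmetric] by (simp add: field_simps)
          ultimately show ?thesis by (simp add: real_sqrt_mult mult.commute mult.left_commute)
        qed
        also have "2 powr (- k * (r/2 - 1)) \<le> 2 powr (- k * d)"
          using k1 by (intro powr_mono) (auto simp: d_def)
        also have "\<dots> = (1 / 2 powr k) powr d" by (simp add: powr_divide powr_powr powr_minus_divide)
        also have "1 / 2 powr k = min (2 powr k * 1) (1 / (2 powr real_of_int k * 1))"
        proof -
          have "(1::real) \<le> 2 powr k" using k1 by (simp add: ge_one_powr_ge_zero)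
          then show ?thesis using mult_mono[of 1 "2 powr real_of_int k" 1 "2 powr real_of_int k"] 
            by (simp add: min_absorb2 pos_divide_le_eq)
        qed
        finally show ?thesis using M by (simp add: mult_left_mono)
      qed
    qed
    also have "\<dots> = 2 powr (r/2) * sqrt M * (\<Sum>k\<in>\<kappa> ` I0. min (2 powr k * 1) (1 / (2 powr k * 1)) powr d)"
      by (simp only: sum_distrib_left)
    also have "\<dots> \<le> 2 powr (r/2) * sqrt M * two_sided_bound d"
      by (intro mult_left_mono dyadic_two_sided_sum) (use d I0 M in auto)
    finally show ?thesis by (simp add: C_def mult.commute mult.left_commute)
  qed
  define T where "T = (\<Sum>i\<in>I. \<mu> i / M * norm (f i) powr r)"
  have "norm (?u f) \<le> C * T powr (1/r)"
  proof (cases "T = 0")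
    case True
    then have "\<forall>i\<in>I. f i = 0"
      using I \<mu>(1) M by (simp add: T_def sum_nonneg_eq_0_iff less_imp_le less_imp_neq[symmetric])
    then show ?thesis using True by (simp add: lin_comb_def)
  next
    case False
    moreover have "T \<ge> 0" unfolding T_def using \<mu>(1) M by (intro sum_nonneg) (auto simp: less_imp_le)
    ultimately have T: "T > 0" by simp
    define L where "L = T powr (1/r)"
    have L: "L > 0" "L powr r = T" using T r by (simp_all add: L_def powr_powr)
    have "norm (of_real (1/L) * f i) powr r = norm (f i) powr r / T" for i
      using L by (simp add: norm_mult norm_divide powr_divide)
    then have "(\<Sum>i\<in>I. \<mu> i / M * norm (of_real (1/L) * f i) powr r) = T / T"
      by (simp only: T_def times_divide_eq_right sum_divide_distrib[symmetric])
    then have "norm (?u (\<lambda>i. of_real (1/L) * f i)) \<le> C" using T by (intro unit) simp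
    then show ?thesis unfolding lin_comb_scale[OF s] using L by (simp add: L_def[symmetric] field_simps)
  qed
  then show ?thesis by (simp add: C_def d_def T_def)
qed

section \<open>The Orlicz property\<close>

text \<open>
  The consequence of cotype 2 in which the average over the signs is replaced by a uniform bound. It
  holds for \<open>\<ell>\<^sub>1\<close> as well, and it suffices for the domination theorem.
\<close>

definition orlicz :: "'y::real_normed_vector set \<Rightarrow> real \<Rightarrow> bool" where
  "orlicz S K \<longleftrightarrow> (\<forall>M (y :: nat \<Rightarrow> 'y) D. (\<forall>m<M. y m \<in> S) \<and>
     (\<forall>c. (\<forall>m. \<bar>c m\<bar> \<le> 1) \<longrightarrow> norm (\<Sum>m<M. c m *\<^sub>R y m) \<le> D) \<longrightarrow>
     (\<Sum>m<M. (norm (y m))\<^sup>2) \<le> (K * D)\<^sup>2)"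

text \<open>
  An average is at most the supremum; the Rademacher functions take values in \<open>{-1, 0, 1}\<close>.
\<close>

lemma cotype_2_imp_orlicz:
  assumes "cotype_2 S"
  obtains K where "K > 0" "orlicz S K"
proof -
  obtain K where K: "K \<ge> 0" and cot: "\<And>n x. (\<forall>i\<in>{1..n}. x i \<in> S) \<Longrightarrow>
     sqrt (\<Sum>i=1..n. (norm (x i))\<^sup>2)
       \<le> K * sqrt (LINT t:{0..1}|lborel. (norm (\<Sum>i=1..n. rademacher i t *\<^sub>R x i))\<^sup>2)"
    using assms unfolding cotype_2_def by blast
  have "orlicz S (K + 1)" unfolding orlicz_def
  proof (intro allI impI, elim conjE)
    fix M and y :: "nat \<Rightarrow> 'a" and D
    assume S: "\<forall>m<M. y m \<in> S" and D: "\<forall>c. (\<forall>m. \<bar>c m\<bar> \<le> 1) \<longrightarrow> norm (\<Sum>m<M. c m *\<^sub>R y m) \<le> D"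
    have D0: "D \<ge> 0" using D[rule_format, of "\<lambda>_. 0"] by simp
    define x where "x i = y (i - 1)" for i
    have shift: "(\<Sum>i=1..M. h i) = (\<Sum>m<M. h (Suc m))" for h :: "nat \<Rightarrow> 'z::comm_monoid_add"
      by (rule sum.reindex_bij_witness[of _ Suc "\<lambda>i. i - 1"]) auto
    have le: "norm (\<Sum>i=1..M. rademacher i t *\<^sub>R x i) \<le> D" for t
      unfolding shift using D[rule_format, of "\<lambda>m. rademacher (Suc m) t"]
      by (simp add: x_def rademacher_def sgn_real_def)
    have int_le: "(LINT t:{0..1}|lborel. (norm (\<Sum>i=1..M. rademacher i t *\<^sub>R x i))\<^sup>2)
      \<le> (LINT t:{0..1::real}|lborel. D\<^sup>2)"
      unfolding set_lebesgue_integral_def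
    proof (rule integral_mono')
      show "integrable lborel (\<lambda>t. indicat_real {0..1::real} t *\<^sub>R D\<^sup>2)"
        by (rule integrable_scaleR_left, rule integrable_real_indicator) auto
      show "indicat_real {0..1} t *\<^sub>R (norm (\<Sum>i=1..M. rademacher i t *\<^sub>R x i))\<^sup>2
        \<le> indicat_real {0..1} t *\<^sub>R D\<^sup>2" for t
        unfolding real_scaleR_def by (intro mult_left_mono power_mono le norm_ge_zero indicator_pos_le)
      show "0 \<le> indicat_real {0..1} t *\<^sub>R D\<^sup>2" for t :: real
        unfolding real_scaleR_def by (intro mult_nonneg_nonneg zero_le_power2 indicator_pos_le)
    qed
    have "(LINT t:{0..1::real}|lborel. D\<^sup>2) = (LINT t|lborel. indicat_real {0..1::real} t) *\<^sub>R D\<^sup>2"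
      unfolding set_lebesgue_integral_def
      by (rule integral_scaleR_left) (rule integrable_real_indicator; simp)
    then have int_const: "(LINT t:{0..1::real}|lborel. D\<^sup>2) = D\<^sup>2" by simp
    have int: "sqrt (LINT t:{0..1}|lborel. (norm (\<Sum>i=1..M. rademacher i t *\<^sub>R x i))\<^sup>2) \<le> D"
      by (rule real_le_lsqrt) (use int_le int_const D0 in \<open>simp_all only:\<close>)
    have "sqrt (\<Sum>i=1..M. (norm (x i))\<^sup>2) \<le> K * D"
      by (rule order_trans[OF cot]) (use S int K in \<open>auto simp: x_def intro!: mult_left_mono\<close>)
    also have "\<dots> \<le> (K + 1) * D" using D0 by (simp add: algebra_simps)
    finally have "(\<Sum>i=1..M. (norm (x i))\<^sup>2) \<le> ((K + 1) * D)\<^sup>2" by (rule sqrt_le_D)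
    then show "(\<Sum>m<M. (norm (y m))\<^sup>2) \<le> ((K + 1) * D)\<^sup>2" unfolding shift by (simp add: x_def)
  qed
  then show thesis using K that[of "K + 1"] by simp
qed

lemma L2_set_sum_le: "L2_set (\<lambda>m. \<Sum>k\<in>L. h m k) M \<le> (\<Sum>k\<in>L. L2_set (\<lambda>m. h m k) M)"
proof (induction L rule: infinite_finite_induct)
  case (insert k L)
  then show ?case using L2_set_triangle_ineq[of "\<lambda>m. h m k" "\<lambda>m. \<Sum>k\<in>L. h m k" M] by simp
qed (auto simp: L2_set_0')

lemma signed_sum_linear_image:
  assumes "linear g"
  shows "g (signed_sum J a A) = signed_sum J (\<lambda>j. g (a j)) A"
  unfolding signed_sum_def linear_sum[OF assms] by (rule sum.cong) (auto simp: linear_neg[OF assms])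

text \<open>
  Khintchine's inequality for \<open>p = 1\<close> in each of the coordinates, summed up.
\<close>

lemma khintchine_l1:
  fixes g :: "'l \<Rightarrow> 'y::real_normed_vector \<Rightarrow> 'k::real_or_complex"
  assumes g: "\<And>k. linear (g k)" and B: "\<And>z. (\<Sum>k\<in>L. norm (g k z)) \<le> B * norm z" and J: "finite J"
  shows "(\<Sum>k\<in>L. L2_set (\<lambda>j. norm (g k (y j))) J) \<le> 12 * B * sign_mean J (\<lambda>A. norm (signed_sum J y A))"
proof -
  have "(\<Sum>k\<in>L. L2_set (\<lambda>j. norm (g k (y j))) J)
    \<le> (\<Sum>k\<in>L. 12 * sign_mean J (\<lambda>A. norm (g k (signed_sum J y A))))"
  proof (rule sum_mono)
    fix k
    show "L2_set (\<lambda>j. norm (g k (y j))) J \<le> 12 * sign_mean J (\<lambda>A. norm (g k (signed_sum J y A)))"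
      using khintchine(1)[OF J, of 1 "\<lambda>j. g k (y j)"] by (simp add: signed_sum_linear_image[OF g])
  qed
  also have "\<dots> = 12 * sign_mean J (\<lambda>A. \<Sum>k\<in>L. norm (g k (signed_sum J y A)))"
    by (simp add: sign_mean_sum sum_distrib_left)
  also have "\<dots> \<le> 12 * sign_mean J (\<lambda>A. B * norm (signed_sum J y A))"
    by (intro mult_left_mono sign_mean_mono B) simp
  finally show ?thesis by (simp add: sign_mean_cmult)
qed

text \<open>
  If the functionals \<open>g k\<close> identify the norm with an \<open>\<ell>\<^sub>1\<close>-norm, Minkowski's inequality in \<open>\<ell>\<^sub>2\<close>
  reduces the claim to the square functions of the coordinates.
\<close>

lemma orlicz_of_l1_coordinates:
  fixes g :: "'l \<Rightarrow> 'y::real_normed_vector \<Rightarrow> 'k::real_or_complex" and M :: nat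
  assumes g: "\<And>k. linear (g k)" and B: "\<And>z. (\<Sum>k\<in>L. norm (g k z)) \<le> B * norm z"
    and A: "\<And>m. m < M \<Longrightarrow> norm (y m) \<le> A * (\<Sum>k\<in>L. norm (g k (y m)))"
    and D: "\<And>c. (\<forall>m. \<bar>c m\<bar> \<le> 1) \<Longrightarrow> norm (\<Sum>m<M. c m *\<^sub>R y m) \<le> D" and AB: "A \<ge> 0" "B \<ge> 0"
  shows "(\<Sum>m<M. (norm (y m))\<^sup>2) \<le> (12 * A * B * D)\<^sup>2"
proof -
  have "L2_set (\<lambda>m. norm (y m)) {..<M} \<le> L2_set (\<lambda>m. A * (\<Sum>k\<in>L. norm (g k (y m)))) {..<M}"
    by (rule L2_set_mono) (use A in auto)
  also have "\<dots> = A * L2_set (\<lambda>m. \<Sum>k\<in>L. norm (g k (y m))) {..<M}"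
    using AB by (simp add: L2_set_right_distrib)
  also have "L2_set (\<lambda>m. \<Sum>k\<in>L. norm (g k (y m))) {..<M} \<le> (\<Sum>k\<in>L. L2_set (\<lambda>m. norm (g k (y m))) {..<M})"
    by (rule L2_set_sum_le)
  also have "\<dots> \<le> 12 * B * sign_mean {..<M} (\<lambda>A. norm (signed_sum {..<M} y A))"
    by (rule khintchine_l1[OF g B]) simp
  also have "sign_mean {..<M} (\<lambda>A. norm (signed_sum {..<M} y A)) \<le> sign_mean {..<M} (\<lambda>A. D)"
  proof (rule sign_mean_mono)
    fix E
    have "signed_sum {..<M} y E = (\<Sum>m<M. (if m \<in> E then 1 else - 1) *\<^sub>R y m)"
      unfolding signed_sum_def by (rule sum.cong) auto
    then show "norm (signed_sum {..<M} y E) \<le> D" using D[of "\<lambda>m. if m \<in> E then 1 else - 1"] by simp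
  qed
  finally have "L2_set (\<lambda>m. norm (y m)) {..<M} \<le> 12 * A * B * D"
    using AB by (simp add: sign_mean_const mult_left_mono mult.assoc mult.left_commute)
  then show ?thesis unfolding L2_set_def by (rule sqrt_le_D)
qed

text \<open>
  Each family in \<open>S\<close> that defines an operator from \<open>\<ell>\<^sub>\<infinity>\<close> of norm at most \<open>D\<close> is dominated by the
  norm of \<open>L\<^sub>r\<close> of some probability measure; \<open>C\<close> depends only on \<open>S\<close> and \<open>r\<close>.
\<close>

definition lr_dominated ::
  "('k::real_or_complex \<Rightarrow> 'y::real_normed_vector \<Rightarrow> 'y) \<Rightarrow> 'y set \<Rightarrow> real \<Rightarrow> real \<Rightarrow> bool" where
  "lr_dominated s S r C \<longleftrightarrow> (\<forall>(I :: nat set) x D. finite I \<and> (\<forall>i\<in>I. x i \<in> S) \<and> D > 0 \<and>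
     (\<forall>f. (\<forall>i\<in>I. norm (f i) \<le> 1) \<longrightarrow> norm (lin_comb s I x f) \<le> D) \<longrightarrow>
     (\<exists>\<nu>. (\<forall>i. \<nu> i > 0) \<and> (\<Sum>i\<in>I. \<nu> i) \<le> 1 \<and>
       (\<forall>f. norm (lin_comb s I x f) \<le> C * D * (\<Sum>i\<in>I. \<nu> i * norm (f i) powr r) powr (1 / r))))"

lemma lr_dominatedE:
  fixes I :: "nat set"
  assumes "lr_dominated s S r C" "finite I" "\<And>i. i \<in> I \<Longrightarrow> x i \<in> S" "D > 0"
    "\<And>f. (\<And>i. i \<in> I \<Longrightarrow> norm (f i) \<le> 1) \<Longrightarrow> norm (lin_comb s I x f) \<le> D"
  obtains \<nu> where "\<And>i. \<nu> i > 0" "(\<Sum>i\<in>I. \<nu> i) \<le> 1"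
    "\<And>f. norm (lin_comb s I x f) \<le> C * D * (\<Sum>i\<in>I. \<nu> i * norm (f i) powr r) powr (1 / r)"
proof -
  have "\<exists>\<nu>. (\<forall>i. \<nu> i > 0) \<and> (\<Sum>i\<in>I. \<nu> i) \<le> 1 \<and>
       (\<forall>f. norm (lin_comb s I x f) \<le> C * D * (\<Sum>i\<in>I. \<nu> i * norm (f i) powr r) powr (1 / r))"
    by (rule assms(1)[unfolded lr_dominated_def, rule_format]) (use assms(2-5) in auto)
  then show thesis using that by blast
qed

text \<open>
  For functions with \<open>\<Sum>|f m| \<le> 1\<close>, the combinations with coefficients in \<open>[-1, 1]\<close> are bounded by 1,
  so the Orlicz property of their images is the summing property that the domination theorem for
  \<open>e = 1\<close> requires.
\<close>

theorem orlicz_imp_lr_dominated: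
  fixes s :: "'k::real_or_complex \<Rightarrow> 'y::real_normed_vector \<Rightarrow> 'y"
  assumes s: "normed_space_over s" and S: "module.subspace s S" and K: "K > 0" "orlicz S K" and r: "r > 2"
  obtains C where "C > 0" "lr_dominated s S r C"
proof -
  interpret s: normed_space_over s by fact
  define B where "B = 2 powr (r/2) * two_sided_bound (min 1 (r/2 - 1))"
  have B: "B \<ge> 0" using r two_sided_bound_nonneg[of "min 1 (r/2 - 1)"] by (simp add: B_def)
  show thesis
  proof (rule that[of "B * sqrt 3 * K + 1"])
    show "B * sqrt 3 * K + 1 > 0" using B K by (simp add: add_nonneg_pos)
    show "lr_dominated s S r (B * sqrt 3 * K + 1)" unfolding lr_dominated_def
    proof (intro allI impI, elim conjE)
      fix I :: "nat set" and x :: "nat \<Rightarrow> 'y" and D :: real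
      assume I: "finite I" and "\<forall>i\<in>I. x i \<in> S" and D: "D > 0"
        and bd': "\<forall>f. (\<forall>i\<in>I. norm (f i) \<le> 1) \<longrightarrow> norm (lin_comb s I x f) \<le> D"
      then have xS: "\<And>i. i \<in> I \<Longrightarrow> x i \<in> S" by blast
      have bd: "norm (lin_comb s I x f) \<le> D" if "\<And>i. i \<in> I \<Longrightarrow> norm (f i) \<le> 1" for f
        using bd' that by blast
      let ?u = "lin_comb s I x"
      show "\<exists>\<nu>. (\<forall>i. \<nu> i > 0) \<and> (\<Sum>i\<in>I. \<nu> i) \<le> 1 \<and>
           (\<forall>f. norm (?u f) \<le> (B * sqrt 3 * K + 1) * D * (\<Sum>i\<in>I. \<nu> i * norm (f i) powr r) powr (1/r))"
      proof (cases "I = {}")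
        case True
        then show ?thesis by (intro exI[of _ "\<lambda>_. 1"]) (simp add: lin_comb_def)
      next
        case False
        have uS: "?u f \<in> S" for f
          unfolding lin_comb_def by (intro s.subspace_sum[OF S] s.subspace_scale[OF S] xS)
        have summing: "(\<Sum>m<M. (norm (?u (f m)))\<^sup>2) \<le> (K * D)\<^sup>2"
          if f: "\<And>i. i \<in> I \<Longrightarrow> (\<Sum>m<M. norm (f m i) powr 1) \<le> 1" for M and f :: "nat \<Rightarrow> nat \<Rightarrow> 'k"
        proof (rule K(2)[unfolded orlicz_def, rule_format], intro conjI allI impI)
          show "?u (f m) \<in> S" for m by (rule uS)
          fix c :: "nat \<Rightarrow> real" assume c: "\<forall>m. \<bar>c m\<bar> \<le> 1"
          have "(\<Sum>m<M. c m *\<^sub>R ?u (f m)) = (\<Sum>m<M. \<Sum>i\<in>I. s (of_real (c m) * f m i) (x i))"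
            unfolding lin_comb_def scaleR_sum_right
            by (intro sum.cong refl) (simp flip: s.scale_of_real)
          also have "\<dots> = ?u (\<lambda>i. \<Sum>m<M. of_real (c m) * f m i)"
            unfolding lin_comb_def s.scale_sum_left by (rule sum.swap)
          finally have eq: "(\<Sum>m<M. c m *\<^sub>R ?u (f m)) = ?u (\<lambda>i. \<Sum>m<M. of_real (c m) * f m i)" .
          show "norm (\<Sum>m<M. c m *\<^sub>R ?u (f m)) \<le> D" unfolding eq
          proof (rule bd)
            fix i assume i: "i \<in> I"
            have "norm (\<Sum>m<M. of_real (c m) * f m i) \<le> (\<Sum>m<M. norm (of_real (c m) * f m i))"
              by (rule norm_sum)
            also have "\<dots> \<le> (\<Sum>m<M. norm (f m i) powr 1)"
              using c by (intro sum_mono) (simp add: norm_mult mult_left_le_one_le)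
            also have "\<dots> \<le> 1" by (rule f[OF i])
            finally show "norm (\<Sum>m<M. of_real (c m) * f m i) \<le> 1" .
          qed
        qed
        have KD: "K * D > 0" using K D by simp
        obtain \<mu> :: "nat \<Rightarrow> real" where \<mu>: "\<And>i. \<mu> i > 0" "(\<Sum>i\<in>I. \<mu> i) \<le> 3 * (K * D)\<^sup>2"
          and dom: "\<And>f. (\<And>i. i \<in> I \<Longrightarrow> norm (f i) \<le> 1) \<Longrightarrow> (\<exists>i\<in>I. norm (f i) = 1) \<Longrightarrow>
            (norm (?u f))\<^sup>2 \<le> (\<Sum>i\<in>I. \<mu> i * norm (f i) powr 1)"
          using domination[OF s I False order_refl KD summing] by blast
        define M where "M = 3 * (K * D)\<^sup>2"
        have M: "M > 0" using K D by (simp add: M_def)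
        have sM: "sqrt M = sqrt 3 * (K * D)" using K D by (simp add: M_def real_sqrt_mult)
        show ?thesis
        proof (intro exI[of _ "\<lambda>i. \<mu> i / M"] conjI allI)
          show "\<mu> i / M > 0" for i using \<mu> M by simp
          show "(\<Sum>i\<in>I. \<mu> i / M) \<le> 1" using \<mu>(2) M by (simp add: M_def flip: sum_divide_distrib)
          fix f :: "nat \<Rightarrow> 'k"
          let ?T = "(\<Sum>i\<in>I. \<mu> i / M * norm (f i) powr r) powr (1/r)"
          have "norm (?u f) \<le> B * sqrt M * ?T"
            unfolding B_def by (rule lr_domination[OF s I r M \<mu>(1)]) (use \<mu>(2) dom in \<open>auto simp: M_def\<close>)
          also have "\<dots> = (B * sqrt 3 * K) * D * ?T" by (simp add: sM)
          also have "\<dots> \<le> (B * sqrt 3 * K + 1) * D * ?T"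
            using D by (intro mult_right_mono) auto
          finally show "norm (?u f) \<le> (B * sqrt 3 * K + 1) * D * ?T" .
        qed
      qed
    qed
  qed
qed

text \<open>
  Up to a constant, the square function of the images is at most the mean of \<open>|u (\<Sum>\<plusminus>A n)|\<close>. The
  latter is at most an \<open>L\<^sub>4\<close>-norm of \<open>\<Sum>\<plusminus>A n\<close>, whose mean is controlled by the fourth moments. In
  effect, the \<open>L\<^sub>4\<close>-domination of \<open>u\<close> becomes a bound in terms of the square function of the
  arguments.
\<close>

lemma krivine_l1:
  fixes s :: "'k::real_or_complex \<Rightarrow> 'y::real_normed_vector \<Rightarrow> 'y" and g :: "'l \<Rightarrow> 'y \<Rightarrow> 'k"
    and I :: "'i set" and N :: "'n set"
  assumes s: "normed_space_over s" and g: "\<And>k. linear (g k)"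
    and B: "\<And>z. (\<Sum>k\<in>L. norm (g k z)) \<le> B * norm z" and fin: "finite I" "finite N" and BC: "B \<ge> 0" "C \<ge> 0"
    and \<nu>: "\<And>i. \<nu> i > 0" "(\<Sum>i\<in>I. \<nu> i) \<le> 1"
    and dom: "\<And>f. norm (lin_comb s I x f) \<le> C * (\<Sum>i\<in>I. \<nu> i * norm (f i) ^ 4) powr (1/4)"
    and A: "\<And>i. i \<in> I \<Longrightarrow> (\<Sum>n\<in>N. (norm (A n i))\<^sup>2) \<le> 1"
  shows "(\<Sum>k\<in>L. L2_set (\<lambda>n. norm (g k (lin_comb s I x (A n)))) N) \<le> 48 * B * C"
proof -
  interpret s: normed_space_over s by fact
  let ?u = "lin_comb s I x"
  define a where "a E i = signed_sum N (\<lambda>n. A n i) E" for E i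
  have sign: "signed_sum N (\<lambda>n. ?u (A n)) E = ?u (a E)" for E
  proof -
    have "signed_sum N (\<lambda>n. ?u (A n)) E = (\<Sum>n\<in>N. \<Sum>i\<in>I. s (if n \<in> E then A n i else - A n i) (x i))"
      unfolding signed_sum_def lin_comb_def by (rule sum.cong) (auto simp: sum_negf)
    also have "\<dots> = ?u (a E)"
      unfolding lin_comb_def a_def signed_sum_def s.scale_sum_left by (rule sum.swap)
    finally show ?thesis .
  qed
  have bern: "t powr (1/4) \<le> 1 + t" if "t \<ge> 0" for t :: real
  proof (cases "t \<ge> 1")
    case True
    then have "t powr (1/4) \<le> t powr 1" by (intro powr_mono) auto
    then show ?thesis using True by simp
  next
    case False
    then have "t powr (1/4) \<le> 1" using that by (intro powr_le1) auto
    then show ?thesis using that by simp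
  qed
  have "(\<Sum>k\<in>L. L2_set (\<lambda>n. norm (g k (?u (A n)))) N) \<le> 12 * B * sign_mean N (\<lambda>E. norm (?u (a E)))"
    using khintchine_l1[OF g B fin(2), of "\<lambda>n. ?u (A n)"] unfolding sign .
  also have "sign_mean N (\<lambda>E. norm (?u (a E))) \<le> sign_mean N (\<lambda>E. C * (1 + (\<Sum>i\<in>I. \<nu> i * norm (a E i) ^ 4)))"
  proof (rule sign_mean_mono)
    fix E
    have "norm (?u (a E)) \<le> C * (\<Sum>i\<in>I. \<nu> i * norm (a E i) ^ 4) powr (1/4)" by (rule dom)
    also have "\<dots> \<le> C * (1 + (\<Sum>i\<in>I. \<nu> i * norm (a E i) ^ 4))"
      using \<nu>(1) by (intro mult_left_mono bern sum_nonneg BC mult_nonneg_nonneg) (auto simp: less_imp_le)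
    finally show "norm (?u (a E)) \<le> C * (1 + (\<Sum>i\<in>I. \<nu> i * norm (a E i) ^ 4))" .
  qed
  also have "sign_mean N (\<lambda>E. C * (1 + (\<Sum>i\<in>I. \<nu> i * norm (a E i) ^ 4)))
      = C * (1 + (\<Sum>i\<in>I. \<nu> i * sign_mean N (\<lambda>E. norm (a E i) ^ 4)))"
    by (simp add: sign_mean_cmult sign_mean_add sign_mean_const fin sign_mean_sum)
  also have "\<dots> \<le> C * (1 + (\<Sum>i\<in>I. \<nu> i * 3))"
  proof (intro mult_left_mono add_left_mono sum_mono BC)
    fix i assume i: "i \<in> I"
    have "sign_mean N (\<lambda>E. norm (a E i) ^ 4) \<le> 3 * (\<Sum>n\<in>N. (norm (A n i))\<^sup>2)\<^sup>2"
      unfolding a_def by (rule fourth_moment[OF fin(2)])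
    also have "\<dots> \<le> 3 * 1\<^sup>2" using A[OF i] by (intro mult_left_mono power_mono sum_nonneg) auto
    finally show "sign_mean N (\<lambda>E. norm (a E i) ^ 4) \<le> 3" by simp
  qed (use \<nu>(1) less_imp_le in blast)
  also have "\<dots> \<le> C * 4" using \<nu>(2) BC by (intro mult_left_mono) (auto simp flip: sum_distrib_right)
  finally show ?thesis using BC by (simp add: mult_left_mono)
qed

section \<open>The finite form of the operator classes\<close>

lemma operators_iff:
  assumes "normed_space_over sE" "normed_space_over sF"
  shows "T \<in> operators sE sF \<longleftrightarrow> (\<forall>c x. blinfun_apply T (sE c x) = sF c (blinfun_apply T x))"
proof -
  interpret E: normed_space_over sE by fact
  interpret F: normed_space_over sF by fact
  show ?thesis
    by (simp add: operators_def Vector_Spaces.linear_iff E.vector_space_axioms F.vector_space_axioms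
      blinfun.add_right)
qed

lemma dual_iff:
  assumes "normed_space_over sF"
  shows "f \<in> dual sF \<longleftrightarrow> (\<forall>c x. blinfun_apply f (sF c x) = c * blinfun_apply f x)"
  unfolding dual_def by (rule operators_iff[OF assms normed_space_over_scalars])

lemma subspace_dual:
  assumes "normed_space_over sF"
  shows "module.subspace dual_scale (dual sF)"
proof -
  interpret D: normed_space_over "dual_scale :: 'a \<Rightarrow> ('b \<Rightarrow>\<^sub>L 'a) \<Rightarrow> ('b \<Rightarrow>\<^sub>L 'a)"
    by (rule normed_space_over_dual)
  show ?thesis
    by (auto simp: D.subspace_def dual_iff[OF assms] blinfun.add_left algebra_simps)
qed

text \<open>
  For complex scalars, the dual space is a proper subspace of the type of bounded real-linear maps;
  the notions for \<open>E\<close> and \<open>F*\<close> are treated together.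
\<close>

locale scaled_subspace = normed_space_over s for s :: "'k::real_or_complex \<Rightarrow> 'a::real_normed_vector \<Rightarrow> 'a" +
  fixes S :: "'a set"
  assumes S: "subspace S"
begin

lemma scaleR_mem: "x \<in> S \<Longrightarrow> r *\<^sub>R x \<in> S"
  using subspace_scale[OF S, of x "of_real r"] by (simp add: scale_of_real)

context
  fixes \<phi> assumes \<phi>: "\<phi> \<in> dual_ball S s"
begin

lemma dual_ball_scale: "x \<in> S \<Longrightarrow> \<phi> (s c x) = c * \<phi> x"
  and dual_ball_add: "x \<in> S \<Longrightarrow> y \<in> S \<Longrightarrow> \<phi> (x + y) = \<phi> x + \<phi> y"
  and dual_ball_le: "x \<in> S \<Longrightarrow> norm (\<phi> x) \<le> norm x"
  using \<phi> by (auto simp: dual_ball_def linear_map_on_def)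

lemma dual_ball_scaleR: "x \<in> S \<Longrightarrow> \<phi> (r *\<^sub>R x) = r *\<^sub>R \<phi> x"
  using dual_ball_scale[of x "of_real r"] by (simp add: scale_of_real scaleR_conv_of_real)

lemma dual_ball_0: "\<phi> 0 = 0"
  using dual_ball_scale[of 0 0] subspace_0[OF S] by simp

lemma dual_ball_sum: "(\<And>i. i \<in> I \<Longrightarrow> x i \<in> S) \<Longrightarrow> \<phi> (\<Sum>i\<in>I. x i) = (\<Sum>i\<in>I. \<phi> (x i))"
  by (induction I rule: infinite_finite_induct)
    (auto simp: dual_ball_0 dual_ball_add subspace_sum[OF S])

end

end

definition wk_bounded ::
  "real \<Rightarrow> 'a set \<Rightarrow> ('k::real_or_complex \<Rightarrow> 'a::real_normed_vector \<Rightarrow> 'a) \<Rightarrow> 'i set \<Rightarrow> ('i \<Rightarrow> 'a) \<Rightarrow> real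
    \<Rightarrow> bool" where
  "wk_bounded p S s I x A \<longleftrightarrow> (\<forall>i\<in>I. x i \<in> S) \<and>
     (\<forall>\<phi>\<in>dual_ball S s. (\<Sum>i\<in>I. norm (\<phi> (x i)) powr p) \<le> A)"

definition mid_bounded ::
    "real \<Rightarrow> ('k::real_or_complex \<Rightarrow> 'e::real_normed_vector \<Rightarrow> 'e)
      \<Rightarrow> ('k \<Rightarrow> 'f::real_normed_vector \<Rightarrow> 'f) \<Rightarrow> ('e \<Rightarrow>\<^sub>L 'f) \<Rightarrow> real \<Rightarrow> bool" where
  "mid_bounded p sE sF T C \<longleftrightarrow> (\<forall>(I :: nat set) (J :: nat set) x y. finite I \<and> finite J \<and>
     wk_bounded p UNIV sE I x 1 \<and> wk_bounded p (dual sF) dual_scale J y 1 \<longrightarrow>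
     (\<Sum>i\<in>I. \<Sum>j\<in>J. norm (blinfun_apply (y j) (blinfun_apply T (x i))) powr p) \<le> C)"

context scaled_subspace
begin

lemma wk_bounded_scaleR:
  assumes "wk_bounded p S s I x A" "r \<ge> 0"
  shows "wk_bounded p S s I (\<lambda>i. r *\<^sub>R x i) (r powr p * A)"
proof -
  have "(\<Sum>i\<in>I. norm (\<phi> (r *\<^sub>R x i)) powr p) = r powr p * (\<Sum>i\<in>I. norm (\<phi> (x i)) powr p)"
    if "\<phi> \<in> dual_ball S s" for \<phi>
    unfolding sum_distrib_left
    by (rule sum.cong) (use assms in \<open>auto simp: dual_ball_scaleR[OF that] wk_bounded_def powr_mult\<close>)
  then show ?thesis using assms by (auto simp: wk_bounded_def scaleR_mem intro!: mult_left_mono)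
qed

lemma wk_bounded_reindex:
  assumes "bij_betw h J I" "wk_bounded p S s I x A"
  shows "wk_bounded p S s J (\<lambda>j. x (h j)) A"
proof -
  have "(\<Sum>j\<in>J. norm (\<phi> (x (h j))) powr p) = (\<Sum>i\<in>I. norm (\<phi> (x i)) powr p)" for \<phi> :: "'a \<Rightarrow> 'k"
    by (rule sum.reindex_bij_betw[OF assms(1)])
  then show ?thesis using assms(2) bij_betw_apply[OF assms(1)] by (simp add: wk_bounded_def)
qed

lemma weakly_summable_imp_wk_bounded:
  assumes x: "x \<in> weakly_summable p S s" and p: "p \<ge> 1"
  obtains A where "A > 0" "\<And>N. wk_bounded p S s {..<N} x A"
proof -
  from x have xS: "\<And>j. x j \<in> S"
    and "\<exists>C. \<forall>\<phi>\<in>dual_ball S s. summable (\<lambda>j. norm (\<phi> (x j)) powr p) \<and>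
        (\<Sum>j. norm (\<phi> (x j)) powr p) powr (1 / p) \<le> C"
    unfolding weakly_summable_def by simp_all
  then obtain C where "\<forall>\<phi>\<in>dual_ball S s. summable (\<lambda>j. norm (\<phi> (x j)) powr p) \<and>
        (\<Sum>j. norm (\<phi> (x j)) powr p) powr (1 / p) \<le> C" by (elim exE)
  note C = this[rule_format]
  have "(\<Sum>j<N. norm (\<phi> (x j)) powr p) \<le> (max C 1) powr p" if \<phi>: "\<phi> \<in> dual_ball S s" for \<phi> N
  proof -
    define T where "T = (\<Sum>j. norm (\<phi> (x j)) powr p)"
    have T: "T \<ge> 0" unfolding T_def using C[OF \<phi>] by (intro suminf_nonneg) auto
    have "(\<Sum>j<N. norm (\<phi> (x j)) powr p) \<le> T"
      unfolding T_def using C[OF \<phi>] by (intro sum_le_suminf) auto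
    also have "T = (T powr (1/p)) powr p" using T p by (simp add: powr_powr)
    also have "\<dots> \<le> (max C 1) powr p" using C[OF \<phi>] p by (intro powr_mono2) (auto simp: T_def)
    finally show ?thesis .
  qed
  then have "wk_bounded p S s {..<N} x ((max C 1) powr p)" for N
    using xS by (simp add: wk_bounded_def)
  then show thesis by (intro that[of "(max C 1) powr p"]) auto
qed

text \<open>
  The \<open>k\<close>-th family, scaled by \<open>2^(-k)\<close>, occupies the indices \<open>prod_encode (k, i)\<close>; its weak \<open>p\<close>-th
  power sums are then at most \<open>2^(-k)\<close>.
\<close>

lemma glued_weakly_summable:
  assumes p: "p \<ge> 1" and fin: "\<And>k. finite (I k)" and x: "\<And>k. wk_bounded p S s (I k) (x k) 1"
  shows "(\<lambda>m. case prod_decode m of (k, i) \<Rightarrow>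
    if i \<in> I k then (1/2) ^ k *\<^sub>R x k i else 0) \<in> weakly_summable p S s"
    (is "?X \<in> _")
proof -
  have xS: "x k i \<in> S" if "i \<in> I k" for k i using x[of k] that by (simp add: wk_bounded_def)
  have XS: "?X m \<in> S" for m
    by (auto split: prod.split simp: xS scaleR_mem subspace_0[OF S])
  have part: "(\<Sum>m<N. norm (\<phi> (?X m)) powr p) \<le> 2" if \<phi>: "\<phi> \<in> dual_ball S s" for \<phi> N
  proof -
    define h where "h z = (if snd z \<in> I (fst z) then ((1/2) ^ fst z) powr p
      * norm (\<phi> (x (fst z) (snd z))) powr p else 0)" for z
    have h: "norm (\<phi> (?X m)) powr p = h (prod_decode m)" for m
      by (auto simp: h_def dual_ball_scaleR[OF \<phi>] xS dual_ball_0[OF \<phi>] powr_mult norm_power split: prod.split)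
    have h0: "h z \<ge> 0" for z by (simp add: h_def)
    let ?A = "prod_decode ` {..<N}"
    have "(\<Sum>m<N. norm (\<phi> (?X m)) powr p) = (\<Sum>z\<in>?A. h z)"
      unfolding h by (subst sum.reindex) (auto intro: inj_prod_decode)
    also have "\<dots> = (\<Sum>z\<in>?A \<inter> {z. snd z \<in> I (fst z)}. h z)"
      by (rule sum.mono_neutral_right) (auto simp: h_def)
    also have "\<dots> \<le> (\<Sum>z\<in>Sigma {..<N} I. h z)"
    proof (rule sum_mono2)
      show "?A \<inter> {z. snd z \<in> I (fst z)} \<subseteq> Sigma {..<N} I"
      proof
        fix z assume z: "z \<in> ?A \<inter> {z. snd z \<in> I (fst z)}"
        then obtain m where m: "m < N" "z = prod_decode m" by auto
        then have "fst z \<le> m" using le_prod_encode_1[of "fst z" "snd z"] by simp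
        then have "fst z \<in> {..<N}" "snd z \<in> I (fst z)" using m z by auto
        then show "z \<in> Sigma {..<N} I" by (metis mem_Sigma_iff prod.collapse)
      qed
    qed (use fin h0 in auto)
    also have "\<dots> = (\<Sum>k<N. \<Sum>i\<in>I k. h (k, i))"
      using fin by (simp add: sum.Sigma)
    also have "\<dots> = (\<Sum>k<N. ((1/2) ^ k) powr p * (\<Sum>i\<in>I k. norm (\<phi> (x k i)) powr p))"
      by (simp add: h_def sum_distrib_left)
    also have "\<dots> \<le> (\<Sum>k<N. (1/2) ^ k)"
    proof (rule sum_mono)
      fix k
      have "((1/2) ^ k) powr p * (\<Sum>i\<in>I k. norm (\<phi> (x k i)) powr p) \<le> ((1/2) ^ k) powr p * 1"
        using x[of k] \<phi> by (intro mult_left_mono) (auto simp: wk_bounded_def)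
      also have "\<dots> \<le> ((1/2) ^ k) powr 1 * 1"
        by (intro mult_right_mono powr_mono') (use p in \<open>auto simp: power_le_one\<close>)
      finally show "((1/2) ^ k) powr p * (\<Sum>i\<in>I k. norm (\<phi> (x k i)) powr p) \<le> (1/2) ^ k" by simp
    qed
    also have "\<dots> \<le> (\<Sum>k. (1/2::real) ^ k)" by (rule sum_le_suminf) auto
    also have "\<dots> = 2" by (simp add: suminf_geometric)
    finally show ?thesis .
  qed
  have sm: "summable (\<lambda>m. norm (\<phi> (?X m)) powr p)" if "\<phi> \<in> dual_ball S s" for \<phi>
    by (rule summableI_nonneg_bounded[of _ 2]) (use part[OF that] in auto)
  have "(\<Sum>m. norm (\<phi> (?X m)) powr p) powr (1/p) \<le> 2 powr (1/p)" if "\<phi> \<in> dual_ball S s" for \<phi>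
    by (intro powr_mono2 suminf_le_const suminf_nonneg sm that part) (use p in auto)
  then show ?thesis using XS sm by (auto simp: weakly_summable_def)
qed

end

locale banach_pair =
  E: normed_space_over sE + F: normed_space_over sF
  for sE :: "'k::real_or_complex \<Rightarrow> 'e::real_normed_vector \<Rightarrow> 'e" and sF :: "'k \<Rightarrow> 'f::real_normed_vector \<Rightarrow> 'f"
begin

sublocale ES: scaled_subspace sE UNIV
  by unfold_locales simp

sublocale DS: scaled_subspace dual_scale "dual sF"
  by (intro scaled_subspace.intro normed_space_over_dual scaled_subspace_axioms.intro subspace_dual
    F.normed_space_over_axioms)

text \<open>
  The defining inequality for arbitrary index types and arbitrary weak norms, by enumeration and
  scaling.
\<close>

lemma mid_boundedD:
  fixes I :: "'i set" and J :: "'j set"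
  assumes T: "mid_bounded p sE sF T C" and fin: "finite I" "finite J" and p: "p \<ge> 1"
    and x: "wk_bounded p UNIV sE I x A" "A > 0" and y: "wk_bounded p (dual sF) dual_scale J y B" "B > 0"
  shows "(\<Sum>i\<in>I. \<Sum>j\<in>J. norm (blinfun_apply (y j) (blinfun_apply T (x i))) powr p) \<le> A * B * C"
proof -
  obtain h k where h: "bij_betw h {0..<card I} I" and k: "bij_betw k {0..<card J} J"
    using ex_bij_betw_nat_finite[OF fin(1)] ex_bij_betw_nat_finite[OF fin(2)] by blast
  define a b where "a = A powr (- 1 / p)" and "b = B powr (- 1 / p)"
  have ab: "a > 0" "b > 0" using x y by (simp_all add: a_def b_def)
  have pa: "a powr p = 1 / A" "b powr p = 1 / B"
    using x(2) y(2) p by (simp_all only: a_def b_def powr_powr) (simp_all add: powr_neg_one)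
  have unit: "a powr p * A = 1" "b powr p * B = 1" using pa x(2) y(2) by simp_all
  have "wk_bounded p UNIV sE {0..<card I} (\<lambda>i. a *\<^sub>R x (h i)) 1"
    using ES.wk_bounded_scaleR[OF ES.wk_bounded_reindex[OF h x(1)] less_imp_le[OF ab(1)]] unit(1)
      by (simp only:)
  moreover have "wk_bounded p (dual sF) dual_scale {0..<card J} (\<lambda>j. b *\<^sub>R y (k j)) 1"
    using DS.wk_bounded_scaleR[OF DS.wk_bounded_reindex[OF k y(1)] less_imp_le[OF ab(2)]] unit(2)
      by (simp only:)
  ultimately have "(\<Sum>i\<in>{0..<card I}. \<Sum>j\<in>{0..<card J}.
      norm (blinfun_apply (b *\<^sub>R y (k j)) (blinfun_apply T (a *\<^sub>R x (h i)))) powr p) \<le> C"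
    using T unfolding mid_bounded_def by blast
  also have "(\<Sum>i\<in>{0..<card I}. \<Sum>j\<in>{0..<card J}.
      norm (blinfun_apply (b *\<^sub>R y (k j)) (blinfun_apply T (a *\<^sub>R x (h i)))) powr p)
     = 1 / A * (1 / B) * (\<Sum>i\<in>{0..<card I}. \<Sum>j\<in>{0..<card J}. norm (blinfun_apply (y (k j)) (blinfun_apply
       T (x (h i)))) powr p)"
    using ab by (simp add: blinfun.bilinear_simps powr_mult pa sum_distrib_left)
  also have "(\<Sum>i\<in>{0..<card I}. \<Sum>j\<in>{0..<card J}. norm (blinfun_apply (y (k j)) (blinfun_apply T (x (h
    i)))) powr p)
     = (\<Sum>i\<in>{0..<card I}. \<Sum>j\<in>J. norm (blinfun_apply (y j) (blinfun_apply T (x (h i)))) powr p)"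
    using sum.reindex_bij_betw[OF k, of "\<lambda>j. norm (blinfun_apply (y j) _) powr p"] by simp
  also have "\<dots> = (\<Sum>i\<in>I. \<Sum>j\<in>J. norm (blinfun_apply (y j) (blinfun_apply T (x i))) powr p)"
    by (rule sum.reindex_bij_betw[OF h])
  finally show ?thesis using x(2) y(2) by (simp add: field_simps)
qed

text \<open>
  If no constant exists, choose families whose sums exceed \<open>4^(k p) * k\<close>. After gluing, the factors
  \<open>2^(-k)\<close> of both families together reduce the \<open>k\<close>-th sum by \<open>4^(- k p)\<close>, and what remains is
  unbounded in \<open>k\<close>.
\<close>

theorem W_mid_iff_mid_bounded:
  assumes p: "p \<ge> 1"
  shows "T \<in> W_mid p sE sF \<longleftrightarrow> T \<in> operators sE sF \<and> (\<exists>C. mid_bounded p sE sF T C)"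
proof (intro iffI conjI)
  assume T: "T \<in> W_mid p sE sF"
  then show "T \<in> operators sE sF" by (simp add: W_mid_def)
  show "\<exists>C. mid_bounded p sE sF T C"
  proof (rule ccontr)
    let ?n = "\<lambda>y x. norm (blinfun_apply y (blinfun_apply T x)) powr p"
    assume "\<nexists>C. mid_bounded p sE sF T C"
    then have "\<not> mid_bounded p sE sF T ((4 ^ k) powr p * k)" for k :: nat by blast
    then have "\<forall>k::nat. \<exists>(I :: nat set) (J :: nat set) x y. finite I \<and> finite J \<and>
     wk_bounded p UNIV sE I x 1 \<and> wk_bounded p (dual sF) dual_scale J y 1 \<and>
     (4 ^ k) powr p * k < (\<Sum>i\<in>I. \<Sum>j\<in>J. ?n (y j) (x i))"
      unfolding mid_bounded_def not_all not_imp not_le conj_assoc by (intro allI)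
    then obtain I J :: "nat \<Rightarrow> nat set" and x y where IJ: "\<And>k. finite (I k)" "\<And>k. finite (J k)"
      and x: "\<And>k. wk_bounded p UNIV sE (I k) (x k) 1"
        and y: "\<And>k. wk_bounded p (dual sF) dual_scale (J k) (y k) 1"
      and big: "\<And>k. (4 ^ k) powr p * k < (\<Sum>i\<in>I k. \<Sum>j\<in>J k. ?n (y k j) (x k i))"
      by metis
    define X where "X m = (case prod_decode m of (k, i) \<Rightarrow> if i \<in> I k then (1/2) ^ k *\<^sub>R x k i else 0)" for m
    define Y where "Y m = (case prod_decode m of (k, j) \<Rightarrow> if j \<in> J k then (1/2) ^ k *\<^sub>R y k j else 0)" for m
    have "X \<in> weakly_summable p UNIV sE"
      unfolding X_def[abs_def] by (rule ES.glued_weakly_summable[OF p IJ(1) x])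
    moreover have "Y \<in> weakly_summable p (dual sF) dual_scale"
      unfolding Y_def[abs_def] by (rule DS.glued_weakly_summable[OF p IJ(2) y])
    ultimately have "(\<Sum>m. \<Sum>n. ennreal (?n (Y n) (X m))) < \<infinity>"
      using T unfolding W_mid_def mid_summable_def by blast
    then obtain t where t: "t \<ge> 0" "(\<Sum>m. \<Sum>n. ennreal (?n (Y n) (X m))) = ennreal t"
      by (cases "(\<Sum>m. \<Sum>n. ennreal (?n (Y n) (X m)))" rule: ennreal_cases) (blast, simp only:
        infinity_ennreal_def less_irrefl)
    obtain k :: nat where k: "t < k" using reals_Archimedean2 by blast
    let ?e = "\<lambda>i. prod_encode (k, i)"
    have inj: "inj_on ?e Z" for Z by (auto simp: inj_on_def)
    have "real k \<le> (1/4 ^ k) powr p * (\<Sum>i\<in>I k. \<Sum>j\<in>J k. ?n (y k j) (x k i))"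
      using mult_left_mono[OF less_imp_le[OF big[of k]], of "(1/4 ^ k) powr p"] by (simp add: powr_divide)
    also have "\<dots> = (\<Sum>i\<in>I k. \<Sum>j\<in>J k. ?n (Y (?e j)) (X (?e i)))"
    proof -
      have q: "(1/2::real) ^ k * (1/2) ^ k = 1 / 4 ^ k"
        by (simp add: power_one_over power_mult_distrib[symmetric])
      have "?n (Y (?e j)) (X (?e i)) = (1/4 ^ k) powr p * ?n (y k j) (x k i)" if "i \<in> I k" "j \<in> J k" for i j
      proof -
        have "X (?e i) = (1/2) ^ k *\<^sub>R x k i" "Y (?e j) = (1/2) ^ k *\<^sub>R y k j"
          using that by (simp_all add: X_def Y_def)
        then have "blinfun_apply (Y (?e j)) (blinfun_apply T (X (?e i)))
            = ((1/2) ^ k * (1/2) ^ k) *\<^sub>R blinfun_apply (y k j) (blinfun_apply T (x k i))"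
          by (simp only: blinfun.scaleR_left blinfun.scaleR_right scaleR_scaleR)
        then have "norm (blinfun_apply (Y (?e j)) (blinfun_apply T (X (?e i))))
            = 1 / 4 ^ k * norm (blinfun_apply (y k j) (blinfun_apply T (x k i)))" unfolding q by simp
        then show ?thesis by (simp only: powr_mult norm_ge_zero)
      qed
      then show ?thesis by (simp add: sum_distrib_left)
    qed
    finally have "ennreal k \<le> ennreal (\<Sum>i\<in>I k. \<Sum>j\<in>J k. ?n (Y (?e j)) (X (?e i)))" by (rule ennreal_leI)
    also have "\<dots> = (\<Sum>i\<in>I k. \<Sum>j\<in>J k. ennreal (?n (Y (?e j)) (X (?e i))))"
      by (simp add: sum_nonneg)
    also have "\<dots> = (\<Sum>m\<in>?e ` I k. \<Sum>n\<in>?e ` J k. ennreal (?n (Y n) (X m)))"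
      by (simp add: sum.reindex[OF inj])
    also have "\<dots> \<le> (\<Sum>m\<in>?e ` I k. \<Sum>n. ennreal (?n (Y n) (X m)))"
      by (intro sum_mono sum_le_suminf) (use IJ in auto)
    also have "\<dots> \<le> (\<Sum>m. \<Sum>n. ennreal (?n (Y n) (X m)))"
      by (intro sum_le_suminf) (use IJ in auto)
    finally show False using k t by (simp add: ennreal_le_iff)
  qed
next
  assume "T \<in> operators sE sF \<and> (\<exists>C. mid_bounded p sE sF T C)"
  then obtain C where op: "T \<in> operators sE sF" and C: "mid_bounded p sE sF T C" by blast
  show "T \<in> W_mid p sE sF" unfolding W_mid_def mid_summable_def
  proof (intro CollectI conjI op ballI)
    fix x y assume x: "x \<in> weakly_summable p UNIV sE" and y: "y \<in> weakly_summable p (dual sF) dual_scale"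
    let ?n = "\<lambda>j n. norm (blinfun_apply (y n) (blinfun_apply T (x j))) powr p"
    obtain A where A: "A > 0" "\<And>N. wk_bounded p UNIV sE {..<N} x A"
      using ES.weakly_summable_imp_wk_bounded[OF x p] by blast
    obtain B where B: "B > 0" "\<And>N. wk_bounded p (dual sF) dual_scale {..<N} y B"
      using DS.weakly_summable_imp_wk_bounded[OF y p] by blast
    have fin: "(\<Sum>j<N. \<Sum>n<M. ?n j n) \<le> A * B * C" for N M
      by (rule mid_boundedD[OF C]) (use A B p in auto)
    have "(\<Sum>j. \<Sum>n. ennreal (?n j n)) \<le> ennreal (A * B * C)"
    proof (rule suminf_le_const)
      fix N
      have "(\<Sum>j<N. \<Sum>n. ennreal (?n j n)) = (\<Sum>n. \<Sum>j<N. ennreal (?n j n))"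
        by (rule suminf_sum[symmetric]) simp
      also have "\<dots> \<le> ennreal (A * B * C)"
      proof (rule suminf_le_const)
        fix M
        have "(\<Sum>n<M. \<Sum>j<N. ennreal (?n j n)) = ennreal (\<Sum>j<N. \<Sum>n<M. ?n j n)"
          by (subst sum.swap) (simp add: sum_nonneg)
        also have "\<dots> \<le> ennreal (A * B * C)" by (rule ennreal_leI[OF fin])
        finally show "(\<Sum>n<M. \<Sum>j<N. ennreal (?n j n)) \<le> ennreal (A * B * C)" .
      qed simp
      finally show "(\<Sum>j<N. \<Sum>n. ennreal (?n j n)) \<le> ennreal (A * B * C)" .
    qed simp
    also have "\<dots> < \<infinity>" by simp
    finally show "(\<Sum>j. \<Sum>n. ennreal (norm (blinfun_apply (y n) (blinfun_apply T (x j))) powr p)) < \<infinity>" .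
  qed
qed

end

section \<open>Inclusions between the operator classes\<close>

lemma (in banach_pair) mid_bounded_nonneg:
  assumes "mid_bounded p sE sF T C"
  shows "C \<ge> 0"
  using assms[unfolded mid_bounded_def, rule_format, of "{}" "{}"] by (simp add: wk_bounded_def)

text \<open>
  Hoelder's inequality, in the form of Young's inequality for each term, with the exponents \<open>q/p\<close>
  and \<open>q/(q - p)\<close>.
\<close>

lemma (in scaled_subspace) wk_bounded_multiplier:
  assumes p: "1 \<le> p" "p < q" and x: "wk_bounded q S s I x 1"
    and t: "\<And>i. i \<in> I \<Longrightarrow> t i \<ge> 0" "(\<Sum>i\<in>I. t i) \<le> 1"
  shows "wk_bounded p S s I (\<lambda>i. t i powr (1 / p - 1 / q) *\<^sub>R x i) 1"
  unfolding wk_bounded_def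
proof (intro conjI ballI)
  fix i assume "i \<in> I" then show "t i powr (1 / p - 1 / q) *\<^sub>R x i \<in> S"
    using x by (simp add: wk_bounded_def scaleR_mem)
next
  fix \<phi> assume \<phi>: "\<phi> \<in> dual_ball S s"
  define u where "u = q / p"
  define v where "v = q / (q - p)"
  have uv: "u > 1" "v > 1" "1 / u + 1 / v = 1"
    using p by (simp_all add: u_def v_def field_simps)
  have "(\<Sum>i\<in>I. norm (\<phi> (t i powr (1 / p - 1 / q) *\<^sub>R x i)) powr p)
    \<le> (\<Sum>i\<in>I. norm (\<phi> (x i)) powr q / u + t i / v)"
  proof (rule sum_mono)
    fix i assume i: "i \<in> I"
    then have xi: "x i \<in> S" using x by (simp add: wk_bounded_def)
    have "norm (\<phi> (t i powr (1 / p - 1 / q) *\<^sub>R x i)) powr p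
      = (t i powr (1 / p - 1 / q)) powr p * norm (\<phi> (x i)) powr p"
      by (simp add: dual_ball_scaleR[OF \<phi> xi] powr_mult)
    also have "(t i powr (1 / p - 1 / q)) powr p = t i powr (1 / v)"
    proof -
      have "(1 / p - 1 / q) * p = 1 / v" using p by (simp add: v_def left_diff_distrib diff_divide_distrib)
      then show ?thesis by (simp only: powr_powr)
    qed
    also have "t i powr (1 / v) * norm (\<phi> (x i)) powr p = norm (\<phi> (x i)) powr p * t i powr (1 / v)" by simp
    also have "\<dots> \<le> (norm (\<phi> (x i)) powr p) powr u / u + (t i powr (1 / v)) powr v / v"
      by (rule Youngs_inequality) (use uv in auto)
    also have "\<dots> = norm (\<phi> (x i)) powr q / u + t i / v"
      unfolding powr_powr using uv t(1)[OF i] p by (simp add: u_def)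
    finally show "norm (\<phi> (t i powr (1 / p - 1 / q) *\<^sub>R x i)) powr p \<le> norm (\<phi> (x i)) powr q / u + t i / v" .
  qed
  also have "\<dots> = (\<Sum>i\<in>I. norm (\<phi> (x i)) powr q) / u + (\<Sum>i\<in>I. t i) / v"
    by (simp add: sum.distrib sum_divide_distrib)
  also have "\<dots> \<le> 1 / u + 1 / v"
    using x \<phi> t uv by (intro add_mono divide_right_mono) (auto simp: wk_bounded_def)
  finally show "(\<Sum>i\<in>I. norm (\<phi> (t i powr (1 / p - 1 / q) *\<^sub>R x i)) powr p) \<le> 1" using uv by simp
qed

text \<open>
  The family \<open>Y\<close> consists of the combinations of \<open>y\<close> by which \<open>\<ell>\<^sub>q\<close> embeds into \<open>\<ell>\<^sub>p\<close>. For it and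
  for the multiples of \<open>x\<close> by \<open>t i ^ (1/p - 1/q)\<close>, where \<open>t\<close> is a probability vector, the hypothesis
  applies. The choice of \<open>t i\<close> proportional to \<open>S i\<close>, the \<open>q\<close>-th power sum of the values at
  \<open>T (x i)\<close>, is the optimal one.
\<close>

theorem (in banach_pair) mid_bounded_mono:
  assumes p: "1 \<le> p" "p < q" "q \<le> 2" and T: "mid_bounded p sE sF T C"
  shows "\<exists>C'. mid_bounded q sE sF T C'"
proof -
  obtain c1 c2 :: real where c: "c1 > 0" "c2 > 0"
    and emb: "\<And>J :: nat set. finite J \<Longrightarrow> \<exists>N (\<theta> :: nat \<Rightarrow> nat \<Rightarrow> real). \<forall>a :: nat \<Rightarrow> 'k.
       c1 * (\<Sum>j\<in>J. norm (a j) powr q) powr (p / q) \<le> (\<Sum>i<N. norm (\<Sum>j\<in>J. \<theta> i j *\<^sub>R a j) powr p) \<and>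
       (\<Sum>i<N. norm (\<Sum>j\<in>J. \<theta> i j *\<^sub>R a j) powr p) \<le> c2 * (\<Sum>j\<in>J. norm (a j) powr q) powr (p / q)"
    by (rule lq_embeds_into_lp[OF p]) blast
  have C: "C \<ge> 0" by (rule mid_bounded_nonneg[OF T])
  have "mid_bounded q sE sF T ((c2 * C / c1) powr (q / p))" unfolding mid_bounded_def
  proof (intro allI impI, elim conjE)
    fix I J :: "nat set" and x :: "nat \<Rightarrow> 'e" and y :: "nat \<Rightarrow> 'f \<Rightarrow>\<^sub>L 'k"
    assume I: "finite I" and J: "finite J" and x: "wk_bounded q UNIV sE I x 1"
      and y: "wk_bounded q (dual sF) dual_scale J y 1"
    obtain N and \<theta> :: "nat \<Rightarrow> nat \<Rightarrow> real" where both: "\<forall>a :: nat \<Rightarrow> 'k.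
       c1 * (\<Sum>j\<in>J. norm (a j) powr q) powr (p / q) \<le> (\<Sum>i<N. norm (\<Sum>j\<in>J. \<theta> i j *\<^sub>R a j) powr p) \<and>
       (\<Sum>i<N. norm (\<Sum>j\<in>J. \<theta> i j *\<^sub>R a j) powr p) \<le> c2 * (\<Sum>j\<in>J. norm (a j) powr q) powr (p / q)"
      using emb[OF J] by (elim exE)
    have lo: "c1 * (\<Sum>j\<in>J. norm (a j) powr q) powr (p / q) \<le> (\<Sum>i<N. norm (\<Sum>j\<in>J. \<theta> i j *\<^sub>R a j) powr p)"
      and hi: "(\<Sum>i<N. norm (\<Sum>j\<in>J. \<theta> i j *\<^sub>R a j) powr p) \<le> c2 * (\<Sum>j\<in>J. norm (a j) powr q) powr (p / q)"
      for a :: "nat \<Rightarrow> 'k" by (rule conjunct1[OF spec[OF both]], rule conjunct2[OF spec[OF both]])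
    define Y where "Y n = (\<Sum>j\<in>J. \<theta> n j *\<^sub>R y j)" for n
    have yS: "y j \<in> dual sF" if "j \<in> J" for j using y that by (simp add: wk_bounded_def)
    have Y: "wk_bounded p (dual sF) dual_scale {..<N} Y c2" unfolding wk_bounded_def
    proof (intro conjI ballI)
      show "Y n \<in> dual sF" for n unfolding Y_def
        by (intro DS.subspace_sum[OF DS.S] DS.scaleR_mem yS)
      fix \<phi> assume \<phi>: "\<phi> \<in> dual_ball (dual sF) dual_scale"
      have "\<phi> (Y n) = (\<Sum>j\<in>J. \<theta> n j *\<^sub>R \<phi> (y j))" for n
        unfolding Y_def by (simp add: DS.dual_ball_sum[OF \<phi>] DS.dual_ball_scaleR[OF \<phi>] yS DS.scaleR_mem)
      then have "(\<Sum>n<N. norm (\<phi> (Y n)) powr p) \<le> c2 * (\<Sum>j\<in>J. norm (\<phi> (y j)) powr q) powr (p / q)"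
        using hi[of "\<lambda>j. \<phi> (y j)"] by simp
      also have "\<dots> \<le> c2 * 1"
      proof (rule mult_left_mono)
        have "0 \<le> (\<Sum>j\<in>J. norm (\<phi> (y j)) powr q)" by (intro sum_nonneg) auto
        moreover have "(\<Sum>j\<in>J. norm (\<phi> (y j)) powr q) \<le> 1" using y \<phi> by (simp add: wk_bounded_def)
        ultimately show "(\<Sum>j\<in>J. norm (\<phi> (y j)) powr q) powr (p / q) \<le> 1"
          using p by (intro powr_le1) auto
      qed (use c in simp)
      finally show "(\<Sum>n<N. norm (\<phi> (Y n)) powr p) \<le> c2" by simp
    qed
    define S where "S i = (\<Sum>j\<in>J. norm (blinfun_apply (y j) (blinfun_apply T (x i))) powr q)" for i
    define \<Sigma> where "\<Sigma> = (\<Sum>i\<in>I. S i)"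
    have S: "S i \<ge> 0" for i unfolding S_def by (intro sum_nonneg) auto
    show "(\<Sum>i\<in>I. \<Sum>j\<in>J. norm (blinfun_apply (y j) (blinfun_apply T (x i))) powr q)
      \<le> (c2 * C / c1) powr (q / p)"
    proof (cases "\<Sigma> = 0")
      case True
      then show ?thesis by (simp add: \<Sigma>_def S_def)
    next
      case False
      then have \<Sigma>: "\<Sigma> > 0" by (simp add: \<Sigma>_def order_less_le S sum_nonneg)
      define d where "d = 1 / p - 1 / q"
      define t where "t i = S i / \<Sigma>" for i
      have t: "t i \<ge> 0" for i using S \<Sigma> by (simp add: t_def)
      have "(\<Sum>i\<in>I. t i) = \<Sigma> / \<Sigma>" by (simp only: t_def \<Sigma>_def sum_divide_distrib)
      then have t1: "(\<Sum>i\<in>I. t i) \<le> 1" using \<Sigma> by simp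
      have z: "wk_bounded p UNIV sE I (\<lambda>i. t i powr d *\<^sub>R x i) 1"
        unfolding d_def by (rule ES.wk_bounded_multiplier[OF p(1,2) x t t1])
      have below: "c1 * (S i / \<Sigma> powr (p * d))
          \<le> (\<Sum>n<N. norm (blinfun_apply (Y n) (blinfun_apply T (t i powr d *\<^sub>R x i))) powr p)" for i
      proof -
        have "blinfun_apply (Y n) (blinfun_apply T (t i powr d *\<^sub>R x i))
            = t i powr d *\<^sub>R (\<Sum>j\<in>J. \<theta> n j *\<^sub>R blinfun_apply (y j) (blinfun_apply T (x i)))" for n
          by (simp add: Y_def blinfun.sum_left blinfun.scaleR_left blinfun.scaleR_right)
        then have "(\<Sum>n<N. norm (blinfun_apply (Y n) (blinfun_apply T (t i powr d *\<^sub>R x i))) powr p)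
            = (t i powr d) powr p * (\<Sum>n<N. norm (\<Sum>j\<in>J. \<theta> n j *\<^sub>R blinfun_apply (y j) (blinfun_apply T (x
              i))) powr p)"
          by (simp add: powr_mult sum_distrib_left)
        moreover have "(t i powr d) powr p * (c1 * S i powr (p / q))
            \<le> (t i powr d) powr p * (\<Sum>n<N. norm (\<Sum>j\<in>J. \<theta> n j *\<^sub>R blinfun_apply (y j) (blinfun_apply T (x
              i))) powr p)"
          unfolding S_def by (intro mult_left_mono lo) simp
        moreover have "(t i powr d) powr p * (c1 * S i powr (p / q)) = c1 * (S i / \<Sigma> powr (p * d))"
        proof (cases "S i = 0")
          case False
          then have Si: "S i > 0" using S[of i] by simp
          have e: "p * d + p / q = 1" using p by (simp add: d_def field_simps)
          have "(t i powr d) powr p = S i powr (p * d) / \<Sigma> powr (p * d)"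
            using \<Sigma> Si by (simp add: t_def powr_divide powr_powr mult.commute)
          moreover have "S i powr (p * d) * S i powr (p / q) = S i"
            unfolding powr_add[symmetric] e using Si by simp
          ultimately show ?thesis by (simp add: mult.left_commute)
        qed simp
        ultimately show ?thesis by simp
      qed
      have "c1 * (\<Sigma> / \<Sigma> powr (p * d)) = (\<Sum>i\<in>I. c1 * (S i / \<Sigma> powr (p * d)))"
        by (simp add: \<Sigma>_def sum_distrib_left sum_divide_distrib)
      also have "\<dots> \<le> (\<Sum>i\<in>I. \<Sum>n<N. norm (blinfun_apply (Y n) (blinfun_apply T (t i powr d *\<^sub>R x i))) powr p)"
        by (rule sum_mono) (rule below)
      also have "\<dots> \<le> 1 * c2 * C"
        by (rule mid_boundedD[OF T I _ p(1) z _ Y]) (use c in auto)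
      finally have "\<Sigma> / \<Sigma> powr (p * d) \<le> c2 * C / c1" using c by (simp add: field_simps)
      moreover have "\<Sigma> / \<Sigma> powr (p * d) = \<Sigma> powr (p / q)"
      proof -
        have e: "p / q = 1 - p * d" using p by (simp add: d_def field_simps)
        show ?thesis unfolding e powr_diff using \<Sigma> by simp
      qed
      ultimately have "(\<Sigma> powr (p / q)) powr (q / p) \<le> (c2 * C / c1) powr (q / p)"
        using p by (intro powr_mono2) auto
      then show ?thesis using \<Sigma> p by (simp add: powr_powr \<Sigma>_def S_def)
    qed
  qed
  then show ?thesis by blast
qed

definition norming :: "'a set \<Rightarrow> ('k::real_or_complex \<Rightarrow> 'a::real_normed_vector \<Rightarrow> 'a) \<Rightarrow> bool" where
  "norming S s \<longleftrightarrow> (\<forall>z\<in>S. \<forall>c. (\<forall>\<phi>\<in>dual_ball S s. norm (\<phi> z) \<le> c) \<longrightarrow> norm z \<le> c)"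

lemma norming_UNIV:
  fixes s :: "'k::real_or_complex \<Rightarrow> 'a::real_normed_vector \<Rightarrow> 'a"
  assumes "normed_space_over s"
  shows "norming UNIV s"
  unfolding norming_def
proof (intro ballI allI impI)
  fix z :: 'a and c :: real assume c: "\<forall>\<phi>\<in>dual_ball UNIV s. norm (\<phi> z) \<le> c"
  obtain \<phi> where "\<phi> \<in> dual_ball UNIV s" "\<phi> z = of_real (norm z)" by (rule norming_functional[OF assms])
  then show "norm z \<le> c" using c by fastforce
qed

lemma evaluation_in_dual_ball:
  fixes sF :: "'k::real_or_complex \<Rightarrow> 'f::real_normed_vector \<Rightarrow> 'f"
  assumes "norm x \<le> 1"
  shows "(\<lambda>f. blinfun_apply f x) \<in> dual_ball (dual sF) dual_scale"
  unfolding dual_ball_def linear_map_on_def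
proof (intro CollectI conjI ballI allI)
  fix f :: "'f \<Rightarrow>\<^sub>L 'k"
  have "norm (blinfun_apply f x) \<le> norm f * norm x" by (rule norm_blinfun)
  also have "\<dots> \<le> norm f * 1" using assms by (intro mult_left_mono) auto
  finally show "norm (blinfun_apply f x) \<le> norm f" by simp
qed (simp_all add: blinfun.add_left)

lemma norming_dual:
  fixes sF :: "'k::real_or_complex \<Rightarrow> 'f::real_normed_vector \<Rightarrow> 'f"
  shows "norming (dual sF) dual_scale"
  unfolding norming_def
proof (intro ballI allI impI)
  fix f :: "'f \<Rightarrow>\<^sub>L 'k" and c assume c: "\<forall>\<phi>\<in>dual_ball (dual sF) dual_scale. norm (\<phi> f) \<le> c"
  have c0: "c \<ge> 0" using c evaluation_in_dual_ball[of 0 sF] by fastforce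
  show "norm f \<le> c"
  proof (rule norm_blinfun_bound[OF c0])
    fix x
    show "norm (blinfun_apply f x) \<le> c * norm x"
    proof (cases "x = 0")
      case False
      then have "norm ((1 / norm x) *\<^sub>R x) \<le> 1" by simp
      from c[rule_format, OF evaluation_in_dual_ball[OF this]]
      have "norm (blinfun_apply f x) / norm x \<le> c" by (simp add: blinfun.scaleR_right)
      then show ?thesis using False by (simp add: field_simps)
    qed simp
  qed
qed

lemma (in scaled_subspace) lin_comb_le_weak1:
  assumes norming: "norming S s" and x: "wk_bounded 1 S s I x 1" and f: "\<And>i. i \<in> I \<Longrightarrow> norm (f i) \<le> 1"
  shows "norm (lin_comb s I x f) \<le> 1"
proof -
  have xS: "x i \<in> S" if "i \<in> I" for i using x that by (simp add: wk_bounded_def)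
  have "lin_comb s I x f \<in> S"
    unfolding lin_comb_def by (intro subspace_sum[OF S] subspace_scale[OF S] xS)
  moreover have "norm (\<phi> (lin_comb s I x f)) \<le> 1" if \<phi>: "\<phi> \<in> dual_ball S s" for \<phi>
  proof -
    have "\<phi> (lin_comb s I x f) = (\<Sum>i\<in>I. f i * \<phi> (x i))"
      unfolding lin_comb_def by (simp add: dual_ball_sum[OF \<phi>] dual_ball_scale[OF \<phi>] subspace_scale[OF S] xS)
    then have "norm (\<phi> (lin_comb s I x f)) \<le> (\<Sum>i\<in>I. norm (f i * \<phi> (x i)))" by (simp add: norm_sum)
    also have "\<dots> \<le> (\<Sum>i\<in>I. norm (\<phi> (x i)) powr 1)"
      using f by (intro sum_mono) (simp add: norm_mult mult_left_le_one_le)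
    also have "\<dots> \<le> 1" using x \<phi> by (simp add: wk_bounded_def)
    finally show ?thesis .
  qed
  ultimately show ?thesis using norming by (simp add: norming_def)
qed

text \<open>
  A weakly 1-summable family is an operator from \<open>\<ell>\<^sub>\<infinity>\<close>. If it is bounded by the norm of \<open>L\<^sub>r(\<nu>)\<close>,
  then division of its members by \<open>\<nu> i ^ (1/r)\<close> gives an operator from \<open>\<ell>\<^sub>r\<close>, which is a weakly
  \<open>q\<close>-summable family for the conjugate exponent \<open>q\<close>.
\<close>

lemma (in scaled_subspace) weak1_factorization:
  assumes norming: "norming S s" and K: "K > 0" "orlicz S K" and q: "1 < q" "q < 2"
  obtains C where "C > 0"
    "\<And>(I :: nat set) x. finite I \<Longrightarrow> wk_bounded 1 S s I x 1 \<Longrightarrow>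
      \<exists>\<nu> z. (\<forall>i\<in>I. \<nu> i > 0 \<and> x i = \<nu> i powr (1 - 1 / q) *\<^sub>R z i) \<and> (\<Sum>i\<in>I. \<nu> i) \<le> 1
        \<and> wk_bounded q S s I z (C powr q)"
proof -
  define r where "r = q / (q - 1)"
  have r: "r > 2" "1 / r = 1 - 1 / q" "(q - 1) * r = q" using q by (simp_all add: r_def field_simps)
  obtain C where C: "C > 0" and dom: "lr_dominated s S r C"
    by (rule orlicz_imp_lr_dominated[OF normed_space_over_axioms S K r(1)])
  show thesis
  proof (rule that[OF C])
    fix I :: "nat set" and x
    assume I: "finite I" and x: "wk_bounded 1 S s I x 1"
    have xS: "x i \<in> S" if "i \<in> I" for i using x that by (simp add: wk_bounded_def)
    obtain \<nu> where \<nu>: "\<And>i. \<nu> i > 0" "(\<Sum>i\<in>I. \<nu> i) \<le> 1"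
      and le': "\<And>f. norm (lin_comb s I x f) \<le> C * 1 * (\<Sum>i\<in>I. \<nu> i * norm (f i) powr r) powr (1 / r)"
      by (rule lr_dominatedE[OF dom I xS zero_less_one lin_comb_le_weak1[OF norming x]]) blast+
    note le = le'[unfolded mult_1_right]
    define m where "m i = \<nu> i powr (1 / r)" for i
    have m: "m i > 0" "m i powr r = \<nu> i" for i using \<nu>(1)[of i] r(1) by (simp_all add: m_def powr_powr)
    define z where "z i = (1 / m i) *\<^sub>R x i" for i
    have xz: "x i = m i *\<^sub>R z i" for i using m(1)[of i] by (simp add: z_def)
    have "wk_bounded q S s I z (C powr q)" unfolding wk_bounded_def
    proof (intro conjI ballI)
      show "z i \<in> S" if "i \<in> I" for i using xS[OF that] by (simp add: z_def scaleR_mem)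
      fix \<phi> assume \<phi>: "\<phi> \<in> dual_ball S s"
      define t where "t i = norm (\<phi> (z i))" for i
      \<comment> \<open>The coefficients for which equality holds in Hoelder's inequality.\<close>
      define h :: "nat \<Rightarrow> 'k" where "h i = of_real (t i powr q) / \<phi> (z i)" for i
      have nh: "norm (h i) = t i powr (q - 1)" for i
        by (cases "\<phi> (z i) = 0") (auto simp: h_def t_def norm_divide powr_diff)
      have hz: "h i * \<phi> (z i) = of_real (t i powr q)" for i
        by (cases "\<phi> (z i) = 0") (auto simp: h_def t_def)
      define f where "f i = of_real (1 / m i) * h i" for i
      define \<Sigma> where "\<Sigma> = (\<Sum>i\<in>I. t i powr q)"
      have \<Sigma>0: "\<Sigma> \<ge> 0" unfolding \<Sigma>_def by (intro sum_nonneg) auto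
      have "\<phi> (lin_comb s I x f) = (\<Sum>i\<in>I. f i * \<phi> (x i))"
        unfolding lin_comb_def by (simp add: dual_ball_sum[OF \<phi>] dual_ball_scale[OF \<phi>] subspace_scale[OF
          S] xS)
      also have "\<dots> = (\<Sum>i\<in>I. of_real (t i powr q))"
      proof (rule sum.cong)
        fix i assume "i \<in> I"
        then have "\<phi> (z i) = of_real (1 / m i) * \<phi> (x i)"
          unfolding z_def by (simp add: dual_ball_scaleR[OF \<phi>] xS scaleR_conv_of_real)
        then have "f i * \<phi> (x i) = h i * \<phi> (z i)" by (simp add: f_def)
        then show "f i * \<phi> (x i) = of_real (t i powr q)" by (simp add: hz)
      qed simp
      finally have "\<phi> (lin_comb s I x f) = of_real \<Sigma>" by (simp add: \<Sigma>_def)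
      then have "\<Sigma> = norm (\<phi> (lin_comb s I x f))" using \<Sigma>0 by simp
      also have "\<dots> \<le> norm (lin_comb s I x f)"
        by (rule dual_ball_le[OF \<phi>]) (auto simp: lin_comb_def intro!: subspace_sum[OF S]
          subspace_scale[OF S] xS)
      also have "\<dots> \<le> C * (\<Sum>i\<in>I. \<nu> i * norm (f i) powr r) powr (1/r)" by (rule le)
      also have "(\<Sum>i\<in>I. \<nu> i * norm (f i) powr r) = \<Sigma>" unfolding \<Sigma>_def
      proof (rule sum.cong)
        fix i
        have "norm (f i) = t i powr (q - 1) / m i"
          using m(1)[of i] by (simp add: f_def norm_divide norm_mult nh)
        then have "norm (f i) powr r = (t i powr (q - 1)) powr r / \<nu> i"
          using m[of i] by (simp add: powr_divide)
        also have "(t i powr (q - 1)) powr r = t i powr q" by (simp only: powr_powr r(3))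
        finally show "\<nu> i * norm (f i) powr r = t i powr q" using \<nu>(1)[of i] by simp
      qed simp
      finally have le\<Sigma>: "\<Sigma> \<le> C * \<Sigma> powr (1 / r)" .
      show "(\<Sum>i\<in>I. norm (\<phi> (z i)) powr q) \<le> C powr q"
      proof (cases "\<Sigma> = 0")
        case True
        then show ?thesis by (simp add: \<Sigma>_def t_def)
      next
        case False
        then have \<Sigma>: "\<Sigma> > 0" using \<Sigma>0 by simp
        have "\<Sigma> = \<Sigma> powr (1 / q) * \<Sigma> powr (1 / r)" unfolding powr_add[symmetric] r(2) using \<Sigma> by simp
        then have "\<Sigma> powr (1 / q) \<le> C" using le\<Sigma> \<Sigma>
          by (metis mult_le_cancel_right_pos powr_gt_zero less_irrefl)
        then have "(\<Sigma> powr (1 / q)) powr q \<le> C powr q" using q by (intro powr_mono2) auto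
        then show ?thesis using \<Sigma> q by (simp add: powr_powr \<Sigma>_def t_def)
      qed
    qed
    then show "\<exists>\<nu> z. (\<forall>i\<in>I. \<nu> i > 0 \<and> x i = \<nu> i powr (1 - 1 / q) *\<^sub>R z i) \<and> (\<Sum>i\<in>I. \<nu> i) \<le> 1
      \<and> wk_bounded q S s I z (C powr q)"
      using \<nu> xz unfolding m_def r(2) by blast
  qed
qed

theorem (in banach_pair) mid_bounded_1_of_orlicz:
  assumes KE: "KE > 0" "orlicz (UNIV :: 'e set) KE" and KF: "KF > 0" "orlicz (dual sF) KF"
    and q: "1 < q" "q < 2" and T: "mid_bounded q sE sF T C"
  shows "\<exists>C'. mid_bounded 1 sE sF T C'"
proof -
  obtain CE where CE: "CE > 0" "\<And>(I :: nat set) x. finite I \<Longrightarrow> wk_bounded 1 UNIV sE I x 1 \<Longrightarrow>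
      \<exists>\<nu> z. (\<forall>i\<in>I. \<nu> i > 0 \<and> x i = \<nu> i powr (1 - 1 / q) *\<^sub>R z i) \<and> (\<Sum>i\<in>I. \<nu> i) \<le> 1
        \<and> wk_bounded q UNIV sE I z (CE powr q)"
    by (rule ES.weak1_factorization[OF norming_UNIV[OF E.normed_space_over_axioms] KE q]) blast
  obtain CF where CF: "CF > 0" "\<And>(I :: nat set) x. finite I \<Longrightarrow> wk_bounded 1 (dual sF) dual_scale I x 1 \<Longrightarrow>
      \<exists>\<nu> z. (\<forall>i\<in>I. \<nu> i > 0 \<and> x i = \<nu> i powr (1 - 1 / q) *\<^sub>R z i) \<and> (\<Sum>i\<in>I. \<nu> i) \<le> 1
        \<and> wk_bounded q (dual sF) dual_scale I z (CF powr q)"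
    by (rule DS.weak1_factorization[OF norming_dual KF q]) blast
  define d where "d = 1 - 1 / q"
  have d: "1 / d > 1" "d > 0" "1 / (1 / d) + 1 / q = 1" using q by (simp_all add: d_def field_simps)
  have "mid_bounded 1 sE sF T (d + CE powr q * CF powr q * C / q)" unfolding mid_bounded_def
  proof (intro allI impI, elim conjE)
    fix I J :: "nat set" and x :: "nat \<Rightarrow> 'e" and y :: "nat \<Rightarrow> 'f \<Rightarrow>\<^sub>L 'k"
    assume I: "finite I" and J: "finite J" and x: "wk_bounded 1 UNIV sE I x 1"
      and y: "wk_bounded 1 (dual sF) dual_scale J y 1"
    obtain \<nu> z where \<nu>: "\<And>i. i \<in> I \<Longrightarrow> \<nu> i > 0" "(\<Sum>i\<in>I. \<nu> i) \<le> 1"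
      and xz: "\<And>i. i \<in> I \<Longrightarrow> x i = \<nu> i powr d *\<^sub>R z i" and z: "wk_bounded q UNIV sE I z (CE powr q)"
      using CE(2)[OF I x] unfolding d_def by blast
    obtain \<mu> w where \<mu>: "\<And>j. j \<in> J \<Longrightarrow> \<mu> j > 0" "(\<Sum>j\<in>J. \<mu> j) \<le> 1"
      and yw: "\<And>j. j \<in> J \<Longrightarrow> y j = \<mu> j powr d *\<^sub>R w j"
        and w: "wk_bounded q (dual sF) dual_scale J w (CF powr q)"
      using CF(2)[OF J y] unfolding d_def by blast
    let ?n = "\<lambda>i j. norm (blinfun_apply (w j) (blinfun_apply T (z i)))"
    have "(\<Sum>i\<in>I. \<Sum>j\<in>J. norm (blinfun_apply (y j) (blinfun_apply T (x i))) powr 1)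
        \<le> (\<Sum>i\<in>I. \<Sum>j\<in>J. d * (\<nu> i * \<mu> j) + ?n i j powr q / q)"
    proof (intro sum_mono)
      fix i j assume ij: "i \<in> I" "j \<in> J"
      have "norm (blinfun_apply (y j) (blinfun_apply T (x i))) powr 1 = (\<nu> i * \<mu> j) powr d * ?n i j"
        using ij by (simp add: xz yw blinfun.scaleR_left blinfun.scaleR_right powr_mult)
      also have "\<dots> \<le> ((\<nu> i * \<mu> j) powr d) powr (1 / d) / (1 / d) + ?n i j powr q / q"
        by (rule Youngs_inequality) (use d q in auto)
      also have "((\<nu> i * \<mu> j) powr d) powr (1 / d) / (1 / d) = d * (\<nu> i * \<mu> j)"
        using d \<nu>(1)[OF ij(1)] \<mu>(1)[OF ij(2)] by (simp add: powr_powr)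
      finally show "norm (blinfun_apply (y j) (blinfun_apply T (x i))) powr 1
        \<le> d * (\<nu> i * \<mu> j) + ?n i j powr q / q" .
    qed
    also have "\<dots> = d * ((\<Sum>i\<in>I. \<nu> i) * (\<Sum>j\<in>J. \<mu> j)) + (\<Sum>i\<in>I. \<Sum>j\<in>J. ?n i j powr q) / q"
    proof -
      have "(\<Sum>i\<in>I. \<Sum>j\<in>J. d * (\<nu> i * \<mu> j)) = d * ((\<Sum>i\<in>I. \<nu> i) * (\<Sum>j\<in>J. \<mu> j))"
        by (simp only: sum_product) (simp only: sum_distrib_left)
      then show ?thesis by (simp only: sum.distrib sum_divide_distrib)
    qed
    also have "\<dots> \<le> d * (1 * 1) + (CE powr q * CF powr q * C) / q"
    proof (intro add_mono mult_left_mono mult_mono divide_right_mono \<nu>(2) \<mu>(2))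
      show "0 \<le> (\<Sum>j\<in>J. \<mu> j)" using \<mu>(1) by (intro sum_nonneg) (auto simp: less_imp_le)
      show "(\<Sum>i\<in>I. \<Sum>j\<in>J. ?n i j powr q) \<le> CE powr q * CF powr q * C"
        by (rule mid_boundedD[OF T I J _ z _ w]) (use q CE CF in auto)
    qed (use d q in auto)
    finally show "(\<Sum>i\<in>I. \<Sum>j\<in>J. norm (blinfun_apply (y j) (blinfun_apply T (x i))) powr 1)
      \<le> d + CE powr q * CF powr q * C / q"
      by simp
  qed
  then show ?thesis by blast
qed

section \<open>Operators on \<open>\<L>\<^sub>\<infinity>\<close>-spaces\<close>

lemma linear_map_on_0:
  assumes "normed_space_over s" "normed_space_over t" "linear_map_on S s t u" "0 \<in> S"
  shows "u 0 = 0"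
proof -
  interpret s: normed_space_over s by fact
  interpret t: normed_space_over t by fact
  have "u (s 0 0) = t 0 (u 0)" using assms(3,4) unfolding linear_map_on_def by blast
  then show ?thesis by simp
qed

lemma op_norm_on_bound:
  assumes s: "normed_space_over s" and t: "normed_space_over t" and G: "module.subspace s G"
    and u: "linear_map_on G s t u" and bd: "bounded_on G u"
  shows "0 \<le> op_norm_on G u" "z \<in> G \<Longrightarrow> norm (u z) \<le> op_norm_on G u * norm z"
proof -
  interpret s: normed_space_over s by fact
  interpret t: normed_space_over t by fact
  obtain C where C: "\<And>x. x \<in> G \<Longrightarrow> norm (u x) \<le> C * norm x" using bd unfolding bounded_on_def by blast
  have bdd: "bdd_above ((\<lambda>x. norm (u x)) ` {x \<in> G. norm x \<le> 1})"
  proof (rule bdd_aboveI2)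
    fix x assume "x \<in> {x \<in> G. norm x \<le> 1}"
    then have "norm (u x) \<le> C * norm x" "norm x \<le> 1" using C by auto
    then show "norm (u x) \<le> \<bar>C\<bar>"
      by (smt (verit) mult_left_le mult_right_mono norm_ge_zero abs_ge_self abs_ge_zero)
  qed
  have upper: "norm (u x) \<le> op_norm_on G u" if "x \<in> G" "norm x \<le> 1" for x
    unfolding op_norm_on_def by (rule cSUP_upper[OF _ bdd]) (use that in simp)
  have u0: "u 0 = 0" by (rule linear_map_on_0[OF s t u s.subspace_0[OF G]])
  show "0 \<le> op_norm_on G u" using upper[OF s.subspace_0[OF G]] u0 by simp
  show "norm (u z) \<le> op_norm_on G u * norm z" if z: "z \<in> G"
  proof (cases "z = 0")
    case True
    then show ?thesis using u0 by simp
  next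
    case False
    let ?c = "of_real (1 / norm z)"
    have "u (s ?c z) = t ?c (u z)" using u z unfolding linear_map_on_def by blast
    moreover have "norm (u (s ?c z)) \<le> op_norm_on G u"
      using False by (intro upper s.subspace_scale[OF G z]) (simp add: s.norm_scale norm_divide)
    ultimately show ?thesis using False by (simp add: t.norm_scale norm_divide field_simps)
  qed
qed

lift_definition c0_unit :: "nat \<Rightarrow> 'k::real_or_complex c0" is "\<lambda>k m. if m = k then 1 else 0"
proof -
  fix k :: nat
  have "\<forall>\<^sub>F m in sequentially. (if m = k then 1 else 0) = (0 :: 'k)"
    using eventually_gt_at_top[of k] by eventually_elim auto
  then show "(\<lambda>m. if m = k then 1 else 0) \<longlonglongrightarrow> (0 :: 'k)" by (rule tendsto_eventually)
qed

lemma c0_nth_add: "c0_nth (x + y) n = c0_nth x n + c0_nth y n"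
  by transfer simp

lemma c0_nth_0: "c0_nth 0 n = 0"
  by transfer simp

lemma c0_nth_scale: "c0_nth (c0_scale c x) n = c * c0_nth x n"
  by transfer simp

lemma c0_nth_sum: "c0_nth (\<Sum>i\<in>I. x i) n = (\<Sum>i\<in>I. c0_nth (x i) n)"
  by (induction I rule: infinite_finite_induct) (auto simp: c0_nth_0 c0_nth_add)

lemma c0_eqI: "(\<And>n. c0_nth x n = c0_nth y n) \<Longrightarrow> x = y"
  by (metis c0_nth_inject ext)

lemma c0_nth_unit_sum: "c0_nth (\<Sum>k<n. c0_scale (f k) (c0_unit k)) m = (if m < n then f m else 0)"
proof -
  have "c0_nth (\<Sum>k<n. c0_scale (f k) (c0_unit k)) m = (\<Sum>k<n. if m = k then f k else 0)"
    unfolding c0_nth_sum c0_nth_scale c0_unit.rep_eq by (rule sum.cong) auto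
  then show ?thesis by simp
qed

lemma norm_c0_le:
  assumes "\<And>n. norm (c0_nth x n) \<le> B"
  shows "norm x \<le> B"
  unfolding norm_c0.rep_eq by (rule cSUP_least) (use assms in auto)

text \<open>
  A factorization of the identity of \<open>G\<close> through \<open>\<ell>\<^sub>\<infinity>\<^sup>n\<close>, given by the coordinate functions \<open>c\<close> and
  the images \<open>e k\<close> of the unit vectors; \<open>a\<close> and \<open>b\<close> bound the norms of the two factors.
\<close>

definition coordinates ::
  "('k::real_or_complex \<Rightarrow> 'a::real_normed_vector \<Rightarrow> 'a) \<Rightarrow> 'a set \<Rightarrow> nat \<Rightarrow> (nat \<Rightarrow> 'a) \<Rightarrow> ('a \<Rightarrow> nat \<Rightarrow> 'k)
    \<Rightarrow> real \<Rightarrow> real \<Rightarrow> bool" where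
  "coordinates s G n e c a b \<longleftrightarrow> module.subspace s G \<and> (\<forall>k<n. e k \<in> G) \<and>
     (\<forall>z\<in>G. \<forall>w\<in>G. \<forall>k. c (z + w) k = c z k + c w k) \<and> (\<forall>z\<in>G. \<forall>\<alpha> k. c (s \<alpha> z) k = \<alpha> * c z k) \<and>
     (\<forall>z\<in>G. \<forall>k. norm (c z k) \<le> a * norm z) \<and> (\<forall>z\<in>G. z = lin_comb s {..<n} e (c z)) \<and>
     (\<forall>f. (\<forall>k<n. norm (f k) \<le> 1) \<longrightarrow> norm (lin_comb s {..<n} e f) \<le> b)"

lemma L_infinity_coordinates:
  fixes s :: "'k::real_or_complex \<Rightarrow> 'a::real_normed_vector \<Rightarrow> 'a"
  assumes s: "normed_space_over s" and S: "module.subspace s S" and L: "L_infinity_space S s"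
  obtains l where "l > 0"
    "\<And>X. finite X \<Longrightarrow> X \<subseteq> S \<Longrightarrow> \<exists>G n e c a b. X \<subseteq> G \<and> G \<subseteq> S \<and> a > 0 \<and> b \<ge> 0 \<and> a * b \<le> l
      \<and> coordinates s G n e c a b"
proof -
  interpret s: normed_space_over s by fact
  note C0 = normed_space_over_c0[where ?'a = 'k]
  interpret C0: normed_space_over "c0_scale :: 'k \<Rightarrow> 'k c0 \<Rightarrow> 'k c0" by (rule C0)
  obtain l where l: "l \<ge> 1" and ext: "\<And>V. finite_dim_subspace s V \<Longrightarrow> V \<subseteq> S \<Longrightarrow>
        \<exists>G. finite_dim_subspace s G \<and> V \<subseteq> G \<and> G \<subseteq> S \<and>
           banach_mazur s G c0_scale (linf (vector_space.dim s G)) \<le> ennreal l"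
    using L unfolding L_infinity_space_def by blast
  show thesis
  proof (rule that[of "l + 2"])
    show "l + 2 > 0" using l by simp
    fix X assume X: "finite X" "X \<subseteq> S"
    have "finite_dim_subspace s (s.span X)" using X unfolding finite_dim_subspace_def by blast
    moreover have "s.span X \<subseteq> S" by (rule s.span_minimal[OF X(2) S])
    ultimately obtain G where G: "finite_dim_subspace s G" "s.span X \<subseteq> G" "G \<subseteq> S"
      and bm: "banach_mazur s G c0_scale (linf (vector_space.dim s G)) \<le> ennreal l" using ext by blast
    define n where "n = vector_space.dim s G"
    have XG: "X \<subseteq> G" using G(2) s.span_superset by blast
    have subG: "s.subspace G" using G(1) unfolding finite_dim_subspace_def by blast
    have "ennreal l < ennreal (l + 1)" using l by (simp add: ennreal_less_iff)
    from le_less_trans[OF bm this] have "banach_mazur s G c0_scale (linf n) < ennreal (l + 1)"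
      unfolding n_def .
    then obtain u where u: "linear_map_on G s c0_scale u" "bij_betw u G (linf n)" "bounded_on G u"
      "bounded_on (linf n) (inv_into G u)"
        and small: "ennreal (op_norm_on G u * op_norm_on (linf n) (inv_into G u)) < ennreal (l + 1)"
      unfolding banach_mazur_def INF_less_iff by blast
    define v where "v = inv_into G u"
    have uv: "u (v y) = y" if "y \<in> linf n" for y
      unfolding v_def by (rule bij_betw_inv_into_right[OF u(2) that])
    have vu: "v (u z) = z" if "z \<in> G" for z
      unfolding v_def by (rule bij_betw_inv_into_left[OF u(2) that])
    have vG: "v y \<in> G" if "y \<in> linf n" for y
      using bij_betw_inv_into[OF u(2)] that unfolding v_def by (rule bij_betw_apply)
    have uL: "u z \<in> linf n" if "z \<in> G" for z using u(2) that by (rule bij_betw_apply)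
    have subL: "C0.subspace (linf n)"
      by (auto simp: C0.subspace_def linf_def c0_nth_0 c0_nth_add c0_nth_scale)
    have v: "linear_map_on (linf n) c0_scale s v" unfolding linear_map_on_def
    proof (intro conjI ballI allI)
      fix x y :: "'k c0" assume xy: "x \<in> linf n" "y \<in> linf n"
      have "u (v x + v y) = x + y" using u(1) vG xy uv unfolding linear_map_on_def by simp
      then show "v (x + y) = v x + v y" using vu[OF s.subspace_add[OF subG vG[OF xy(1)] vG[OF xy(2)]]] by simp
    next
      fix c and x :: "'k c0" assume x: "x \<in> linf n"
      have "u (s c (v x)) = c0_scale c x" using u(1) vG x uv unfolding linear_map_on_def by simp
      then show "v (c0_scale c x) = s c (v x)" using vu[OF s.subspace_scale[OF subG vG[OF x]], of c] by simp
    qed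
    define A where "A = op_norm_on G u"
    define b where "b = op_norm_on (linf n) v"
    have A: "A \<ge> 0" "\<And>z. z \<in> G \<Longrightarrow> norm (u z) \<le> A * norm z"
      using op_norm_on_bound[OF s C0 subG u(1,3)] by (auto simp: A_def)
    have b: "b \<ge> 0" "\<And>z. z \<in> linf n \<Longrightarrow> norm (v z) \<le> b * norm z"
      using op_norm_on_bound[OF C0 s subL v u(4)[folded v_def]] by (auto simp: b_def)
    have "0 \<le> A * b" using A(1) b(1) by simp
    moreover have "ennreal (A * b) < ennreal (l + 1)" using small by (simp only: A_def b_def v_def)
    ultimately have Ab: "A * b < l + 1" by (simp only: ennreal_less_iff)
    \<comment> \<open>The second summand makes \<open>a\<close> positive also for \<open>G = {0}\<close> and increases \<open>a * b\<close> by less than 1.\<close>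
    define a where "a = A + 1 / (b + 1)"
    have a: "a > 0" using A b by (simp add: a_def add_nonneg_pos)
    have "1 / (b + 1) * b \<le> 1" using b by (simp add: field_simps)
    then have ab: "a * b \<le> l + 2" using Ab by (simp add: a_def distrib_right)
    define e where "e k = v (c0_unit k)" for k
    define c where "c z k = c0_nth (u z) k" for z k
    have unit: "c0_unit k \<in> linf n" if "k < n" for k
      using that by (simp add: linf_def c0_unit.rep_eq)
    have comb: "lin_comb s {..<n} e f = v (\<Sum>k<n. c0_scale (f k) (c0_unit k))" for f
    proof -
      have "v (\<Sum>k\<in>M. c0_scale (f k) (c0_unit k)) = (\<Sum>k\<in>M. s (f k) (e k))" if "M \<subseteq> {..<n}" for M
        using finite_subset[OF that finite_lessThan] that
      proof (induction M rule: finite_induct)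
        case empty
        show ?case using linear_map_on_0[OF C0 s v C0.subspace_0[OF subL]] by simp
      next
        case (insert k M)
        have "(\<Sum>k\<in>M. c0_scale (f k) (c0_unit k)) \<in> linf n"
          using insert by (intro C0.subspace_sum[OF subL] C0.subspace_scale[OF subL] unit) auto
        moreover have "c0_scale (f k) (c0_unit k) \<in> linf n" "c0_unit k \<in> linf n"
          using insert by (auto intro!: C0.subspace_scale[OF subL] unit)
        moreover from this have "v (c0_scale (f k) (c0_unit k)) = s (f k) (v (c0_unit k))"
          using v unfolding linear_map_on_def by blast
        ultimately show ?case using insert v by (simp add: linear_map_on_def e_def)
      qed
      then show ?thesis by (simp add: lin_comb_def)
    qed
    have "coordinates s G n e c a b" unfolding coordinates_def
    proof (intro conjI ballI allI impI)
      show "s.subspace G" by (rule subG)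
      show "e k \<in> G" if "k < n" for k unfolding e_def by (rule vG[OF unit[OF that]])
      show "c (z + w) k = c z k + c w k" if "z \<in> G" "w \<in> G" for z w k
        using u(1) that by (simp add: linear_map_on_def c_def c0_nth_add)
      show "c (s \<alpha> z) k = \<alpha> * c z k" if "z \<in> G" for z \<alpha> k
        using u(1) that by (simp add: linear_map_on_def c_def c0_nth_scale)
      show "norm (c z k) \<le> a * norm z" if "z \<in> G" for z k
      proof -
        have "norm (c z k) \<le> norm (u z)" unfolding c_def by (rule norm_c0_nth_le)
        also have "\<dots> \<le> A * norm z" by (rule A(2)[OF that])
        also have "\<dots> \<le> a * norm z" using b(1) by (intro mult_right_mono) (auto simp: a_def)
        finally show ?thesis .
      qed
      show "z = lin_comb s {..<n} e (c z)" if "z \<in> G" for z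
      proof -
        have "(\<Sum>k<n. c0_scale (c z k) (c0_unit k)) = u z"
          by (rule c0_eqI) (use uL[OF that] in \<open>auto simp: c0_nth_unit_sum c_def linf_def\<close>)
        then show ?thesis using comb vu[OF that] by simp
      qed
      show "norm (lin_comb s {..<n} e f) \<le> b" if "\<forall>k<n. norm (f k) \<le> 1" for f
      proof -
        let ?y = "\<Sum>k<n. c0_scale (f k) (c0_unit k)"
        have "?y \<in> linf n" by (simp add: linf_def c0_nth_unit_sum)
        then have "norm (v ?y) \<le> b * norm ?y" by (rule b(2))
        also have "norm ?y \<le> 1" by (rule norm_c0_le) (use that in \<open>simp add: c0_nth_unit_sum\<close>)
        then have "b * norm ?y \<le> b" using b(1) by (simp add: mult_left_le)
        finally show ?thesis using comb by simp
      qed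
    qed
    then show "\<exists>G n e c a b. X \<subseteq> G \<and> G \<subseteq> S \<and> a > 0 \<and> b \<ge> 0 \<and> a * b \<le> l + 2 \<and> coordinates s G n e c a b"
      using XG G(3) a b(1) ab by blast
  qed
qed

text \<open>
  Norming functionals of the given vectors lie in a subspace of the dual that is isomorphic to
  \<open>\<ell>\<^sub>\<infinity>\<^sup>n\<close>; let \<open>e k\<close> be the images of the unit vectors. The values of the functionals \<open>e k\<close> are then
  coordinates in which the norms of these vectors are equivalent to \<open>\<ell>\<^sub>1\<close>-norms.
\<close>

lemma dual_L_infinity_imp_orlicz:
  fixes sF :: "'k::real_or_complex \<Rightarrow> 'f::real_normed_vector \<Rightarrow> 'f"
  assumes sF: "normed_space_over sF" and L: "L_infinity_space (dual sF) dual_scale"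
  obtains K where "K > 0" "orlicz (UNIV :: 'f set) K"
proof -
  interpret F: normed_space_over sF by fact
  obtain l where l: "l > 0" and coord: "\<And>X. finite X \<Longrightarrow> X \<subseteq> dual sF \<Longrightarrow>
      \<exists>G n e c a b. X \<subseteq> G \<and> G \<subseteq> dual sF \<and> a > 0 \<and> b \<ge> 0 \<and> a * b \<le> l \<and> coordinates dual_scale G n e c a b"
    by (rule L_infinity_coordinates[OF normed_space_over_dual subspace_dual[OF sF] L]) blast
  have norming: "\<exists>f. f \<in> dual sF \<and> norm f \<le> 1 \<and> norm (blinfun_apply f z) = norm z" for z
  proof -
    obtain \<phi> where \<phi>: "\<phi> \<in> dual_ball UNIV sF" "\<phi> z = of_real (norm z)" by (rule norming_functional[OF sF])
    have lin: "\<phi> (x + y) = \<phi> x + \<phi> y" "\<phi> (sF c x) = c * \<phi> x" "norm (\<phi> x) \<le> norm x" for x y c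
      using \<phi>(1) by (auto simp: dual_ball_def linear_map_on_def)
    have "\<phi> (r *\<^sub>R x) = r *\<^sub>R \<phi> x" for r x
      using lin(2)[of "of_real r" x] by (simp add: F.scale_of_real scaleR_conv_of_real)
    then have bl: "bounded_linear \<phi>"
      using lin by (intro bounded_linear_intro[where K = 1]) auto
    have ap: "blinfun_apply (Blinfun \<phi>) = \<phi>" by (rule bounded_linear_Blinfun_apply[OF bl])
    have "Blinfun \<phi> \<in> dual sF" by (simp add: dual_iff[OF sF] ap lin)
    moreover have "norm (Blinfun \<phi>) \<le> 1" by (rule norm_blinfun_bound) (simp_all add: ap lin)
    moreover have "norm (blinfun_apply (Blinfun \<phi>) z) = norm z" by (simp add: ap \<phi>(2))
    ultimately show ?thesis by blast
  qed
  have "orlicz (UNIV :: 'f set) (12 * l)" unfolding orlicz_def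
  proof (intro allI impI, elim conjE)
    fix M and y :: "nat \<Rightarrow> 'f" and D
    assume D: "\<forall>c. (\<forall>m. \<bar>c m\<bar> \<le> 1) \<longrightarrow> norm (\<Sum>m<M. c m *\<^sub>R y m) \<le> D"
    have D0: "D \<ge> 0" using D[rule_format, of "\<lambda>_. 0"] by simp
    have "\<forall>m. \<exists>f. f \<in> dual sF \<and> norm f \<le> 1 \<and> norm (blinfun_apply f (y m)) = norm (y m)" using norming by blast
    from choice[OF this] obtain f where f: "\<And>m. f m \<in> dual sF" "\<And>m. norm (f m) \<le> 1"
      "\<And>m. norm (blinfun_apply (f m) (y m)) = norm (y m)" by blast
    have "finite (f ` {..<M})" "f ` {..<M} \<subseteq> dual sF" using f by auto
    from coord[OF this] obtain G n e c a b where G: "f ` {..<M} \<subseteq> G" "G \<subseteq> dual sF"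
      and ab: "a > 0" "b \<ge> 0" "a * b \<le> l"
      and co: "coordinates dual_scale G n e c a b" by blast
    have "(\<Sum>m<M. (norm (y m))\<^sup>2) \<le> (12 * a * b * D)\<^sup>2"
    proof (rule orlicz_of_l1_coordinates[where g = "\<lambda>k. blinfun_apply (e k)" and L = "{..<n}"])
      show "linear (blinfun_apply (e k))" for k
        by (simp add: blinfun.bounded_linear_right bounded_linear.linear)
      show "(\<Sum>k<n. norm (blinfun_apply (e k) z)) \<le> b * norm z" for z
      proof -
        define h :: "nat \<Rightarrow> 'k" where "h k = phase (blinfun_apply (e k) z)" for k
        have h: "norm (h k) \<le> 1" "h k * blinfun_apply (e k) z = of_real (norm (blinfun_apply (e k) z))" for k
          by (simp_all add: h_def norm_phase_le phase_mult)
        have "blinfun_apply (lin_comb dual_scale {..<n} e h) z = of_real (\<Sum>k<n. norm (blinfun_apply (e k) z))"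
          by (simp add: lin_comb_def blinfun.sum_left h(2))
        then have "(\<Sum>k<n. norm (blinfun_apply (e k) z))
          = norm (blinfun_apply (lin_comb dual_scale {..<n} e h) z)"
          by (simp add: sum_nonneg del: of_real_sum)
        also have "\<dots> \<le> norm (lin_comb dual_scale {..<n} e h) * norm z" by (rule norm_blinfun)
        also have "\<dots> \<le> b * norm z"
          using co h(1) by (intro mult_right_mono) (simp_all add: coordinates_def)
        finally show ?thesis .
      qed
      show "norm (y m) \<le> a * (\<Sum>k<n. norm (blinfun_apply (e k) (y m)))" if "m < M" for m
      proof -
        have fG: "f m \<in> G" using G that by blast
        have eq: "f m = lin_comb dual_scale {..<n} e (c (f m))" using co fG by (simp add: coordinates_def)
        have ca: "norm (c (f m) k) \<le> a" for k
        proof -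
          have "norm (c (f m) k) \<le> a * norm (f m)" using co fG by (simp add: coordinates_def)
          also have "\<dots> \<le> a" using ab(1) f(2)[of m] by (simp add: mult_left_le)
          finally show ?thesis .
        qed
        have "norm (y m) = norm (blinfun_apply (lin_comb dual_scale {..<n} e (c (f m))) (y m))"
          using f(3)[of m] eq by simp
        also have "\<dots> = norm (\<Sum>k<n. c (f m) k * blinfun_apply (e k) (y m))"
          by (simp add: lin_comb_def blinfun.sum_left)
        also have "\<dots> \<le> (\<Sum>k<n. norm (c (f m) k * blinfun_apply (e k) (y m)))" by (rule norm_sum)
        also have "\<dots> \<le> (\<Sum>k<n. a * norm (blinfun_apply (e k) (y m)))"
          by (intro sum_mono) (simp add: norm_mult mult_right_mono ca)
        finally show ?thesis by (simp add: sum_distrib_left)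
      qed
    qed (use D ab in auto)
    also have "\<dots> \<le> (12 * l * D)\<^sup>2"
    proof (rule power_mono)
      have "a * b * D \<le> l * D" using ab D0 by (intro mult_right_mono)
      then show "12 * a * b * D \<le> 12 * l * D" by (simp add: mult.assoc)
    qed (use ab D0 in simp)
    finally show "(\<Sum>m<M. (norm (y m))\<^sup>2) \<le> (12 * l * D)\<^sup>2" .
  qed
  then show thesis using l that[of "12 * l"] by simp
qed

text \<open>
  The vectors \<open>x i\<close> lie in a subspace isomorphic to \<open>\<ell>\<^sub>\<infinity>\<^sup>n\<close>, on which \<open>T\<close> is dominated by the norm
  of \<open>L\<^sub>q(\<nu>)\<close>. The \<open>q\<close>-th powers of the norms of \<open>T (x i)\<close> thus sum up to at most an average over
  \<open>k\<close> of the power sums of the \<open>k\<close>-th coordinates. The coordinate functionals extend to the whole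
  space by the Hahn-Banach theorem, which brings in the weak summability of \<open>x\<close>.
\<close>

theorem (in banach_pair) mid_bounded_of_L_infinity:
  assumes E: "L_infinity_space UNIV sE" and F: "L_infinity_space (dual sF) dual_scale" and q: "q > 2"
    and T: "T \<in> operators sE sF"
  shows "\<exists>C. mid_bounded q sE sF T C"
proof -
  obtain l where l: "l > 0" and coord: "\<And>X. finite X \<Longrightarrow> X \<subseteq> UNIV \<Longrightarrow>
      \<exists>G n e c a b. X \<subseteq> G \<and> G \<subseteq> UNIV \<and> a > 0 \<and> b \<ge> 0 \<and> a * b \<le> l \<and> coordinates sE G n e c a b"
    by (rule L_infinity_coordinates[OF E.normed_space_over_axioms E.subspace_UNIV E]) blast
  obtain K where K: "K > 0" "orlicz (UNIV :: 'f set) K"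
    by (rule dual_L_infinity_imp_orlicz[OF F.normed_space_over_axioms F])
  obtain C where C: "C > 0" and dom: "lr_dominated sF UNIV q C"
    by (rule orlicz_imp_lr_dominated[OF F.normed_space_over_axioms F.subspace_UNIV K q])
  have TE: "blinfun_apply T (lin_comb sE I e f) = lin_comb sF I (\<lambda>k. blinfun_apply T (e k)) f"
    for I :: "nat set" and e f
    using T unfolding operators_iff[OF E.normed_space_over_axioms F.normed_space_over_axioms]
    by (simp add: lin_comb_def blinfun.sum_right)
  have "mid_bounded q sE sF T ((C * (norm T * l + 1)) powr q)" unfolding mid_bounded_def
  proof (intro allI impI, elim conjE)
    fix I J :: "nat set" and x :: "nat \<Rightarrow> 'e" and y :: "nat \<Rightarrow> 'f \<Rightarrow>\<^sub>L 'k"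
    assume I: "finite I" and J: "finite J" and x: "wk_bounded q UNIV sE I x 1"
      and y: "wk_bounded q (dual sF) dual_scale J y 1"
    obtain G n e c a b where G: "x ` I \<subseteq> G" and ab: "a > 0" "b \<ge> 0" "a * b \<le> l"
      and co: "coordinates sE G n e c a b"
      using coord[of "x ` I"] I by blast
    \<comment> \<open>A bound for the operator on \<open>\<ell>\<^sub>\<infinity>\<^sup>n\<close> that \<open>T\<close> induces; the second summand makes \<open>D\<close> positive
      and adds only 1 to \<open>a * D\<close>.\<close>
    define D where "D = norm T * b + 1 / a"
    have D: "D > 0" using ab by (simp add: D_def add_nonneg_pos)
    have aD: "a * D \<le> norm T * l + 1"
    proof -
      have "a * D = norm T * (a * b) + 1" using ab by (simp add: D_def distrib_left)
      then show ?thesis using ab by (simp add: mult_left_mono)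
    qed
    have bd: "norm (lin_comb sF {..<n} (\<lambda>k. blinfun_apply T (e k)) f) \<le> D"
      if "\<And>k. k \<in> {..<n} \<Longrightarrow> norm (f k) \<le> 1" for f
    proof -
      have "norm (blinfun_apply T (lin_comb sE {..<n} e f)) \<le> norm T * norm (lin_comb sE {..<n} e f)"
        by (rule norm_blinfun)
      also have "\<dots> \<le> norm T * b" using co that by (intro mult_left_mono) (auto simp: coordinates_def)
      also have "\<dots> \<le> D" using ab by (simp add: D_def)
      finally show ?thesis by (simp add: TE)
    qed
    obtain \<nu> where \<nu>: "\<And>k. \<nu> k > 0" "(\<Sum>k<n. \<nu> k) \<le> 1"
      and le: "\<And>f. norm (lin_comb sF {..<n} (\<lambda>k. blinfun_apply T (e k)) f)
        \<le> C * D * (\<Sum>k<n. \<nu> k * norm (f k) powr q) powr (1/q)"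
      by (rule lr_dominatedE[OF dom finite_lessThan UNIV_I D bd]) blast+
    have Tx: "norm (blinfun_apply T (x i)) powr q
      \<le> (C * D) powr q * (\<Sum>k<n. \<nu> k * norm (c (x i) k) powr q)" if "i \<in> I" for i
    proof -
      define R where "R = (\<Sum>k<n. \<nu> k * norm (c (x i) k) powr q)"
      have R: "R \<ge> 0" unfolding R_def using \<nu>(1)
        by (intro sum_nonneg mult_nonneg_nonneg) (auto simp: less_imp_le)
      have "x i = lin_comb sE {..<n} e (c (x i))"
        using co G that by (simp add: coordinates_def image_subset_iff)
      then have "norm (blinfun_apply T (x i)) \<le> C * D * R powr (1/q)"
        using le[of "c (x i)"] TE by (metis R_def)
      then have "norm (blinfun_apply T (x i)) powr q \<le> (C * D * R powr (1/q)) powr q"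
        using q by (intro powr_mono2) auto
      also have "\<dots> = (C * D) powr q * R" using R q C D by (simp add: powr_mult powr_powr)
      finally show ?thesis by (simp add: R_def)
    qed
    have coord_sum: "(\<Sum>i\<in>I. norm (c (x i) k) powr q) \<le> a powr q" for k
    proof -
      obtain \<phi> where \<phi>: "linear_map_on UNIV sE (*) \<phi>" "\<And>z. z \<in> G \<Longrightarrow> \<phi> z = c z k" "\<And>z. norm (\<phi> z) \<le> a * norm z"
      proof (rule hahn_banach[OF E.normed_space_over_axioms, of G a "\<lambda>z. c z k"])
        show "E.subspace G" "0 \<le> a" using co ab by (auto simp: coordinates_def)
        show "c (z + w) k = c z k + c w k" if "z \<in> G" "w \<in> G" for z w
          using co that by (simp add: coordinates_def)
        show "c (sE \<alpha> z) k = \<alpha> * c z k" if "z \<in> G" for \<alpha> z using co that by (simp add: coordinates_def)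
        show "norm (c z k) \<le> a * norm z" if "z \<in> G" for z using co that by (simp add: coordinates_def)
      qed blast
      have "(\<lambda>z. of_real (1 / a) * \<phi> z) \<in> dual_ball UNIV sE"
        using \<phi>(1,3) ab by (auto simp: dual_ball_def linear_map_on_def algebra_simps norm_mult
          norm_divide field_simps)
      moreover have "\<forall>\<phi>\<in>dual_ball UNIV sE. (\<Sum>i\<in>I. norm (\<phi> (x i)) powr q) \<le> 1"
        using x by (simp add: wk_bounded_def)
      ultimately have "(\<Sum>i\<in>I. norm (of_real (1 / a) * \<phi> (x i)) powr q) \<le> 1" by (rule bspec[rotated])
      moreover have "norm (of_real (1 / a) * \<phi> (x i)) powr q = norm (c (x i) k) powr q / a powr q"
        if "i \<in> I" for i
      proof -
        have "norm (of_real (1 / a) * \<phi> (x i)) = norm (c (x i) k) / a"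
          using \<phi>(2)[of "x i"] G that ab by (simp add: norm_mult norm_divide image_subset_iff)
        then show ?thesis using ab by (simp only: powr_divide norm_ge_zero less_imp_le)
      qed
      ultimately have "(\<Sum>i\<in>I. norm (c (x i) k) powr q) / a powr q \<le> 1" by (simp add: sum_divide_distrib)
      then show ?thesis using ab by (simp add: field_simps)
    qed
    have "(\<Sum>i\<in>I. \<Sum>j\<in>J. norm (blinfun_apply (y j) (blinfun_apply T (x i))) powr q)
      \<le> (\<Sum>i\<in>I. norm (blinfun_apply T (x i)) powr q)"
    proof (rule sum_mono)
      fix i
      let ?w = "blinfun_apply T (x i)"
      show "(\<Sum>j\<in>J. norm (blinfun_apply (y j) ?w) powr q) \<le> norm ?w powr q"
      proof (cases "?w = 0")
        case False
        define w where "w = (1 / norm ?w) *\<^sub>R ?w"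
        have "norm w \<le> 1" using False by (simp add: w_def)
        then have "(\<Sum>j\<in>J. norm (blinfun_apply (y j) w) powr q) \<le> 1"
          using bspec[OF conjunct2[OF y[unfolded wk_bounded_def]] evaluation_in_dual_ball] by blast
        moreover have "norm (blinfun_apply (y j) w) powr q
          = norm (blinfun_apply (y j) ?w) powr q / norm ?w powr q" for j
          by (simp add: w_def blinfun.scaleR_right powr_divide)
        ultimately have "(\<Sum>j\<in>J. norm (blinfun_apply (y j) ?w) powr q) / norm ?w powr q \<le> 1"
          by (simp add: sum_divide_distrib)
        then show ?thesis using False by (simp add: field_simps)
      qed simp
    qed
    also have "\<dots> \<le> (\<Sum>i\<in>I. (C * D) powr q * (\<Sum>k<n. \<nu> k * norm (c (x i) k) powr q))"
      by (rule sum_mono) (rule Tx)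
    also have "\<dots> = (C * D) powr q * (\<Sum>k<n. \<nu> k * (\<Sum>i\<in>I. norm (c (x i) k) powr q))"
      unfolding sum_distrib_left[symmetric] by (subst sum.swap) (simp only: sum_distrib_left)
    also have "\<dots> \<le> (C * D) powr q * (\<Sum>k<n. \<nu> k * a powr q)"
      using \<nu>(1) by (intro mult_left_mono sum_mono coord_sum) (auto simp: less_imp_le)
    also have "\<dots> \<le> (C * D) powr q * (1 * a powr q)"
      unfolding sum_distrib_right[symmetric] using \<nu>(2) by (intro mult_left_mono mult_right_mono) auto
    also have "\<dots> = (C * (a * D)) powr q"
      using C D ab by (simp add: powr_mult)
    also have "\<dots> \<le> (C * (norm T * l + 1)) powr q"
      using C D ab aD q by (intro powr_mono2 mult_left_mono) auto
    finally show "(\<Sum>i\<in>I. \<Sum>j\<in>J. norm (blinfun_apply (y j) (blinfun_apply T (x i))) powr q)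
      \<le> (C * (norm T * l + 1)) powr q" .
  qed
  then show ?thesis by blast
qed

section \<open>Operators from \<open>\<ell>\<^sub>1\<close> to \<open>c\<^sub>0\<close>\<close>

lemma l1_nth_add: "l1_nth (x + y) n = l1_nth x n + l1_nth y n"
  by transfer simp

lemma l1_nth_0: "l1_nth 0 n = 0"
  by transfer simp

lemma l1_nth_scale: "l1_nth (l1_scale c x) n = c * l1_nth x n"
  by transfer simp

lemma linear_l1_nth: "linear (\<lambda>x :: 'k::real_or_complex l1. l1_nth x n)"
  by standard (transfer; simp)+

lemma l1_nth_lin_comb: "l1_nth (lin_comb l1_scale I x f) n = (\<Sum>i\<in>I. f i * l1_nth (x i) n)"
  unfolding lin_comb_def linear_sum[OF linear_l1_nth] l1_nth_scale ..

lemma l1_eqI: "(\<And>n. l1_nth x n = l1_nth y n) \<Longrightarrow> x = y"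
  by (metis l1_nth_inject ext)

text \<open>
  On this subspace norms are finite sums of coordinates, so that the finite inequalities above
  apply. It contains all finite-dimensional coordinate subspaces, so that the constants do not
  depend on the dimension.
\<close>

definition l1_finite :: "'k::real_or_complex l1 set" where
  "l1_finite = {x. \<exists>L. \<forall>n\<ge>L. l1_nth x n = 0}"

lemma norm_l1_finite:
  assumes "\<And>n. n \<ge> L \<Longrightarrow> l1_nth x n = 0"
  shows "norm x = (\<Sum>n<L. norm (l1_nth x n))"
  unfolding norm_l1.rep_eq by (rule suminf_finite) (use assms in \<open>auto simp: not_less\<close>)

lemma l1_finite_common_support:
  assumes "finite I" "\<And>i. i \<in> I \<Longrightarrow> x i \<in> l1_finite"
  obtains L where "\<And>i n. i \<in> I \<Longrightarrow> n \<ge> L \<Longrightarrow> l1_nth (x i) n = 0"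
proof -
  have "\<forall>i\<in>I. \<exists>L. \<forall>n\<ge>L. l1_nth (x i) n = 0" using assms(2) by (simp add: l1_finite_def)
  then obtain L where L: "\<forall>i\<in>I. \<forall>n\<ge>L i. l1_nth (x i) n = 0" by (rule bchoice[THEN exE])
  show thesis
  proof (rule that[of "Max (insert 0 (L ` I))"])
    fix i n assume i: "i \<in> I" and n: "Max (insert 0 (L ` I)) \<le> n"
    have "L i \<le> Max (insert 0 (L ` I))" using i assms(1) by (intro Max_ge) auto
    then show "l1_nth (x i) n = 0" using L i n by auto
  qed
qed

lemma subspace_l1_finite: "module.subspace l1_scale (l1_finite :: 'k::real_or_complex l1 set)"
proof -
  interpret normed_space_over "l1_scale :: 'k \<Rightarrow> 'k l1 \<Rightarrow> 'k l1" by (rule normed_space_over_l1)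
  show ?thesis unfolding subspace_def
  proof (intro conjI ballI allI)
    show "(0 :: 'k l1) \<in> l1_finite" by (simp add: l1_finite_def l1_nth_0)
    fix x y :: "'k l1" assume "x \<in> l1_finite" "y \<in> l1_finite"
    then obtain L M where "\<forall>n\<ge>L. l1_nth x n = 0" "\<forall>n\<ge>M. l1_nth y n = 0" by (auto simp: l1_finite_def)
    then have "\<forall>n\<ge>max L M. l1_nth (x + y) n = 0" by (simp add: l1_nth_add)
    then show "x + y \<in> l1_finite" unfolding l1_finite_def by blast
  next
    fix c and x :: "'k l1" assume "x \<in> l1_finite"
    then show "l1_scale c x \<in> l1_finite" by (auto simp: l1_finite_def l1_nth_scale)
  qed
qed

lemma orlicz_l1_finite: "orlicz (l1_finite :: 'k::real_or_complex l1 set) 12"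
  unfolding orlicz_def
proof (intro allI impI, elim conjE)
  fix M and y :: "nat \<Rightarrow> 'k l1" and D
  assume y: "\<forall>m<M. y m \<in> l1_finite"
    and D: "\<forall>c. (\<forall>m. \<bar>c m\<bar> \<le> 1) \<longrightarrow> norm (\<Sum>m<M. c m *\<^sub>R y m) \<le> D"
  obtain L where L: "\<And>m n. m \<in> {..<M} \<Longrightarrow> n \<ge> L \<Longrightarrow> l1_nth (y m) n = 0"
    by (rule l1_finite_common_support[of "{..<M}" y]) (use y in auto)
  have "(\<Sum>m<M. (norm (y m))\<^sup>2) \<le> (12 * 1 * 1 * D)\<^sup>2"
  proof (rule orlicz_of_l1_coordinates[where g = "\<lambda>k x. l1_nth x k" and L = "{..<L}"])
    show "(\<Sum>k<L. norm (l1_nth z k)) \<le> 1 * norm z" for z :: "'k l1" using sum_norm_l1_le[of z L] by simp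
    show "norm (y m) \<le> 1 * (\<Sum>k<L. norm (l1_nth (y m) k))" if "m < M" for m
      using norm_l1_finite[of L "y m"] L that by simp
  qed (use linear_l1_nth D in auto)
  then show "(\<Sum>m<M. (norm (y m))\<^sup>2) \<le> (12 * D)\<^sup>2" by simp
qed

lemma l1_krivine:
  obtains \<kappa> :: real where "\<kappa> > 0"
    "\<And>(I :: nat set) (N :: nat set) U (A :: nat \<Rightarrow> nat \<Rightarrow> 'k::real_or_complex) L. finite I \<Longrightarrow> finite N \<Longrightarrow>
       (\<And>i. i \<in> I \<Longrightarrow> U i \<in> l1_finite) \<Longrightarrow>
       (\<And>f. (\<And>i. i \<in> I \<Longrightarrow> norm (f i) \<le> 1) \<Longrightarrow> norm (lin_comb l1_scale I U f) \<le> 1) \<Longrightarrow>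
       (\<And>i. i \<in> I \<Longrightarrow> (\<Sum>n\<in>N. (norm (A n i))\<^sup>2) \<le> 1) \<Longrightarrow>
       (\<Sum>l<L. L2_set (\<lambda>n. norm (l1_nth (lin_comb l1_scale I U (A n)) l)) N) \<le> \<kappa>"
proof -
  obtain C where C: "C > 0" and dom: "lr_dominated (l1_scale :: 'k \<Rightarrow> 'k l1 \<Rightarrow> 'k l1) l1_finite 4 C"
    by (rule orlicz_imp_lr_dominated[OF normed_space_over_l1[where ?'a
      = 'k] subspace_l1_finite _ orlicz_l1_finite, of 4]) auto
  show thesis
  proof (rule that[of "48 * 1 * C"])
    show "48 * 1 * C > 0" using C by simp
    fix I N :: "nat set" and U :: "nat \<Rightarrow> 'k l1" and A :: "nat \<Rightarrow> nat \<Rightarrow> 'k" and L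
    assume fin: "finite I" "finite N" and U: "\<And>i. i \<in> I \<Longrightarrow> U i \<in> l1_finite"
      and bd: "\<And>f. (\<And>i. i \<in> I \<Longrightarrow> norm (f i) \<le> 1) \<Longrightarrow> norm (lin_comb l1_scale I U f) \<le> 1"
      and A: "\<And>i. i \<in> I \<Longrightarrow> (\<Sum>n\<in>N. (norm (A n i))\<^sup>2) \<le> 1"
    obtain \<nu> where \<nu>: "\<And>i. \<nu> i > 0" "(\<Sum>i\<in>I. \<nu> i) \<le> 1"
      and le: "\<And>f. norm (lin_comb l1_scale I U f) \<le> C * 1 * (\<Sum>i\<in>I. \<nu> i * norm (f i) powr 4) powr (1/4)"
      by (rule lr_dominatedE[OF dom fin(1) U zero_less_one bd]) blast+
    show "(\<Sum>l<L. L2_set (\<lambda>n. norm (l1_nth (lin_comb l1_scale I U (A n)) l)) N) \<le> 48 * 1 * C"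
    proof (rule krivine_l1[where g = "\<lambda>l x. l1_nth x l"
      and B = 1, OF normed_space_over_l1 linear_l1_nth _ fin _ _ \<nu>])
      show "(\<Sum>k<L. norm (l1_nth z k)) \<le> 1 * norm z" for z :: "'k l1" using sum_norm_l1_le[of z L] by simp
      show "norm (lin_comb l1_scale I U f) \<le> C * (\<Sum>i\<in>I. \<nu> i * norm (f i) ^ 4) powr (1 / 4)" for f
        using le[of f] by simp
    qed (use C A in auto)
  qed
qed

lemma square_domination_homogeneous:
  fixes f :: "'i \<Rightarrow> 'k::real_or_complex"
  assumes s: "normed_space_over s" and I: "finite I" and \<mu>: "\<And>i. \<mu> i > 0"
    and dom: "\<And>f. (\<And>i. i \<in> I \<Longrightarrow> norm (f i) \<le> 1) \<Longrightarrow> (\<exists>i\<in>I. norm (f i) = 1) \<Longrightarrow>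
      (norm (lin_comb s I x f))\<^sup>2 \<le> (\<Sum>i\<in>I. \<mu> i * norm (f i) powr 2)"
  shows "norm (lin_comb s I x f) \<le> L2_set (\<lambda>i. sqrt (\<mu> i) * norm (f i)) I"
proof (cases "\<forall>i\<in>I. f i = 0")
  case True
  then have "lin_comb s I x f = 0"
  proof -
    interpret normed_space_over s by fact
    show ?thesis using True by (simp add: lin_comb_def)
  qed
  then show ?thesis by simp
next
  case False
  obtain t j where t: "t > 0" and le: "\<And>i. i \<in> I \<Longrightarrow> norm (f i) \<le> t" and j: "j \<in> I" "norm (f j) = t"
    by (rule max_norm_attained[OF I False]) (erule that, blast, assumption, assumption)
  define h where "h i = of_real (1 / t) * f i" for i
  have nh: "norm (h i) = norm (f i) / t" for i using t by (simp add: h_def norm_mult norm_divide)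
  have "(norm (lin_comb s I x h))\<^sup>2 \<le> (\<Sum>i\<in>I. \<mu> i * norm (h i) powr 2)"
    by (rule dom) (use le j t in \<open>auto simp: nh\<close>)
  also have "\<dots> = (\<Sum>i\<in>I. (sqrt (\<mu> i) * norm (f i))\<^sup>2) / t\<^sup>2"
    unfolding sum_divide_distrib
  proof (rule sum.cong)
    fix i
    have "(sqrt (\<mu> i))\<^sup>2 = \<mu> i" using \<mu>[of i] by simp
    then show "\<mu> i * norm (h i) powr 2 = (sqrt (\<mu> i) * norm (f i))\<^sup>2 / t\<^sup>2"
      using t by (simp add: nh power_divide power_mult_distrib)
  qed simp
  finally have "(norm (lin_comb s I x h))\<^sup>2 \<le> (\<Sum>i\<in>I. (sqrt (\<mu> i) * norm (f i))\<^sup>2) / t\<^sup>2" .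
  moreover have "lin_comb s I x h = (1 / t) *\<^sub>R lin_comb s I x f"
    unfolding h_def by (rule lin_comb_scale[OF s])
  ultimately have "(norm (lin_comb s I x f))\<^sup>2 \<le> (\<Sum>i\<in>I. (sqrt (\<mu> i) * norm (f i))\<^sup>2)"
    using t by (simp add: power_divide divide_le_cancel)
  then show ?thesis unfolding L2_set_def by (rule real_le_rsqrt)
qed

text \<open>
  The matrices \<open>U\<close> and \<open>V\<close> are operators \<open>u\<close> and \<open>v\<close> from \<open>\<ell>\<^sub>\<infinity>\<close> to \<open>\<ell>\<^sub>1\<close> of norm at most 1. With
  suitable signs \<open>A i j\<close>, the left-hand side is at most \<open>\<tau>\<close> times the sum over \<open>l\<close> of the norms of
  \<open>v (D l)\<close>, where \<open>D l j\<close> is the \<open>l\<close>-th coordinate of the image under \<open>u\<close> of the \<open>j\<close>-th column of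
  \<open>A\<close>. By \<open>l1_krivine\<close>, \<open>v\<close> is 2-summing, so the norm of \<open>v (D l)\<close> is at most the norm of \<open>D l\<close> in
  some \<open>L\<^sub>2(\<mu>)\<close>. The sum of these norms over \<open>l\<close> is the square function of the columns multiplied by
  \<open>sqrt (\<mu> j)\<close>, to which \<open>l1_krivine\<close> applies for \<open>u\<close>.
\<close>

theorem finite_grothendieck:
  obtains C :: real where "C > 0"
    "\<And>(I :: nat set) (J :: nat set) U V (t :: nat \<Rightarrow> nat \<Rightarrow> 'k::real_or_complex) \<tau> L M. finite I \<Longrightarrow> finite J \<Longrightarrow>
       (\<And>i. i \<in> I \<Longrightarrow> U i \<in> l1_finite) \<Longrightarrow> (\<And>j. j \<in> J \<Longrightarrow> V j \<in> l1_finite) \<Longrightarrow>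
       (\<And>f. (\<And>i. i \<in> I \<Longrightarrow> norm (f i) \<le> 1) \<Longrightarrow> norm (lin_comb l1_scale I U f) \<le> 1) \<Longrightarrow>
       (\<And>f. (\<And>j. j \<in> J \<Longrightarrow> norm (f j) \<le> 1) \<Longrightarrow> norm (lin_comb l1_scale J V f) \<le> 1) \<Longrightarrow>
       (\<And>k l. norm (t k l) \<le> \<tau>) \<Longrightarrow>
       (\<Sum>i\<in>I. \<Sum>j\<in>J. norm (\<Sum>l<L. \<Sum>k<M. t k l * l1_nth (U i) l * l1_nth (V j) k)) \<le> C * \<tau>"
proof -
  note s = normed_space_over_l1[where ?'a = 'k]
  obtain \<kappa> :: real where \<kappa>: "\<kappa> > 0" and kriv: "\<And>(I :: nat set) (N :: nat set) U (A :: nat \<Rightarrow> nat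
    \<Rightarrow> 'k) L. finite I \<Longrightarrow> finite N \<Longrightarrow>
       (\<And>i. i \<in> I \<Longrightarrow> U i \<in> l1_finite) \<Longrightarrow>
       (\<And>f. (\<And>i. i \<in> I \<Longrightarrow> norm (f i) \<le> 1) \<Longrightarrow> norm (lin_comb l1_scale I U f) \<le> 1) \<Longrightarrow>
       (\<And>i. i \<in> I \<Longrightarrow> (\<Sum>n\<in>N. (norm (A n i))\<^sup>2) \<le> 1) \<Longrightarrow>
       (\<Sum>l<L. L2_set (\<lambda>n. norm (l1_nth (lin_comb l1_scale I U (A n)) l)) N) \<le> \<kappa>"
    by (rule l1_krivine[where ?'k = 'k]) blast
  show thesis
  proof (rule that[of "sqrt 3 * \<kappa> * \<kappa>"])
    show "sqrt 3 * \<kappa> * \<kappa> > 0" using \<kappa> by simp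
    fix I J :: "nat set" and U V :: "nat \<Rightarrow> 'k l1" and t :: "nat \<Rightarrow> nat \<Rightarrow> 'k" and \<tau> L M
    assume fin: "finite I" "finite J" and U: "\<And>i. i \<in> I \<Longrightarrow> U i \<in> l1_finite"
      and V: "\<And>j. j \<in> J \<Longrightarrow> V j \<in> l1_finite"
      and bU: "\<And>f. (\<And>i. i \<in> I \<Longrightarrow> norm (f i) \<le> 1) \<Longrightarrow> norm (lin_comb l1_scale I U f) \<le> 1"
      and bV: "\<And>f. (\<And>j. j \<in> J \<Longrightarrow> norm (f j) \<le> 1) \<Longrightarrow> norm (lin_comb l1_scale J V f) \<le> 1"
      and t: "\<And>k l. norm (t k l) \<le> \<tau>"
    have \<tau>: "\<tau> \<ge> 0" using t[of 0 0] norm_ge_zero order_trans by blast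
    show "(\<Sum>i\<in>I. \<Sum>j\<in>J. norm (\<Sum>l<L. \<Sum>k<M. t k l * l1_nth (U i) l * l1_nth (V j) k)) \<le> sqrt 3 * \<kappa> * \<kappa> * \<tau>"
    proof (cases "J = {}")
      case True
      then show ?thesis using \<kappa> \<tau> by simp
    next
      case False
      let ?u = "lin_comb l1_scale I U" and ?v = "lin_comb l1_scale J V"
      have summing: "(\<Sum>m<N. (norm (?v (f m)))\<^sup>2) \<le> \<kappa>\<^sup>2"
        if f: "\<And>j. j \<in> J \<Longrightarrow> (\<Sum>m<N. norm (f m j) powr 2) \<le> 1" for N and f :: "nat \<Rightarrow> nat \<Rightarrow> 'k"
      proof -
        obtain H where H: "\<And>j n. j \<in> J \<Longrightarrow> n \<ge> H \<Longrightarrow> l1_nth (V j) n = 0"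
          by (rule l1_finite_common_support[OF fin(2), of V]) (erule V, rule that)
        have nv: "norm (?v (f m)) = (\<Sum>k<H. norm (l1_nth (?v (f m)) k))" for m
          by (rule norm_l1_finite) (simp add: l1_nth_lin_comb H)
        have "L2_set (\<lambda>m. norm (?v (f m))) {..<N} \<le> (\<Sum>k<H. L2_set (\<lambda>m. norm (l1_nth (?v (f m)) k)) {..<N})"
          unfolding nv by (rule L2_set_sum_le)
        also have "\<dots> \<le> \<kappa>" by (rule kriv[OF fin(2) finite_lessThan V bV]) (use f in auto)
        finally show ?thesis unfolding L2_set_def by (rule sqrt_le_D)
      qed
      obtain \<mu> :: "nat \<Rightarrow> real" where \<mu>: "\<And>j. \<mu> j > 0" "(\<Sum>j\<in>J. \<mu> j) \<le> 3 * \<kappa>\<^sup>2"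
        and dom: "\<And>f. (\<And>j. j \<in> J \<Longrightarrow> norm (f j) \<le> 1) \<Longrightarrow> (\<exists>j\<in>J. norm (f j) = 1) \<Longrightarrow>
          (norm (?v f))\<^sup>2 \<le> (\<Sum>j\<in>J. \<mu> j * norm (f j) powr 2)"
        using domination[OF s fin(2) False one_le_numeral \<kappa> summing] by blast
      note v_le = square_domination_homogeneous[OF s fin(2) \<mu>(1) dom]
      define b where "b i j = (\<Sum>l<L. \<Sum>k<M. t k l * l1_nth (U i) l * l1_nth (V j) k)" for i j
      define A where "A i j = phase (b i j)" for i j
      have A: "norm (A i j) \<le> 1" "A i j * b i j = of_real (norm (b i j))" for i j
        by (simp_all add: A_def norm_phase_le phase_mult)
      define D where "D l j = l1_nth (?u (\<lambda>i. A i j)) l" for l j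
      have eq: "of_real (\<Sum>i\<in>I. \<Sum>j\<in>J. norm (b i j)) = (\<Sum>l<L. \<Sum>k<M. t k l * l1_nth (?v (D l)) k)"
      proof -
        have "of_real (\<Sum>i\<in>I. \<Sum>j\<in>J. norm (b i j)) = (\<Sum>i\<in>I. \<Sum>j\<in>J. A i j * b i j)" by (simp add: A(2))
        also have "\<dots> = (\<Sum>i\<in>I. \<Sum>j\<in>J. \<Sum>l<L. \<Sum>k<M. A i j * (t k l * l1_nth (U i) l * l1_nth (V j) k))"
          by (simp only: b_def sum_distrib_left)
        also have "\<dots> = (\<Sum>i\<in>I. \<Sum>l<L. \<Sum>j\<in>J. \<Sum>k<M. A i j * (t k l * l1_nth (U i) l * l1_nth (V j) k))"
          by (intro sum.cong refl sum.swap)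
        also have "\<dots> = (\<Sum>l<L. \<Sum>i\<in>I. \<Sum>j\<in>J. \<Sum>k<M. A i j * (t k l * l1_nth (U i) l * l1_nth (V j) k))"
          by (rule sum.swap)
        also have "\<dots> = (\<Sum>l<L. \<Sum>i\<in>I. \<Sum>k<M. \<Sum>j\<in>J. A i j * (t k l * l1_nth (U i) l * l1_nth (V j) k))"
          by (intro sum.cong refl sum.swap)
        also have "\<dots> = (\<Sum>l<L. \<Sum>k<M. \<Sum>i\<in>I. \<Sum>j\<in>J. A i j * (t k l * l1_nth (U i) l * l1_nth (V j) k))"
          by (intro sum.cong refl sum.swap)
        also have "\<dots> = (\<Sum>l<L. \<Sum>k<M. \<Sum>j\<in>J. \<Sum>i\<in>I. A i j * (t k l * l1_nth (U i) l * l1_nth (V j) k))"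
          by (intro sum.cong refl sum.swap)
        also have "\<dots> = (\<Sum>l<L. \<Sum>k<M. t k l * l1_nth (?v (D l)) k)"
          by (intro sum.cong refl)
            (simp add: l1_nth_lin_comb D_def sum_distrib_left sum_distrib_right mult.assoc mult.left_commute)
        finally show ?thesis .
      qed
      have "0 \<le> (\<Sum>i\<in>I. \<Sum>j\<in>J. norm (b i j))" by (intro sum_nonneg) auto
      then have "(\<Sum>i\<in>I. \<Sum>j\<in>J. norm (b i j)) = norm (\<Sum>l<L. \<Sum>k<M. t k l * l1_nth (?v (D l)) k)"
        unfolding eq[symmetric] norm_of_real by (rule abs_of_nonneg[symmetric])
      also have "\<dots> \<le> (\<Sum>l<L. \<Sum>k<M. norm (t k l * l1_nth (?v (D l)) k))"
        by (rule order_trans[OF norm_sum]) (intro sum_mono norm_sum)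
      also have "\<dots> \<le> (\<Sum>l<L. \<Sum>k<M. \<tau> * norm (l1_nth (?v (D l)) k))"
        by (intro sum_mono) (simp add: norm_mult mult_right_mono t)
      also have "\<dots> = \<tau> * (\<Sum>l<L. \<Sum>k<M. norm (l1_nth (?v (D l)) k))" by (simp only: sum_distrib_left)
      also have "\<dots> \<le> \<tau> * (\<Sum>l<L. norm (?v (D l)))" by (intro mult_left_mono sum_mono sum_norm_l1_le \<tau>)
      also have "\<dots> \<le> \<tau> * (\<Sum>l<L. L2_set (\<lambda>j. sqrt (\<mu> j) * norm (D l j)) J)"
        by (intro mult_left_mono sum_mono v_le \<tau>)
      also have "(\<Sum>l<L. L2_set (\<lambda>j. sqrt (\<mu> j) * norm (D l j)) J) \<le> sqrt 3 * \<kappa> * \<kappa>"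
      proof -
        define a where "a = sqrt 3 * \<kappa>"
        have a: "a > 0" "a\<^sup>2 = 3 * \<kappa>\<^sup>2" using \<kappa> by (simp_all add: a_def power_mult_distrib)
        define A' where "A' j i = of_real (sqrt (\<mu> j) / a) * A i j" for j i
        have "sqrt (\<mu> j) * norm (D l j) = a * norm (l1_nth (?u (A' j)) l)" for l j
        proof -
          have "l1_nth (?u (A' j)) l = of_real (sqrt (\<mu> j) / a) * D l j"
            by (simp add: D_def l1_nth_lin_comb A'_def sum_distrib_left mult.assoc)
          then show ?thesis using a \<mu>(1)[of j] by (simp add: norm_mult norm_divide)
        qed
        then have "(\<Sum>l<L. L2_set (\<lambda>j. sqrt (\<mu> j) * norm (D l j)) J)
          = a * (\<Sum>l<L. L2_set (\<lambda>j. norm (l1_nth (?u (A' j)) l)) J)"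
          using a by (simp add: L2_set_right_distrib sum_distrib_left)
        also have "(\<Sum>l<L. L2_set (\<lambda>j. norm (l1_nth (?u (A' j)) l)) J) \<le> \<kappa>"
        proof (rule kriv[OF fin U bU])
          fix i
          have "(\<Sum>j\<in>J. (norm (A' j i))\<^sup>2) \<le> (\<Sum>j\<in>J. \<mu> j / a\<^sup>2)"
          proof (rule sum_mono)
            fix j
            have "norm (A' j i) \<le> sqrt (\<mu> j) / a"
              using A(1)[of i j] a \<mu>(1)[of j]
                by (simp add: A'_def norm_mult norm_divide mult_left_le divide_right_mono)
            then have "(norm (A' j i))\<^sup>2 \<le> (sqrt (\<mu> j) / a)\<^sup>2" by (intro power_mono) auto
            then show "(norm (A' j i))\<^sup>2 \<le> \<mu> j / a\<^sup>2" using \<mu>(1)[of j] by (simp add: power_divide)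
          qed
          also have "\<dots> = (\<Sum>j\<in>J. \<mu> j) / a\<^sup>2" by (simp only: sum_divide_distrib)
          also have "\<dots> \<le> 1" using \<mu>(2) \<kappa> unfolding a(2) by (simp add: field_simps)
          finally show "(\<Sum>j\<in>J. (norm (A' j i))\<^sup>2) \<le> 1" .
        qed auto
        finally have "(\<Sum>l<L. L2_set (\<lambda>j. sqrt (\<mu> j) * norm (D l j)) J) \<le> a * \<kappa>"
          using a(1) by (simp add: mult_left_mono)
        then show ?thesis by (simp only: a_def)
      qed
      finally have "(\<Sum>i\<in>I. \<Sum>j\<in>J. norm (b i j)) \<le> \<tau> * (sqrt 3 * \<kappa> * \<kappa>)"
        using \<tau> by (simp add: mult_left_mono)
      then show ?thesis by (simp only: b_def mult.commute[of \<tau>])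
    qed
  qed
qed

lift_definition l1_cut :: "nat \<Rightarrow> 'k::real_or_complex l1 \<Rightarrow> 'k l1" is "\<lambda>L x n. if n < L then x n else 0"
  by (rule summable_comparison_test'[where N = 0]) auto

lift_definition l1_unit :: "nat \<Rightarrow> 'k::real_or_complex l1" is "\<lambda>k n. if n = k then 1 else 0"
  by (rule summable_finite[of "{_}"]) auto

lemma norm_l1_cut_le: "norm (l1_cut L x) \<le> norm x"
  by transfer (rule suminf_le, auto intro: summable_comparison_test'[where N = 0])

lemma l1_cut_lin_comb: "lin_comb l1_scale I (\<lambda>i. l1_cut L (x i)) f = l1_cut L (lin_comb l1_scale I x f)"
  by (rule l1_eqI) (simp add: l1_nth_lin_comb l1_cut.rep_eq)

lemma l1_cut_finite: "l1_cut L x \<in> l1_finite"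
  by (auto simp: l1_finite_def l1_cut.rep_eq intro!: exI[of _ L])

lemma norm_l1_unit: "norm (l1_unit k :: 'k::real_or_complex l1) = 1"
  by (subst norm_l1_finite[of "Suc k"]) (auto simp: l1_unit.rep_eq)

lemma l1_cut_eq: "l1_cut L x = (\<Sum>l<L. l1_scale (l1_nth x l) (l1_unit l))"
proof (rule l1_eqI)
  fix n
  have "(\<Sum>l<L. l1_nth x l * (if n = l then 1 else 0)) = (if n < L then l1_nth x n else 0)"
    by (simp add: if_distrib[of "(*) _"] sum.delta' cong: if_cong)
  then show "l1_nth (l1_cut L x) n = l1_nth (\<Sum>l<L. l1_scale (l1_nth x l) (l1_unit l)) n"
    using l1_nth_lin_comb[of "{..<L}" l1_unit "l1_nth x" n]
      by (simp add: lin_comb_def l1_cut.rep_eq l1_unit.rep_eq)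
qed

lemma l1_cut_tendsto: "(\<lambda>L. l1_cut L x) \<longlonglongrightarrow> x"
proof -
  have eq: "norm (x - l1_cut L x) = norm x - (\<Sum>n<L. norm (l1_nth x n))" for L
  proof -
    have "norm (x - l1_cut L x) = (\<Sum>n. norm (l1_nth x n) - (if n \<in> {..<L} then norm (l1_nth x n) else 0))"
      unfolding norm_l1.rep_eq l1_nth_minus l1_cut.rep_eq by (rule suminf_cong) auto
    also have "\<dots> = (\<Sum>n. norm (l1_nth x n)) - (\<Sum>n. if n \<in> {..<L} then norm (l1_nth x n) else 0)"
      by (rule suminf_diff[symmetric]) (auto intro: summable_l1 summable_If_finite_set)
    also have "(\<Sum>n. if n \<in> {..<L} then norm (l1_nth x n) else 0) = (\<Sum>n<L. norm (l1_nth x n))"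
      by (rule sums_unique[symmetric]) (rule sums_If_finite_set, simp)
    finally show ?thesis by (simp add: norm_l1.rep_eq)
  qed
  have "(\<lambda>L. norm x - (\<Sum>n<L. norm (l1_nth x n))) \<longlonglongrightarrow> norm x - norm x"
    unfolding norm_l1.rep_eq by (intro tendsto_diff tendsto_const summable_LIMSEQ summable_l1)
  then have "(\<lambda>L. norm (l1_cut L x - x)) \<longlonglongrightarrow> 0"
    by (simp add: eq norm_minus_commute)
  then show ?thesis by (simp add: tendsto_norm_zero_iff LIM_zero_cancel)
qed

definition c0_cut :: "nat \<Rightarrow> 'k::real_or_complex c0 \<Rightarrow> 'k c0" where
  "c0_cut M w = (\<Sum>k<M. c0_scale (c0_nth w k) (c0_unit k))"

lemma c0_cut_tendsto: "(\<lambda>M. c0_cut M w) \<longlonglongrightarrow> w"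
proof (rule LIMSEQ_I)
  fix r :: real assume r: "r > 0"
  have "c0_nth w \<longlonglongrightarrow> 0" using c0_nth[of w] by simp
  then obtain N where N: "\<And>n. n \<ge> N \<Longrightarrow> norm (c0_nth w n) < r / 2"
    using LIMSEQ_D[of "c0_nth w" 0 "r / 2"] r by auto
  have "norm (c0_cut M w - w) \<le> r / 2" if "M \<ge> N" for M
  proof (rule norm_c0_le)
    fix n
    show "norm (c0_nth (c0_cut M w - w) n) \<le> r / 2"
      using N[of n] that r by (auto simp: c0_nth_minus c0_cut_def c0_nth_unit_sum)
  qed
  then have "norm (c0_cut M w - w) < r" if "M \<ge> N" for M using that r by fastforce
  then show "\<exists>N. \<forall>M\<ge>N. norm (c0_cut M w - w) < r" by blast
qed

text \<open>
  Functionals on \<open>c\<^sub>0\<close> are elements of \<open>\<ell>\<^sub>1\<close>, so that \<open>x\<close> and \<open>y\<close> both become operators from \<open>\<ell>\<^sub>\<infinity>\<close>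
  to \<open>\<ell>\<^sub>1\<close>, while \<open>T\<close> is a bounded matrix. The inequality for matrices is applied to finitely many
  coordinates of \<open>x i\<close> and of the images in \<open>c\<^sub>0\<close>; both truncations converge in norm.
\<close>

theorem mid_bounded_l1_c0:
  fixes T :: "'k::real_or_complex l1 \<Rightarrow>\<^sub>L 'k c0"
  assumes T: "T \<in> operators l1_scale c0_scale"
  shows "\<exists>C. mid_bounded 1 l1_scale c0_scale T C"
proof -
  note l1 = normed_space_over_l1[where ?'a = 'k] and c0 = normed_space_over_c0[where ?'a = 'k]
  interpret banach_pair "l1_scale :: 'k \<Rightarrow> 'k l1 \<Rightarrow> 'k l1" "c0_scale :: 'k \<Rightarrow> 'k c0 \<Rightarrow> 'k c0"
    by (intro banach_pair.intro l1 c0)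
  obtain C :: real where C: "C > 0" and groth: "\<And>(I :: nat set) (J :: nat set) U V (t :: nat \<Rightarrow> nat
    \<Rightarrow> 'k) \<tau> L M. finite I \<Longrightarrow> finite J \<Longrightarrow>
       (\<And>i. i \<in> I \<Longrightarrow> U i \<in> l1_finite) \<Longrightarrow> (\<And>j. j \<in> J \<Longrightarrow> V j \<in> l1_finite) \<Longrightarrow>
       (\<And>f. (\<And>i. i \<in> I \<Longrightarrow> norm (f i) \<le> 1) \<Longrightarrow> norm (lin_comb l1_scale I U f) \<le> 1) \<Longrightarrow>
       (\<And>f. (\<And>j. j \<in> J \<Longrightarrow> norm (f j) \<le> 1) \<Longrightarrow> norm (lin_comb l1_scale J V f) \<le> 1) \<Longrightarrow>
       (\<And>k l. norm (t k l) \<le> \<tau>) \<Longrightarrow>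
       (\<Sum>i\<in>I. \<Sum>j\<in>J. norm (\<Sum>l<L. \<Sum>k<M. t k l * l1_nth (U i) l * l1_nth (V j) k)) \<le> C * \<tau>"
    by (rule finite_grothendieck[where ?'k = 'k]) blast
  have "mid_bounded 1 l1_scale c0_scale T (C * norm T)" unfolding mid_bounded_def
  proof (intro allI impI, elim conjE)
    fix I J :: "nat set" and x :: "nat \<Rightarrow> 'k l1" and y :: "nat \<Rightarrow> 'k c0 \<Rightarrow>\<^sub>L 'k"
    assume I: "finite I" and J: "finite J" and x: "wk_bounded 1 UNIV l1_scale I x 1"
      and y: "wk_bounded 1 (dual c0_scale) dual_scale J y 1"
    have yd: "y j \<in> dual c0_scale" if "j \<in> J" for j using y that by (simp add: wk_bounded_def)
    define V where "V M j = (\<Sum>k<M. l1_scale (blinfun_apply (y j) (c0_unit k)) (l1_unit k))" for M j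
    have Vn: "l1_nth (V M j) k = (if k < M then blinfun_apply (y j) (c0_unit k) else 0)" for M j k
    proof -
      have "(\<Sum>l<M. blinfun_apply (y j) (c0_unit l) * (if k = l then 1 else 0))
        = (if k < M then blinfun_apply (y j) (c0_unit k) else 0)"
        by (simp add: if_distrib[of "(*) _"] sum.delta' cong: if_cong)
      then show ?thesis
        using l1_nth_lin_comb[of "{..<M}" l1_unit "\<lambda>k. blinfun_apply (y j) (c0_unit k)" k]
        by (simp add: V_def lin_comb_def l1_unit.rep_eq)
    qed
    have Vf: "V M j \<in> l1_finite" for M j by (auto simp: l1_finite_def Vn intro!: exI[of _ M])
    have Vbound: "norm (lin_comb l1_scale J (V M) f) \<le> 1" if f: "\<And>j. j \<in> J \<Longrightarrow> norm (f j) \<le> 1" for M f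
    proof -
      define w where "w = lin_comb dual_scale J y f"
      have w1: "norm w \<le> 1" unfolding w_def by (rule DS.lin_comb_le_weak1[OF norming_dual y f])
      have "w \<in> dual c0_scale"
        unfolding w_def lin_comb_def by (intro DS.subspace_sum[OF DS.S] DS.subspace_scale[OF DS.S] yd)
      then have wlin: "blinfun_apply w (c0_scale c z) = c * blinfun_apply w z" for c z
        by (simp add: dual_iff[OF c0])
      have nth: "l1_nth (lin_comb l1_scale J (V M) f) k
        = (if k < M then blinfun_apply w (c0_unit k) else 0)" for k
      proof -
        have "blinfun_apply w (c0_unit k) = (\<Sum>j\<in>J. f j * blinfun_apply (y j) (c0_unit k))"
          by (simp add: w_def lin_comb_def blinfun.sum_left)
        then show ?thesis unfolding l1_nth_lin_comb Vn by simp
      qed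
      define h where "h k = phase (blinfun_apply w (c0_unit k))" for k
      have h: "norm (h k) \<le> 1" "h k * blinfun_apply w (c0_unit k)
        = of_real (norm (blinfun_apply w (c0_unit k)))" for k
        by (simp_all add: h_def norm_phase_le phase_mult)
      let ?z = "\<Sum>k<M. c0_scale (h k) (c0_unit k)"
      have "norm (lin_comb l1_scale J (V M) f) = (\<Sum>k<M. norm (blinfun_apply w (c0_unit k)))"
        by (subst norm_l1_finite[of M]) (auto simp: nth)
      also have "\<dots> = norm (blinfun_apply w ?z)"
      proof -
        have "blinfun_apply w ?z = of_real (\<Sum>k<M. norm (blinfun_apply w (c0_unit k)))"
          by (simp add: blinfun.sum_right wlin h(2))
        then show ?thesis by (simp add: sum_nonneg del: of_real_sum)
      qed
      also have "\<dots> \<le> norm w * norm ?z" by (rule norm_blinfun)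
      also have "\<dots> \<le> 1 * 1"
        by (intro mult_mono w1 norm_c0_le) (auto simp: c0_nth_unit_sum h(1))
      finally show ?thesis by simp
    qed
    have Ubound: "norm (lin_comb l1_scale I (\<lambda>i. l1_cut L (x i)) f) \<le> 1"
      if "\<And>i. i \<in> I \<Longrightarrow> norm (f i) \<le> 1" for L f
      unfolding l1_cut_lin_comb
      by (rule order_trans[OF norm_l1_cut_le ES.lin_comb_le_weak1[OF norming_UNIV[OF l1] x that]])
    have Tlin: "blinfun_apply T (l1_scale c z) = c0_scale c (blinfun_apply T z)" for c z
      using T by (simp add: operators_iff[OF l1 c0])
    have fin: "(\<Sum>i\<in>I. \<Sum>j\<in>J. norm (blinfun_apply (y j) (c0_cut M (blinfun_apply T (l1_cut L (x i))))))
      \<le> C * norm T" for L M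
    proof -
      define t where "t k l = c0_nth (blinfun_apply T (l1_unit l)) k" for k l
      have t: "norm (t k l) \<le> norm T" for k l
      proof -
        have "norm (t k l) \<le> norm (blinfun_apply T (l1_unit l))" unfolding t_def by (rule norm_c0_nth_le)
        also have "\<dots> \<le> norm T * norm (l1_unit l :: 'k l1)" by (rule norm_blinfun)
        finally show ?thesis by (simp add: norm_l1_unit)
      qed
      have "blinfun_apply (y j) (c0_cut M (blinfun_apply T (l1_cut L (x i))))
          = (\<Sum>l<L. \<Sum>k<M. t k l * l1_nth (l1_cut L (x i)) l * l1_nth (V M j) k)" if j: "j \<in> J" for i j
      proof -
        have ylin: "blinfun_apply (y j) (c0_scale c z) = c * blinfun_apply (y j) z" for c z
          using yd[OF j] by (simp add: dual_iff[OF c0])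
        have "c0_nth (blinfun_apply T (l1_cut L (x i))) k = (\<Sum>l<L. l1_nth (x i) l * t k l)" for k
          by (simp add: l1_cut_eq blinfun.sum_right Tlin c0_nth_sum c0_nth_scale t_def)
        then have "blinfun_apply (y j) (c0_cut M (blinfun_apply T (l1_cut L (x i))))
            = (\<Sum>k<M. \<Sum>l<L. l1_nth (x i) l * t k l * blinfun_apply (y j) (c0_unit k))"
          by (simp add: c0_cut_def blinfun.sum_right ylin sum_distrib_right)
        also have "\<dots> = (\<Sum>l<L. \<Sum>k<M. l1_nth (x i) l * t k l * blinfun_apply (y j) (c0_unit k))"
          by (rule sum.swap)
        also have "\<dots> = (\<Sum>l<L. \<Sum>k<M. t k l * l1_nth (l1_cut L (x i)) l * l1_nth (V M j) k)"
          by (intro sum.cong refl) (simp add: Vn l1_cut.rep_eq)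
        finally show ?thesis .
      qed
      then have "(\<Sum>i\<in>I. \<Sum>j\<in>J. norm (blinfun_apply (y j) (c0_cut M (blinfun_apply T (l1_cut L (x i))))))
          = (\<Sum>i\<in>I. \<Sum>j\<in>J. norm (\<Sum>l<L. \<Sum>k<M. t k l * l1_nth (l1_cut L (x i)) l * l1_nth (V M j) k))"
        by (intro sum.cong refl) simp
      also have "\<dots> \<le> C * norm T"
        by (rule groth[OF I J l1_cut_finite Vf Ubound Vbound t])
      finally show ?thesis .
    qed
    have fin2: "(\<Sum>i\<in>I. \<Sum>j\<in>J. norm (blinfun_apply (y j) (blinfun_apply T (l1_cut L (x i))))) \<le> C * norm T"
      for L
    proof (rule LIMSEQ_le_const2)
      show "(\<lambda>M. \<Sum>i\<in>I. \<Sum>j\<in>J. norm (blinfun_apply (y j) (c0_cut M (blinfun_apply T (l1_cut L (x i))))))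
          \<longlonglongrightarrow> (\<Sum>i\<in>I. \<Sum>j\<in>J. norm (blinfun_apply (y j) (blinfun_apply T (l1_cut L (x i)))))"
        by (intro tendsto_sum tendsto_norm bounded_linear.tendsto[OF blinfun.bounded_linear_right]
          c0_cut_tendsto)
    qed (use fin in blast)
    have "(\<Sum>i\<in>I. \<Sum>j\<in>J. norm (blinfun_apply (y j) (blinfun_apply T (x i)))) \<le> C * norm T"
    proof (rule LIMSEQ_le_const2)
      show "(\<lambda>L. \<Sum>i\<in>I. \<Sum>j\<in>J. norm (blinfun_apply (y j) (blinfun_apply T (l1_cut L (x i)))))
          \<longlonglongrightarrow> (\<Sum>i\<in>I. \<Sum>j\<in>J. norm (blinfun_apply (y j) (blinfun_apply T (x i))))"
        by (intro tendsto_sum tendsto_norm bounded_linear.tendsto[OF blinfun.bounded_linear_right]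
          l1_cut_tendsto)
    qed (use fin2 in blast)
    then show "(\<Sum>i\<in>I. \<Sum>j\<in>J. norm (blinfun_apply (y j) (blinfun_apply T (x i))) powr 1) \<le> C * norm T" by simp
  qed
  then show ?thesis by blast
qed

section \<open>Inclusions and coincidences of the classes\<close>

context banach_pair
begin

lemma W_mid_subsetI:
  assumes "1 \<le> p" "1 \<le> q" "\<And>T C. mid_bounded p sE sF T C \<Longrightarrow> \<exists>C'. mid_bounded q sE sF T C'"
  shows "W_mid p sE sF \<subseteq> W_mid q sE sF"
  unfolding subset_iff W_mid_iff_mid_bounded[OF assms(1)] W_mid_iff_mid_bounded[OF assms(2)]
  using assms(3) by blast

lemma W_mid_mono:
  assumes p: "1 \<le> p" "p \<le> q" "q \<le> 2"
  shows "W_mid p sE sF \<subseteq> W_mid q sE sF"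
proof (cases "p = q")
  case False
  then have "p < q" using p by simp
  then show ?thesis using p by (intro W_mid_subsetI mid_bounded_mono[of p q]) auto
qed simp

lemma W_mid_eq_of_cotype_2:
  assumes pq: "1 \<le> p" "p < 2" "1 \<le> q" "q < 2" and cotype: "cotype_2 (UNIV :: 'e set)" "cotype_2 (dual sF)"
  shows "W_mid p sE sF = W_mid q sE sF"
proof -
  obtain KE where KE: "KE > 0" "orlicz (UNIV :: 'e set) KE" by (rule cotype_2_imp_orlicz[OF cotype(1)])
  obtain KF where KF: "KF > 0" "orlicz (dual sF) KF" by (rule cotype_2_imp_orlicz[OF cotype(2)])
  have down: "W_mid r sE sF \<subseteq> W_mid 1 sE sF" if r: "1 \<le> r" "r < 2" for r
  proof (cases "r = 1")
    case False
    then have "1 < r" using r by simp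
    then show ?thesis using r by (intro W_mid_subsetI mid_bounded_1_of_orlicz[OF KE KF, of r]) auto
  qed simp
  have eq: "W_mid r sE sF = W_mid 1 sE sF" if "1 \<le> r" "r < 2" for r
    by (rule equalityI[OF down[OF that] W_mid_mono]) (use that in auto)
  show ?thesis unfolding eq[OF pq(1,2)] eq[OF pq(3,4)] ..
qed

lemma W_mid_mono_of_L_infinity:
  assumes pq: "1 \<le> p" "p \<le> q" and E: "L_infinity_space UNIV sE" and F: "L_infinity_space (dual sF) dual_scale"
  shows "W_mid p sE sF \<subseteq> W_mid q sE sF"
proof (cases "q \<le> 2")
  case True
  then show ?thesis using W_mid_mono pq by blast
next
  case False
  then have "q > 2" by simp
  then have "operators sE sF \<subseteq> W_mid q sE sF"
    unfolding subset_iff W_mid_iff_mid_bounded[OF order_trans[OF pq]]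
    using mid_bounded_of_L_infinity[OF E F] by blast
  then show ?thesis unfolding W_mid_def by blast
qed

end

lemma W_mid_l1_c0:
  assumes p: "1 \<le> p" "p \<le> 2"
  shows "W_mid p (l1_scale :: 'k::real_or_complex \<Rightarrow> 'k l1 \<Rightarrow> 'k l1) (c0_scale :: 'k \<Rightarrow> 'k c0 \<Rightarrow> 'k c0) =
          operators l1_scale c0_scale"
proof -
  interpret banach_pair "l1_scale :: 'k \<Rightarrow> 'k l1 \<Rightarrow> 'k l1" "c0_scale :: 'k \<Rightarrow> 'k c0 \<Rightarrow> 'k c0"
    by (intro banach_pair.intro normed_space_over_l1 normed_space_over_c0)
  have "operators l1_scale c0_scale \<subseteq> W_mid 1 (l1_scale :: 'k \<Rightarrow> 'k l1 \<Rightarrow> 'k l1) (c0_scale :: 'k \<Rightarrow> 'k c0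
    \<Rightarrow> 'k c0)"
    unfolding subset_iff W_mid_iff_mid_bounded[OF order_refl] using mid_bounded_l1_c0 by blast
  moreover have "W_mid 1 l1_scale c0_scale \<subseteq> W_mid p (l1_scale :: 'k \<Rightarrow> 'k l1 \<Rightarrow> 'k l1) (c0_scale :: 'k
    \<Rightarrow> 'k c0 \<Rightarrow> 'k c0)"
    by (rule W_mid_mono) (use p in auto)
  moreover have "W_mid p l1_scale c0_scale \<subseteq> (operators l1_scale c0_scale :: ('k l1 \<Rightarrow>\<^sub>L 'k c0) set)"
    unfolding W_mid_def by blast
  ultimately show ?thesis by blast
qed

theorem corollary5p6:
  fixes sE :: "'k::real_or_complex \<Rightarrow> 'e::banach \<Rightarrow> 'e"
    and sF :: "'k \<Rightarrow> 'f::banach \<Rightarrow> 'f"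
  assumes "normed_space_over sE" and "normed_space_over sF"
  shows "(\<forall>p q :: real. 1 \<le> p \<and> p \<le> q \<and> q < 2 \<longrightarrow> W_mid p sE sF \<subseteq> W_mid q sE sF) \<and>
    (\<forall>p q :: real. 1 \<le> p \<and> p < 2 \<and> 1 \<le> q \<and> q < 2 \<and>
        cotype_2 (UNIV :: 'e set) \<and> cotype_2 (dual sF) \<longrightarrow>
        W_mid p sE sF = W_mid q sE sF) \<and>
    (\<forall>p q :: real. 1 \<le> p \<and> p \<le> q \<and>
        L_infinity_space UNIV sE \<and> L_infinity_space (dual sF) dual_scale \<longrightarrow>
        W_mid p sE sF \<subseteq> W_mid q sE sF) \<and>
    (\<forall>p :: real. 1 \<le> p \<and> p \<le> 2 \<longrightarrow>
        W_mid p (l1_scale :: 'k \<Rightarrow> 'k l1 \<Rightarrow> 'k l1) (c0_scale :: 'k \<Rightarrow> 'k c0 \<Rightarrow> 'k c0) =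
          operators l1_scale c0_scale)"
proof -
  interpret banach_pair sE sF by (intro banach_pair.intro assms)
  show ?thesis
  proof (intro conjI allI impI; elim conjE)
    fix p q :: real
    show "W_mid p sE sF \<subseteq> W_mid q sE sF" if "1 \<le> p" "p \<le> q" "q < 2"
      using that by (intro W_mid_mono) auto
    show "W_mid p sE sF = W_mid q sE sF"
      if "1 \<le> p" "p < 2" "1 \<le> q" "q < 2" "cotype_2 (UNIV :: 'e set)" "cotype_2 (dual sF)"
      using that by (rule W_mid_eq_of_cotype_2)
    show "W_mid p sE sF \<subseteq> W_mid q sE sF"
      if "1 \<le> p" "p \<le> q" "L_infinity_space UNIV sE" "L_infinity_space (dual sF) dual_scale"
      using that by (rule W_mid_mono_of_L_infinity)
    show "W_mid p (l1_scale :: 'k \<Rightarrow> 'k l1 \<Rightarrow> 'k l1) (c0_scale :: 'k \<Rightarrow> 'k c0 \<Rightarrow> 'k c0) = operators l1_scale c0_scale"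
      if "1 \<le> p" "p \<le> 2"
      using that by (rule W_mid_l1_c0)
  qed
qed

end
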